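(* Let $G$ be a finite $2$-Frobenius group, with normal subgroups $K$ and $L$ of $G$ such that $L$ is a Frobenius group with Frobenius kernel $K$ and $G/K$ is a Frobenius group with Frobenius kernel $L/K$. Let $p$ be a prime number, and assume that $K$ is a $p$-group and that $G/L$ is not a $p$-group. Then the number of connected components of the cyclic graph $\Delta(G)$ is $$|K|+|L:K|+m_{p}^{\ast},$$ where $m_{p}^{\ast}$ is the number of subgroups of order $p$ in $G$ that are not centralized by any element of $G$ of prime order other than $p$.
   Context: All groups are finite. A group $G$ is a $2$-Frobenius group if it has normal subgroups $K$ and $L$ such that $L$ is a Frobenius group with Frobenius kernel $K$ and $G/K$ is a Frobenius group with Frobenius kernel $L/K$. The cyclic graph $\Delta(G)$ of a group $G$ is the graph whose vertex set is $G\setminus\{1\}$, with an edge between distinct vertices $x$ and $y$ if and only if the subgroup $\langle x,y\rangle$ is cyclic. *)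

theory Defs
  imports "HOL-Algebra.Elementary_Groups" "HOL-Algebra.Multiplicative_Group"
    "HOL-Computational_Algebra.Primes" "Graph_Theory.Digraph_Component"
begin

definition frobenius_complement :: "('a, 'b) monoid_scheme \<Rightarrow> 'a set \<Rightarrow> bool" where
  "frobenius_complement G H \<longleftrightarrow>
     subgroup H G \<and> H \<noteq> {\<one>\<^bsub>G\<^esub>} \<and> H \<noteq> carrier G \<and>
     (\<forall>g \<in> carrier G - H. H \<inter> (g <#\<^bsub>G\<^esub> H #>\<^bsub>G\<^esub> inv\<^bsub>G\<^esub> g) = {\<one>\<^bsub>G\<^esub>})"

definition frobenius_kernel :: "('a, 'b) monoid_scheme \<Rightarrow> 'a set \<Rightarrow> 'a set" where
  "frobenius_kernel G H =
     carrier G - (\<Union>g \<in> carrier G. g <#\<^bsub>G\<^esub> (H - {\<one>\<^bsub>G\<^esub>}) #>\<^bsub>G\<^esub> inv\<^bsub>G\<^esub> g)"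

definition frobenius_group_with_kernel :: "('a, 'b) monoid_scheme \<Rightarrow> 'a set \<Rightarrow> bool" where
  "frobenius_group_with_kernel G K \<longleftrightarrow>
     group G \<and> (\<exists>H. frobenius_complement G H \<and> K = frobenius_kernel G H)"

text \<open>The set \<open>carrier (G\<lparr>carrier := L\<rparr> Mod K)\<close> of cosets of \<open>K\<close> in \<open>L\<close> is the subgroup
  \<open>L / K\<close> of \<open>G Mod K\<close>.\<close>

definition two_frobenius_group :: "('a, 'b) monoid_scheme \<Rightarrow> 'a set \<Rightarrow> 'a set \<Rightarrow> bool" where
  "two_frobenius_group G K L \<longleftrightarrow>
     K \<lhd> G \<and> L \<lhd> G \<and>
     frobenius_group_with_kernel (G\<lparr>carrier := L\<rparr>) K \<and>
     frobenius_group_with_kernel (G Mod K) (carrier (G\<lparr>carrier := L\<rparr> Mod K))"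

text \<open>Only used for finite groups; the trivial group counts as a \<open>p\<close>-group.\<close>

definition p_group :: "nat \<Rightarrow> ('a, 'b) monoid_scheme \<Rightarrow> bool" where
  "p_group p G \<longleftrightarrow> (\<exists>n. order G = p ^ n)"

text \<open>Undirected graphs are represented by symmetric digraphs.\<close>

definition cyclic_graph :: "('a, 'b) monoid_scheme \<Rightarrow> 'a pair_pre_digraph" where
  "cyclic_graph G =
     \<lparr> pverts = carrier G - {\<one>\<^bsub>G\<^esub>},
       parcs = {(x, y). x \<in> carrier G - {\<one>\<^bsub>G\<^esub>} \<and> y \<in> carrier G - {\<one>\<^bsub>G\<^esub>} \<and> x \<noteq> y \<and>
                        cyclic_group (subgroup_generated G {x, y})} \<rparr>"

definition connected_components :: "('a, 'b) pre_digraph \<Rightarrow> ('a, 'b) pre_digraph set" where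
  "connected_components D = {C. pre_digraph.max_subgraph D connected C}"

lemma graph_cyclic_graph:
  assumes "finite (carrier G)"
  shows "graph (with_proj (cyclic_graph G))"
proof -
  let ?V = "carrier G - {\<one>\<^bsub>G\<^esub>}"
  have "parcs (cyclic_graph G) \<subseteq> ?V \<times> ?V"
    by (auto simp: cyclic_graph_def)
  then have fin: "finite (parcs (cyclic_graph G))"
    using assms by (meson finite_Diff finite_SigmaI finite_subset)
  show ?thesis
    by unfold_locales
      (use assms fin in \<open>auto simp: cyclic_graph_def arc_to_ends_def symmetric_def insert_commute intro!: symI\<close>)
qed

lemma (in sym_digraph) connected_components_eq_sccs: "connected_components G = sccs"
proof -
  have conn: "connected H" if "strongly_connected H" "subgraph H G" for H
  proof -
    have "u \<rightarrow>\<^sup>*\<^bsub>mk_symmetric H\<^esub> v" if "u \<in> verts H" "v \<in> verts H" for u v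
    proof -
      have "(u, v) \<in> rtrancl_on (verts H) (arcs_ends H)"
        using \<open>strongly_connected H\<close> that by (auto simp: strongly_connected_def reachable_def)
      then have "(u, v) \<in> rtrancl_on (verts H) (parcs (mk_symmetric H))"
        by (rule rtrancl_on_mono[rotated 2]) (auto simp: mk_symmetric_def arcs_ends_conv)
      then show ?thesis
        by (simp add: reachable_def mk_symmetric_def)
    qed
    then show ?thesis
      using \<open>strongly_connected H\<close> \<open>subgraph H G\<close>
      by (auto simp: strongly_connected_def intro!: wf_digraph.connectedI)
  qed
  have ind: "strongly_connected (G \<restriction> verts H)" if "connected H" and sub: "subgraph H G" for H
  proof -
    have isub: "induced_subgraph (G \<restriction> verts H) G"
      using sub by (auto dest: subgraph_imp_subverts)
    have "symmetric (G \<restriction> verts H)"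
      using sym_arcs isub by (rule induced_graph_imp_symmetric)
    moreover have "spanning H (G \<restriction> verts H)"
      using sub by (simp add: spanning_def subgraph_induce_subgraphI2)
    ultimately show ?thesis
      using \<open>connected H\<close> isub wf_digraphI_induced wf_digraph.connected_spanning_imp_connected
        wf_digraph.symmetric_connected_imp_strongly_connected by metis
  qed
  have "max_subgraph connected H \<longleftrightarrow> max_subgraph strongly_connected H" for H
  proof
    assume H: "max_subgraph connected H"
    then have sub: "subgraph H G" and "connected H"
      by (auto simp: max_subgraph_def)
    have up: "subgraph H (G \<restriction> verts H)" "subgraph (G \<restriction> verts H) G"
      using sub by (auto intro: subgraph_induce_subgraphI2 subgraph_induce_subgraphI)
    have sc: "strongly_connected (G \<restriction> verts H)"
      using ind sub \<open>connected H\<close> by blast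
    then have "G \<restriction> verts H = H"
      using H up conn unfolding max_subgraph_def by metis
    then show "max_subgraph strongly_connected H"
      using H sc conn unfolding max_subgraph_def by metis
  next
    assume H: "max_subgraph strongly_connected H"
    then have sub: "subgraph H G" and sc: "strongly_connected H"
      by (auto simp: max_subgraph_def)
    show "max_subgraph connected H"
    proof (rule max_subgraphI)
      show "connected H" using conn sc sub by blast
      show "subgraph H G" by (rule sub)
    next
      fix D assume D: "H \<noteq> D" "subgraph H D" "subgraph D G"
      show "\<not> connected D"
      proof
        assume "connected D"
        then have "strongly_connected (G \<restriction> verts D)"
          using ind D by blast
        moreover have up: "subgraph D (G \<restriction> verts D)" "subgraph (G \<restriction> verts D) G"
          using D by (auto intro: subgraph_induce_subgraphI2 subgraph_induce_subgraphI)
        moreover have "subgraph H (G \<restriction> verts D)"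
          using D(2) up(1) by (rule subgraph_trans)
        ultimately have "G \<restriction> verts D = H"
          using H unfolding max_subgraph_def by metis
        then have "subgraph D H" using up(1) by simp
        then show False
          using D(1,2) by (auto simp: subgraph_def compatible_def)
      qed
    qed
  qed
  then show ?thesis
    by (simp add: connected_components_def sccs_altdef2)
qed

definition m_star :: "('a, 'b) monoid_scheme \<Rightarrow> nat \<Rightarrow> nat" where
  "m_star G p = card {P. subgroup P G \<and> card P = p \<and>
     \<not> (\<exists>x \<in> carrier G. prime (group.ord G x) \<and> group.ord G x \<noteq> p \<and>
          (\<forall>y \<in> P. x \<otimes>\<^bsub>G\<^esub> y = y \<otimes>\<^bsub>G\<^esub> x))}"

end

theory Submission
  imports Defs "HOL-Algebra.Group_Action" "HOL-Algebra.Sylow" "HOL-Number_Theory.Cong"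
begin

text \<open>
  Two elements of prime order lie in the same component of the cyclic graph whenever they generate
  the same subgroup, or commute and have distinct orders; these relations generate the partition
  into components. Let \<open>F = G / K\<close> and \<open>M = L / K\<close>.

  An element \<open>h \<noteq> 1\<close> of a conjugate \<open>H\<close> of the complement of \<open>K\<close> in \<open>L\<close> has its centraliser inside
  \<open>H\<close>, which accounts for \<open>card K\<close> components. A norm computation in the group ring shows that every
  complement \<open>Q\<close> of \<open>M\<close> in \<open>F\<close> centralises an element \<open>u\<close> of order \<open>p\<close> in the centre of \<open>K\<close>, so \<open>u\<close>
  is adjacent to all elements of prime order \<open>\<noteq> p\<close> lying over \<open>Q\<close>. Elements \<open>y\<close>, \<open>z\<close> outside \<open>L\<close>
  that centralise a common \<open>k \<noteq> 1\<close> in \<open>K\<close> lie over the same complement, since \<open>G / L\<close> is abelian and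
  thus \<open>[y, z]\<close> lies in the centraliser of \<open>k\<close> in \<open>L\<close>, that is, in \<open>K\<close>. This gives one component for
  each of the \<open>card M\<close> complements, and what remains are the isolated subgroups of order \<open>p\<close>.

  Connectedness of \<open>H - {1}\<close> and commutativity of \<open>G / L\<close> both follow from a subgroup of prime order
  of \<open>M\<close> that is normal in \<open>F\<close>. The same norm computation shows that commuting elements of equal
  prime order in \<open>M\<close> generate the same subgroup, so it suffices that no nontrivial normal subgroup
  \<open>S \<subseteq> M\<close> of \<open>F\<close> is perfect. An element of \<open>F - M\<close> acts without fixed points on \<open>M\<close>, whereas
  automorphism groups of cyclic groups are abelian; this makes the Sylow subgroups of \<open>S\<close> cyclic and
  the fusion in them trivial, and the transfer into a Sylow subgroup is nontrivial.
\<close>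

section \<open>Conjugation and actions of groups of prime power order\<close>

text \<open>\<open>M\<close> plays two roles. Isomorphic to a complement of \<open>K\<close> in
  \<open>L\<close>, it acts without fixed points on the centre of \<open>K\<close>, which restricts
  its commuting elements of prime order; as the kernel of \<open>F\<close>, it is itself moved
  without fixed points by elements outside \<open>M\<close>. The first role alone would allow
  quaternion Sylow subgroups; the second excludes them, since a normalised subgroup of order 2 is
  fixed elementwise. The summands \<open>card K\<close> and \<open>card M\<close> come from
  malnormality: a complement is its own normaliser, so it has as many conjugates as cosets, and that
  number is the order of the kernel. The norm computation says that a partition into
  \<open>k\<close> subgroups, each with trivial fixed points, forces \<open>v^k = v\<close>. A group
  of type \<open>(r, r)\<close> has \<open>k = r + 1\<close>, and the partition of \<open>F\<close>
  by \<open>M\<close> and its complements has \<open>k = card M + 1\<close>. In both cases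
  \<open>k - 1\<close> is prime to \<open>p\<close>, which is impossible for a nontrivial
  \<open>v\<close> in a \<open>p\<close>-group. That \<open>G / L\<close> is not a
  \<open>p\<close>-group puts an element of prime order other than \<open>p\<close> over every
  complement of \<open>M\<close>; otherwise these complements would contribute no
  components.\<close>

definition conj_by :: "('a, 'b) monoid_scheme \<Rightarrow> 'a \<Rightarrow> 'a \<Rightarrow> 'a" where
  "conj_by G g x = g \<otimes>\<^bsub>G\<^esub> x \<otimes>\<^bsub>G\<^esub> inv\<^bsub>G\<^esub> g"

context group
begin

lemma inv_mult_cancel_left:
  assumes "x \<in> carrier G" "y \<in> carrier G"
  shows "inv x \<otimes> (x \<otimes> y) = y" "x \<otimes> (inv x \<otimes> y) = y"
  using assms by (simp_all flip: m_assoc)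

lemmas group_word = m_assoc inv_mult_group inv_mult_cancel_left

lemma conj_by_closed [simp]: "g \<in> carrier G \<Longrightarrow> x \<in> carrier G \<Longrightarrow> conj_by G g x \<in> carrier G"
  by (simp add: conj_by_def)

lemma conj_by_one_left [simp]: "x \<in> carrier G \<Longrightarrow> conj_by G \<one> x = x"
  by (simp add: conj_by_def)

lemma conj_by_one [simp]: "g \<in> carrier G \<Longrightarrow> conj_by G g \<one> = \<one>"
  by (simp add: conj_by_def)

lemma conj_by_mult:
  "\<lbrakk>g \<in> carrier G; x \<in> carrier G; y \<in> carrier G\<rbrakk> \<Longrightarrow>
    conj_by G g (x \<otimes> y) = conj_by G g x \<otimes> conj_by G g y"
  by (simp add: conj_by_def group_word)

lemma conj_by_conj_by:
  "\<lbrakk>g \<in> carrier G; h \<in> carrier G; x \<in> carrier G\<rbrakk> \<Longrightarrow>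
    conj_by G g (conj_by G h x) = conj_by G (g \<otimes> h) x"
  by (simp add: conj_by_def group_word)

lemma conj_by_inv:
  "\<lbrakk>g \<in> carrier G; x \<in> carrier G\<rbrakk> \<Longrightarrow> conj_by G g (inv x) = inv (conj_by G g x)"
  by (simp add: conj_by_def group_word)

lemma conj_by_pow:
  "\<lbrakk>g \<in> carrier G; x \<in> carrier G\<rbrakk> \<Longrightarrow> conj_by G g (x [^] (n::nat)) = conj_by G g x [^] n"
  by (induction n) (simp_all add: conj_by_mult)

lemma conj_by_cancel [simp]:
  assumes "g \<in> carrier G" "x \<in> carrier G"
  shows "conj_by G (inv g) (conj_by G g x) = x" "conj_by G g (conj_by G (inv g) x) = x"
  using assms by (simp_all add: conj_by_conj_by)

lemma conj_by_inject:
  "\<lbrakk>g \<in> carrier G; x \<in> carrier G; y \<in> carrier G\<rbrakk> \<Longrightarrow> conj_by G g x = conj_by G g y \<longleftrightarrow> x = y"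
  by (metis conj_by_cancel(1))

lemma inj_on_conj_by: "g \<in> carrier G \<Longrightarrow> A \<subseteq> carrier G \<Longrightarrow> inj_on (conj_by G g) A"
  by (auto simp: inj_on_def conj_by_inject subset_iff)

lemma conj_by_eq_self_iff:
  "\<lbrakk>g \<in> carrier G; x \<in> carrier G\<rbrakk> \<Longrightarrow> conj_by G g x = x \<longleftrightarrow> g \<otimes> x = x \<otimes> g"
  by (metis conj_by_def inv_solve_right' m_closed)

lemma ord_conj_by: "\<lbrakk>g \<in> carrier G; x \<in> carrier G\<rbrakk> \<Longrightarrow> ord (conj_by G g x) = ord x"
  by (metis conj_by_closed conj_by_inject conj_by_one conj_by_pow nat_pow_closed one_closed ord_unique pow_eq_id)

lemma conj_by_in_normal: "N \<lhd> G \<Longrightarrow> g \<in> carrier G \<Longrightarrow> x \<in> N \<Longrightarrow> conj_by G g x \<in> N"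
  by (simp add: conj_by_def normal.inv_op_closed2)

lemma subgroup_conj_by:
  assumes "subgroup H G" "g \<in> carrier G"
  shows "subgroup (conj_by G g ` H) G"
proof (rule subgroupI)
  show "conj_by G g ` H \<noteq> {}" using assms subgroup.one_closed by blast
qed (use assms subgroup.subset[OF assms(1)] in
      \<open>auto simp: subset_iff conj_by_mult[symmetric] conj_by_inv[symmetric] subgroupE(3,4)\<close>)

lemma subgroup_pow_closed: "subgroup H G \<Longrightarrow> x \<in> H \<Longrightarrow> x [^] (n::nat) \<in> H"
  by (induction n) (auto simp: subgroup.one_closed subgroup.m_closed)

text \<open>An inverse \<open>q\<close> of \<open>k\<close> modulo the order of \<open>x\<close>
  undoes the power.\<close>

lemma pow_coprime_root:
  assumes x: "x \<in> carrier G" and "coprime k (ord x)"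
  obtains q :: nat where "(x [^] (k::nat)) [^] q = x"
proof -
  obtain q where "[k * q = 1] (mod ord x)"
    using cong_solve_coprime_nat[OF assms(2)] by auto
  then have "[int 1 = int (k * q)] (mod int (ord x))"
    by (simp only: cong_int_iff cong_sym_eq)
  then have "int (ord x) dvd int 1 - int (k * q)"
    by (simp only: cong_iff_dvd_diff)
  then have "x [^] int (k * q) = x [^] int 1" using int_pow_eq[OF x] by blast
  then have "x [^] (k * q) = x [^] (1::nat)" by (simp only: int_pow_int)
  then have "(x [^] k) [^] q = x" using x by (simp add: nat_pow_pow)
  then show thesis by (rule that)
qed

lemma card_subgroup_factor:
  assumes "subgroup H G" "subgroup S G" "H \<subseteq> S"
  shows "card ((\<lambda>s. H #> s) ` S) * card H = card S"
proof -
  interpret S: group "G\<lparr>carrier := S\<rparr>"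
    using assms(2) by (rule subgroup_imp_group)
  have "subgroup H (G\<lparr>carrier := S\<rparr>)"
    using assms by (simp add: subgroup_incl)
  from S.lagrange[OF this] show ?thesis
    by (simp add: RCOSETS_def r_coset_def order_def UNION_singleton_eq_range)
qed

lemma r_coset_eq_iff:
  assumes "subgroup H G" "x \<in> carrier G" "y \<in> carrier G"
  shows "H #> x = H #> y \<longleftrightarrow> x \<otimes> inv y \<in> H"
proof
  assume "H #> x = H #> y"
  then have "x \<in> H #> y" using rcos_self[OF assms(2,1)] by simp
  then show "x \<otimes> inv y \<in> H"
    using subgroup.rcos_module[OF assms(1) is_group] assms by simp
next
  assume "x \<otimes> inv y \<in> H"
  then have "x \<in> H #> y"
    using subgroup.rcos_module[OF assms(1) is_group] assms by simp
  then show "H #> x = H #> y"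
    using repr_independence[OF _ assms(3,1)] by simp
qed

text \<open>Orbits with more than one point have length a positive power of \<open>p\<close>. The
  action is a bare function with hypotheses on \<open>P\<close> and \<open>E\<close> only, so that
  conjugation and translation of cosets can be inserted directly.\<close>

lemma card_fixed_points_cong:
  assumes P: "subgroup P G" "card P = p ^ n" "prime p" and fin: "finite E"
    and act: "\<And>g x. g \<in> P \<Longrightarrow> x \<in> E \<Longrightarrow> f g x \<in> E" "\<And>x. x \<in> E \<Longrightarrow> f \<one> x = x"
      "\<And>g h x. g \<in> P \<Longrightarrow> h \<in> P \<Longrightarrow> x \<in> E \<Longrightarrow> f (g \<otimes> h) x = f g (f h x)"
  shows "[card E = card {x \<in> E. \<forall>g\<in>P. f g x = x}] (mod p)"
proof -
  define H where "H = G\<lparr>carrier := P\<rparr>"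
  interpret H: group H
    unfolding H_def using P(1) by (rule subgroup_imp_group)
  interpret P: subgroup P G by fact
  have inv_act: "f (inv g) (f g x) = x" "f g (f (inv g) x) = x" if "g \<in> P" "x \<in> E" for g x
    using that act(2) act(3)[of "inv g" g x] act(3)[of g "inv g" x] by simp_all
  define \<phi> where "\<phi> = (\<lambda>g. restrict (f g) E)"
  have bij: "bij_betw (f g) E E" if "g \<in> P" for g
    by (rule bij_betw_byWitness[where f' = "f (inv g)"]) (use that inv_act act(1) in auto)
  interpret A: group_action H E \<phi>
  proof (intro group_action.intro group_hom.intro group_hom_axioms.intro homI)
    show "group H" "group (BijGroup E)" using group_BijGroup by (auto intro: H.group_axioms)
    show "\<phi> g \<in> carrier (BijGroup E)" if "g \<in> carrier H" for g
      using that bij by (auto simp: BijGroup_def Bij_def \<phi>_def H_def)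
    show "\<phi> (g \<otimes>\<^bsub>H\<^esub> h) = \<phi> g \<otimes>\<^bsub>BijGroup E\<^esub> \<phi> h" if "g \<in> carrier H" "h \<in> carrier H" for g h
      using that bij act by (auto simp: BijGroup_def Bij_def \<phi>_def H_def compose_def fun_eq_iff)
  qed
  define F where "F = {x \<in> E. \<forall>g\<in>P. f g x = x}"
  have orb: "orbit H \<phi> x = (\<lambda>g. f g x) ` P" if "x \<in> E" for x
    using that by (auto simp: orbit_def H_def \<phi>_def)
  \<comment> \<open>Once the one-point orbits are removed, the remaining orbits cover exactly the
    moved points.\<close>
  have un: "\<Union> (orbits H E \<phi> - (\<lambda>x. {x}) ` F) = E - F"
  proof (intro equalityI subsetI)
    fix y assume "y \<in> \<Union> (orbits H E \<phi> - (\<lambda>x. {x}) ` F)"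
    then obtain x where x: "x \<in> E" "y \<in> orbit H \<phi> x" "orbit H \<phi> x \<notin> (\<lambda>x. {x}) ` F"
      by (auto simp: orbits_def)
    then obtain g where g: "g \<in> P" "y = f g x" by (auto simp: orb)
    have "y \<notin> F"
    proof
      assume "y \<in> F"
      then have "f (inv g) y = y" using g P.m_inv_closed by (auto simp: F_def)
      then have "y = x" using inv_act g x by metis
      then have "(\<lambda>g. f g x) ` P = (\<lambda>g. x) ` P"
        using \<open>y \<in> F\<close> by (intro image_cong) (auto simp: F_def)
      then have "orbit H \<phi> x = {x}"
        using orb[OF x(1)] image_constant[OF P.one_closed] by simp
      then show False using x(3) \<open>y \<in> F\<close> \<open>y = x\<close> by auto
    qed
    then show "y \<in> E - F" using g x act by auto
  next
    fix x assume x: "x \<in> E - F"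
    have "x \<in> orbit H \<phi> x" using A.orbit_refl x by blast
    moreover have "orbit H \<phi> x \<noteq> {y}" if "y \<in> F" for y
    proof
      assume "orbit H \<phi> x = {y}"
      with \<open>x \<in> orbit H \<phi> x\<close> have "x = y" by simp
      then show False using that x by blast
    qed
    ultimately show "x \<in> \<Union> (orbits H E \<phi> - (\<lambda>x. {x}) ` F)"
      using x by (auto simp: orbits_def)
  qed
  have "p dvd card (\<Union> (orbits H E \<phi> - (\<lambda>x. {x}) ` F))"
  proof (rule dvd_partition)
    show "finite (\<Union> (orbits H E \<phi> - (\<lambda>x. {x}) ` F))" using un fin by simp
    show "\<forall>c1\<in>orbits H E \<phi> - (\<lambda>x. {x}) ` F. \<forall>c2\<in>orbits H E \<phi> - (\<lambda>x. {x}) ` F. c1 \<noteq> c2 \<longrightarrow> c1 \<inter> c2 = {}"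
      using A.disjoint_union by blast
    show "\<forall>c\<in>orbits H E \<phi> - (\<lambda>x. {x}) ` F. p dvd card c"
    proof
      fix c assume "c \<in> orbits H E \<phi> - (\<lambda>x. {x}) ` F"
      then obtain x where x: "x \<in> E" "c = orbit H \<phi> x" "c \<notin> (\<lambda>x. {x}) ` F" by (auto simp: orbits_def)
      have "card c * card (stabilizer H \<phi> x) = p ^ n"
        using A.orbit_stabilizer_theorem[OF x(1)] P(2) x(2) by (simp add: order_def H_def)
      then obtain k where k: "card c = p ^ k"
        using divides_primepow_nat[OF P(3)] by (metis dvd_triv_left)
      have "card c \<noteq> 1"
      proof
        assume "card c = 1"
        then have "c = {x}" using A.orbit_refl x by (metis card_1_singletonE singletonD)
        then have "x \<in> F" using x orb[OF x(1)] by (auto simp: F_def)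
        then show False using x(3) \<open>c = {x}\<close> by blast
      qed
      then show "p dvd card c" using k by (cases k) auto
    qed
  qed
  then have "p dvd card E - card F"
    using un fin by (simp add: card_Diff_subset F_def)
  moreover have "card F \<le> card E" using fin by (simp add: card_mono F_def)
  ultimately show ?thesis
    unfolding F_def[symmetric] by (simp add: cong_altdef_nat cong_sym_eq)
qed

text \<open>\<open>P\<close> acts on the cosets of \<open>R\<close> in \<open>S\<close> by right
  translation with inverses. Their number is prime to \<open>p\<close>, so some coset
  \<open>R s\<close> is fixed, which means that \<open>s\<close> conjugates \<open>P\<close> into
  \<open>R\<close>.\<close>

lemma prime_power_subgroup_le_conj:
  assumes S: "subgroup S G" "finite S" and R: "subgroup R G" "R \<subseteq> S" and P: "subgroup P G" "P \<subseteq> S"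
    and "prime p" "card P = p ^ n" "\<not> p dvd card ((\<lambda>s. R #> s) ` S)"
  shows "\<exists>s\<in>S. \<forall>x\<in>P. conj_by G s x \<in> R"
proof -
  let ?E = "(\<lambda>s. R #> s) ` S" and ?f = "\<lambda>g C. C #> inv g"
  have SG: "S \<subseteq> carrier G" and RG: "R \<subseteq> carrier G" and PG: "P \<subseteq> carrier G"
    using S R P subgroup.subset by blast+
  have *: "(R #> s) #> inv g = R #> (s \<otimes> inv g)" if "s \<in> S" "g \<in> P" for s g
    using that SG PG RG by (intro coset_mult_assoc) auto
  have cong: "[card ?E = card {C \<in> ?E. \<forall>g\<in>P. ?f g C = C}] (mod p)"
  proof (rule card_fixed_points_cong[OF P(1) assms(8,7)])
    show "finite ?E" using S by simp
    show "?f g C \<in> ?E" if "g \<in> P" "C \<in> ?E" for g C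
      using that * P(2) subgroupE(3,4)[OF S(1)] by (auto simp: subset_iff)
    show "?f \<one> C = C" if "C \<in> ?E" for C
      using that SG RG by (auto simp: coset_mult_assoc subset_iff)
    show "?f (g \<otimes> h) C = ?f g (?f h C)" if "g \<in> P" "h \<in> P" "C \<in> ?E" for g h C
      using that SG RG PG by (auto simp: coset_mult_assoc subset_iff inv_mult_group m_assoc)
  qed
  then have "card {C \<in> ?E. \<forall>g\<in>P. ?f g C = C} \<noteq> 0"
    using cong_dvd_iff[OF cong] assms(9) by (intro notI) simp
  then have "{C \<in> ?E. \<forall>g\<in>P. ?f g C = C} \<noteq> {}"
    by (intro notI) simp
  then obtain s where s: "s \<in> S" "\<forall>g\<in>P. (R #> s) #> inv g = R #> s"
    by blast
  have "conj_by G s x \<in> R" if "x \<in> P" for x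
  proof -
    have "R #> s = R #> (s \<otimes> inv x)" using s that * by simp
    then have "s \<otimes> inv (s \<otimes> inv x) \<in> R"
      using r_coset_eq_iff[OF R(1)] s that SG PG by (auto simp: subset_iff)
    then show ?thesis using s that SG PG by (auto simp: subset_iff conj_by_def group_word)
  qed
  then show ?thesis using s by blast
qed

text \<open>The \<open>p\<close>-group \<open>R\<close> acts by conjugation on the cosets of
  \<open>A\<close>. Their number is divisible by \<open>p\<close> and the coset \<open>A\<close> is
  fixed, hence so is another one. This is the nontrivial centre of \<open>R / A\<close>, phrased
  without the quotient.\<close>

lemma prime_power_group_central_mod:
  assumes R: "subgroup R G" "prime p" "card R = p ^ n" and A: "subgroup A G" "A \<subset> R"
    and inv: "\<And>g a. g \<in> R \<Longrightarrow> a \<in> A \<Longrightarrow> conj_by G g a \<in> A"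
  shows "\<exists>b\<in>R - A. \<forall>g\<in>R. conj_by G g b \<otimes> inv b \<in> A"
proof -
  let ?E = "(\<lambda>s. A #> s) ` R" and ?f = "\<lambda>g C. conj_by G g ` C"
  have RG: "R \<subseteq> carrier G" and AG: "A \<subseteq> carrier G" using R A subgroup.subset by blast+
  have finR: "finite R" using R by (metis card.infinite not_prime_0 power_eq_0_iff)
  have img: "?f g (A #> b) = A #> conj_by G g b" if "g \<in> R" "b \<in> R" for g b
  proof -
    have "conj_by G g ` A = A"
    proof (rule card_subset_eq)
      show "conj_by G g ` A \<subseteq> A" using inv that by auto
      show "card (conj_by G g ` A) = card A"
        using that RG AG by (intro card_image inj_on_conj_by) auto
    qed (use finR A finite_subset in blast)
    then have "A #> conj_by G g b = (conj_by G g ` A) #> conj_by G g b" by simp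
    also have "\<dots> = ?f g (A #> b)"
      using that RG AG by (auto simp: r_coset_def conj_by_mult subset_iff image_UN)
    finally show ?thesis by simp
  qed
  have conj_R: "conj_by G g b \<in> R" if "g \<in> R" "b \<in> R" for g b
    using that subgroupE(3,4)[OF R(1)] by (simp add: conj_by_def)
  have "[card ?E = card {C \<in> ?E. \<forall>g\<in>R. ?f g C = C}] (mod p)"
  proof (rule card_fixed_points_cong[OF R(1,3,2)])
    show "finite ?E" using finR by simp
    show "?f g C \<in> ?E" if "g \<in> R" "C \<in> ?E" for g C
      using that img conj_R by auto
    have sub: "C \<subseteq> carrier G" if "C \<in> ?E" for C
      using that RG AG r_coset_subset_G by blast
    show "?f \<one> C = C" if "C \<in> ?E" for C
      using sub[OF that] by (force simp: subset_iff image_iff)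
    show "?f (g \<otimes> h) C = ?f g (?f h C)" if "g \<in> R" "h \<in> R" "C \<in> ?E" for g h C
      using that RG sub[OF that(3)] by (auto simp: subset_iff conj_by_conj_by image_image)
  qed
  moreover have "p dvd card ?E"
  proof -
    have eq: "card ?E * card A = p ^ n" using card_subgroup_factor[OF A(1) R(1)] A R(3) by auto
    then obtain k where k: "card ?E = p ^ k" using divides_primepow_nat[OF R(2)] by (metis dvd_triv_left)
    have "card A < card R" using A finR by (simp add: psubset_card_mono)
    then have "card ?E \<noteq> 1" using eq R(3) by auto
    then show ?thesis using k by (cases k) auto
  qed
  ultimately have dvd: "p dvd card {C \<in> ?E. \<forall>g\<in>R. ?f g C = C}"
    using cong_dvd_iff[of "card ?E" _ p] by simp
  have "A \<in> {C \<in> ?E. \<forall>g\<in>R. ?f g C = C}"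
  proof -
    have "A = A #> \<one>" using AG by simp
    then have "A \<in> ?E" using subgroup.one_closed[OF R(1)] by blast
    moreover have "?f g A = A" if "g \<in> R" for g
      using img[OF that subgroup.one_closed[OF R(1)]] RG AG that by (auto simp: subset_iff)
    ultimately show ?thesis by blast
  qed
  moreover have "{C \<in> ?E. \<forall>g\<in>R. ?f g C = C} \<noteq> {A}"
  proof
    assume "{C \<in> ?E. \<forall>g\<in>R. ?f g C = C} = {A}"
    then have "p dvd 1" using dvd by simp
    then show False using R(2) by simp
  qed
  ultimately obtain C where C: "C \<in> ?E" "C \<noteq> A" "\<forall>g\<in>R. ?f g C = C" by blast
  then obtain b where b: "b \<in> R" "C = A #> b" by blast
  have "b \<notin> A" using C b coset_join2[of b A] A RG by auto
  moreover have "conj_by G g b \<otimes> inv b \<in> A" if "g \<in> R" for g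
  proof -
    have "A #> conj_by G g b = A #> b" using C b img that by auto
    then show ?thesis using r_coset_eq_iff[OF A(1)] b that RG by (auto simp: subset_iff)
  qed
  ultimately show ?thesis using b by blast
qed

end

section \<open>Frobenius groups\<close>

lemma card_image_cong_iff:
  assumes "\<And>x y. x \<in> A \<Longrightarrow> y \<in> A \<Longrightarrow> f x = f y \<longleftrightarrow> g x = g y"
  shows "card (f ` A) = card (g ` A)"
proof -
  let ?h = "\<lambda>z. g (inv_into A f z)"
  have h: "?h (f x) = g x" if "x \<in> A" for x
    using assms[of "inv_into A f (f x)" x] that by (simp add: f_inv_into_f inv_into_into)
  have "bij_betw ?h (f ` A) (g ` A)"
    using h assms by (auto simp: bij_betw_def inj_on_def image_image)
  then show ?thesis by (rule bij_betw_same_card)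
qed

lemma (in group) l_r_coset_conj_by:
  assumes "g \<in> carrier G" "A \<subseteq> carrier G"
  shows "g <# A #> inv g = conj_by G g ` A"
  by (auto simp: l_coset_def r_coset_def conj_by_def)

text \<open>Here \<open>\<Q>\<close> is meant to be the family of all conjugates of one Frobenius
  complement. The locale is used twice, for \<open>L\<close> with kernel \<open>K\<close> and for
  \<open>G / K\<close> with kernel \<open>L / K\<close>.\<close>

locale frobenius_partition = group G for G (structure) +
  fixes M \<Q>
  assumes finite_carrier: "finite (carrier G)"
    and normal_kernel: "M \<lhd> G" and kernel_nontrivial: "M \<noteq> {\<one>}"
    and subgroup_complement: "Q \<in> \<Q> \<Longrightarrow> subgroup Q G"
    and complement_nontrivial: "Q \<in> \<Q> \<Longrightarrow> Q \<noteq> {\<one>}"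
    and complements_meet: "\<lbrakk>Q \<in> \<Q>; Q' \<in> \<Q>; x \<in> Q; x \<in> Q'; x \<noteq> \<one>\<rbrakk> \<Longrightarrow> Q = Q'"
    and malnormal: "\<lbrakk>Q \<in> \<Q>; x \<in> Q; x \<noteq> \<one>; g \<in> carrier G; conj_by G g x \<in> Q\<rbrakk> \<Longrightarrow> g \<in> Q"
    and covers: "carrier G = M \<union> \<Union>\<Q>"
    and complement_Int_kernel: "Q \<in> \<Q> \<Longrightarrow> Q \<inter> M = {\<one>}"
    and card_complements: "card \<Q> = card M"
    and card_complement: "Q \<in> \<Q> \<Longrightarrow> card Q * card M = card (carrier G)"
    and complements_conj: "\<lbrakk>Q \<in> \<Q>; Q' \<in> \<Q>\<rbrakk> \<Longrightarrow> \<exists>g\<in>carrier G. Q' = conj_by G g ` Q"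
begin

lemma subgroup_kernel: "subgroup M G"
  using normal_kernel by (rule normal_imp_subgroup)

lemma kernel_carrier: "M \<subseteq> carrier G"
  using subgroup_kernel by (rule subgroup.subset)

lemma complement_carrier: "Q \<in> \<Q> \<Longrightarrow> Q \<subseteq> carrier G"
  using subgroup_complement by (rule subgroup.subset)

lemma finite_complements: "finite \<Q>"
proof -
  have "\<Q> \<subseteq> Pow (carrier G)" using complement_carrier by blast
  then show ?thesis using finite_carrier finite_subset by blast
qed

lemma commute_complement:
  assumes "Q \<in> \<Q>" "x \<in> Q" "x \<noteq> \<one>" "g \<in> carrier G" "g \<otimes> x = x \<otimes> g"
  shows "g \<in> Q"
proof (rule malnormal[OF assms(1-4)])
  have "x \<in> carrier G" using assms(1,2) complement_carrier by blast
  then have "conj_by G g x = x" using conj_by_eq_self_iff[OF assms(4)] assms(5) by blast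
  then show "conj_by G g x \<in> Q" using assms(2) by simp
qed

lemma complement_ex: "g \<in> carrier G - M \<Longrightarrow> \<exists>Q\<in>\<Q>. g \<in> Q"
  using covers by blast

lemma complements_nonempty: "\<Q> \<noteq> {}"
proof
  assume "\<Q> = {}"
  then have "card M = 0" using card_complements by simp
  moreover have "finite M" using kernel_carrier finite_carrier by (rule finite_subset)
  ultimately show False using subgroup.one_closed[OF subgroup_kernel] by simp
qed

text \<open>An element outside \<open>M\<close> lies in some complement, and by malnormality that
  complement would then contain \<open>x\<close> as well.\<close>

lemma commute_kernel:
  assumes "x \<in> M" "x \<noteq> \<one>" "g \<in> carrier G" "g \<otimes> x = x \<otimes> g"
  shows "g \<in> M"
proof (rule ccontr)
  assume "g \<notin> M"
  then obtain Q where Q: "Q \<in> \<Q>" "g \<in> Q" using complement_ex assms by blast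
  have "g \<noteq> \<one>" using \<open>g \<notin> M\<close> subgroup.one_closed[OF subgroup_kernel] by blast
  then have "x \<in> Q" using commute_complement[OF Q, of x] assms kernel_carrier by auto
  then show False using complement_Int_kernel[OF Q(1)] assms by blast
qed

lemma kernel_ne_carrier: "M \<noteq> carrier G"
  using complements_nonempty complement_Int_kernel complement_carrier complement_nontrivial by blast

end

text \<open>Malnormality makes distinct conjugates of \<open>H\<close> meet trivially and identifies
  them with the cosets of \<open>H\<close>. The remaining numerical facts follow by counting the
  elements that lie in no conjugate except for the identity.\<close>

lemma (in group) frobenius_partition_exists:
  assumes fin: "finite (carrier G)" and M: "M \<lhd> G" and frob: "frobenius_group_with_kernel G M"
  shows "\<exists>\<Q>. frobenius_partition G M \<Q>"
proof -
  obtain H where H: "frobenius_complement G H" and ker: "M = frobenius_kernel G H"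
    using frob by (auto simp: frobenius_group_with_kernel_def)
  have sub: "subgroup H G" and H1: "H \<noteq> {\<one>}" and HG: "H \<noteq> carrier G"
    using H by (auto simp: frobenius_complement_def)
  interpret H: subgroup H G by (fact sub)
  have finH: "finite H" using fin H.subset by (rule finite_subset[rotated])
  have mal: "g \<in> H" if "x \<in> H" "x \<noteq> \<one>" "g \<in> carrier G" "conj_by G g x \<in> H" for g x
  proof (rule ccontr)
    assume "g \<notin> H"
    moreover have "\<forall>g \<in> carrier G - H. H \<inter> (g <# H #> inv g) = {\<one>}"
      using H by (simp add: frobenius_complement_def)
    ultimately have "H \<inter> (g <# H #> inv g) = {\<one>}"
      using that(3) by blast
    then have "H \<inter> (conj_by G g ` H) = {\<one>}"
      using l_r_coset_conj_by[OF that(3) H.subset] by simp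
    then have "conj_by G g x = \<one>" using that by blast
    then show False using that conj_by_inject[of g x \<one>] by auto
  qed
  define \<Q> where "\<Q> = (\<lambda>g. conj_by G g ` H) ` carrier G"
  have \<Q>E: "\<exists>a\<in>carrier G. Q = conj_by G a ` H" if "Q \<in> \<Q>" for Q
    using that by (simp add: \<Q>_def image_iff)
  have conjH: "conj_by G h ` H = H" if "h \<in> H" for h
  proof (rule card_subset_eq[OF finH])
    show "conj_by G h ` H \<subseteq> H" using that by (auto simp: conj_by_def)
    show "card (conj_by G h ` H) = card H"
      using that by (intro card_image inj_on_conj_by) (auto simp: H.subset)
  qed
  have comp: "conj_by G (g \<otimes> h) ` H = conj_by G g ` conj_by G h ` H"
    if "g \<in> carrier G" "h \<in> carrier G" for g h
    using that by (auto simp: image_image conj_by_conj_by intro!: image_cong)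
  have meet: "conj_by G a ` H = conj_by G b ` H"
    if ab: "a \<in> carrier G" "b \<in> carrier G" and x: "x \<in> conj_by G a ` H" "x \<in> conj_by G b ` H" "x \<noteq> \<one>" for a b x
  proof -
    obtain y z where yz: "y \<in> H" "z \<in> H" "x = conj_by G a y" "x = conj_by G b z" using x by blast
    have "y \<noteq> \<one>" using yz x ab by auto
    moreover have "conj_by G (inv b \<otimes> a) y = z"
    proof -
      have "conj_by G (inv b \<otimes> a) y = conj_by G (inv b) (conj_by G b z)"
        using ab yz conj_by_conj_by[of "inv b" a y] by simp
      then show ?thesis using ab yz by simp
    qed
    ultimately have "inv b \<otimes> a \<in> H" using mal[of y "inv b \<otimes> a"] ab yz by auto
    then have "conj_by G b ` conj_by G (inv b \<otimes> a) ` H = conj_by G b ` H" using conjH by simp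
    moreover have "conj_by G b ` conj_by G (inv b \<otimes> a) ` H = conj_by G a ` H"
      using comp[of b "inv b \<otimes> a"] ab by (simp add: inv_mult_cancel_left)
    ultimately show ?thesis by simp
  qed
  \<comment> \<open>The conjugate of \<open>H\<close> by \<open>inv s\<close> depends only on the
    right coset \<open>H s\<close>, and malnormality gives the converse; this is why the conjugating
    elements are inverted.\<close>
  have iff: "conj_by G (inv s) ` H = conj_by G (inv t) ` H \<longleftrightarrow> H #> s = H #> t"
    if st: "s \<in> carrier G" "t \<in> carrier G" for s t
  proof
    assume eq: "conj_by G (inv s) ` H = conj_by G (inv t) ` H"
    obtain x where x: "x \<in> H" "x \<noteq> \<one>" using H1 H.one_closed by blast
    then obtain y where y: "y \<in> H" "conj_by G (inv s) x = conj_by G (inv t) y" using eq by blast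
    have "conj_by G (t \<otimes> inv s) x = conj_by G t (conj_by G (inv t) y)"
      using st x y by (simp flip: conj_by_conj_by)
    then have "t \<otimes> inv s \<in> H" using mal[of x "t \<otimes> inv s"] st x y by simp
    then show "H #> s = H #> t" using r_coset_eq_iff[OF sub] st by metis
  next
    assume "H #> s = H #> t"
    then have "s \<otimes> inv t \<in> H" using r_coset_eq_iff[OF sub] st by simp
    then have "conj_by G (inv s) ` conj_by G (s \<otimes> inv t) ` H = conj_by G (inv s) ` H"
      using conjH by simp
    moreover have "conj_by G (inv s) ` conj_by G (s \<otimes> inv t) ` H = conj_by G (inv t) ` H"
      using comp[of "inv s" "s \<otimes> inv t"] st by (simp add: inv_mult_cancel_left)
    ultimately show "conj_by G (inv s) ` H = conj_by G (inv t) ` H" by simp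
  qed
  have \<Q>inv: "\<Q> = (\<lambda>s. conj_by G (inv s) ` H) ` carrier G"
    unfolding \<Q>_def by (auto simp: image_iff) (metis inv_closed inv_inv)+
  have "card \<Q> = card ((\<lambda>s. H #> s) ` carrier G)"
    unfolding \<Q>inv using iff by (intro card_image_cong_iff) auto
  then have c\<Q>: "card \<Q> * card H = card (carrier G)"
    using card_subgroup_factor[OF sub subgroup_self H.subset] by simp
  have cQ: "card Q = card H" if "Q \<in> \<Q>" for Q
    using that by (auto simp: \<Q>_def intro!: card_image inj_on_conj_by)
  have sub\<Q>: "subgroup Q G" if "Q \<in> \<Q>" for Q
    using that subgroup_conj_by[OF sub] by (auto simp: \<Q>_def)
  have carr\<Q>: "Q \<subseteq> carrier G" if "Q \<in> \<Q>" for Q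
    using sub\<Q>[OF that] by (rule subgroup.subset)
  have meet\<Q>: "Q = Q'" if "Q \<in> \<Q>" "Q' \<in> \<Q>" "x \<in> Q" "x \<in> Q'" "x \<noteq> \<one>" for Q Q' x
  proof -
    obtain a b where "a \<in> carrier G" "b \<in> carrier G" "Q = conj_by G a ` H" "Q' = conj_by G b ` H"
      using \<Q>E[OF \<open>Q \<in> \<Q>\<close>] \<Q>E[OF \<open>Q' \<in> \<Q>\<close>] by (elim bexE) (rule that)
    then show ?thesis using meet[of a b x] that by simp
  qed
  have kerU: "M = carrier G - (\<Union>Q\<in>\<Q>. Q - {\<one>})"
  proof -
    have "g <# (H - {\<one>}) #> inv g = conj_by G g ` H - {\<one>}" if "g \<in> carrier G" for g
    proof -
      have "g <# (H - {\<one>}) #> inv g = conj_by G g ` (H - {\<one>})"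
        using that H.subset by (intro l_r_coset_conj_by) auto
      also have "\<dots> = conj_by G g ` H - conj_by G g ` {\<one>}"
        using that H.subset by (intro inj_on_image_set_diff[OF inj_on_conj_by]) auto
      finally show ?thesis using that by simp
    qed
    then show ?thesis unfolding ker frobenius_kernel_def \<Q>_def by auto
  qed
  have fin\<Q>: "finite \<Q>" unfolding \<Q>_def using fin by simp
  have "card (\<Union>Q\<in>\<Q>. Q - {\<one>}) = (\<Sum>Q\<in>\<Q>. card (Q - {\<one>}))"
  proof (rule card_UN_disjoint[OF fin\<Q>])
    show "\<forall>Q\<in>\<Q>. finite (Q - {\<one>})"
      using finite_subset[OF carr\<Q> fin] by simp
    show "\<forall>Q\<in>\<Q>. \<forall>Q'\<in>\<Q>. Q \<noteq> Q' \<longrightarrow> (Q - {\<one>}) \<inter> (Q' - {\<one>}) = {}"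
      using meet\<Q> by blast
  qed
  also have "\<dots> = (\<Sum>Q\<in>\<Q>. card H - 1)"
  proof (rule sum.cong)
    fix Q assume Q: "Q \<in> \<Q>"
    have "card (Q - {\<one>}) = card Q - 1"
      using subgroup.one_closed[OF sub\<Q>[OF Q]] by (rule card_Diff_singleton)
    then show "card (Q - {\<one>}) = card H - 1" using cQ[OF Q] by simp
  qed simp
  \<comment> \<open>Of the \<open>card \<Q> * card H\<close> elements of the group,
    \<open>card \<Q> * (card H - 1)\<close> are nonidentity elements of conjugates, so
    \<open>card \<Q>\<close> elements are left for \<open>M\<close>.\<close>
  finally have "card (\<Union>Q\<in>\<Q>. Q - {\<one>}) = card \<Q> * (card H - 1)" by simp
  moreover have "card M = card (carrier G) - card (\<Union>Q\<in>\<Q>. Q - {\<one>})"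
  proof -
    have U: "(\<Union>Q\<in>\<Q>. Q - {\<one>}) \<subseteq> carrier G" using carr\<Q> by blast
    then have "finite (\<Union>Q\<in>\<Q>. Q - {\<one>})" using fin by (rule finite_subset)
    then show ?thesis unfolding kerU using U by (rule card_Diff_subset)
  qed
  moreover have "card H > 0" using finH H.one_closed card_gt_0_iff by blast
  ultimately have cM: "card M = card \<Q>"
    using c\<Q> by (cases "card H") auto
  have "card M \<noteq> 1"
  proof
    assume "card M = 1"
    then have "card H = card (carrier G)" using cM c\<Q> by simp
    then show False using HG card_subset_eq[OF fin H.subset] by simp
  qed
  show ?thesis
  proof (rule exI[of _ \<Q>], rule frobenius_partition.intro[OF is_group], rule frobenius_partition_axioms.intro)
    show "M \<noteq> {\<one>}" using \<open>card M \<noteq> 1\<close> by auto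
    show "Q \<noteq> {\<one>}" if "Q \<in> \<Q>" for Q
    proof
      assume "Q = {\<one>}"
      then have "card H = 1" using cQ[OF that] by simp
      then show False using H1 H.one_closed by (metis card_1_singletonE singletonD)
    qed
    show "g \<in> Q" if asm: "Q \<in> \<Q>" "x \<in> Q" "x \<noteq> \<one>" "g \<in> carrier G" "conj_by G g x \<in> Q" for Q x g
    proof -
      obtain a where a: "a \<in> carrier G" "Q = conj_by G a ` H"
        using \<Q>E[OF \<open>Q \<in> \<Q>\<close>] by (elim bexE) (rule that)
      obtain y z where yz: "y \<in> H" "z \<in> H" "x = conj_by G a y" "conj_by G g x = conj_by G a z"
        using asm(2,5) unfolding a(2) by (elim imageE) (rule that)
      have "conj_by G (inv a \<otimes> g \<otimes> a) y = conj_by G (inv a) (conj_by G a z)"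
        using yz(3,4)[symmetric] a(1) asm(4) H.mem_carrier[OF yz(1)] by (simp add: m_assoc flip: conj_by_conj_by)
      then have "conj_by G (inv a \<otimes> g \<otimes> a) y = z" using a(1) H.mem_carrier[OF yz(2)] by simp
      moreover have "y \<noteq> \<one>" using yz(3) asm(3) a(1) by auto
      ultimately have "inv a \<otimes> g \<otimes> a \<in> H"
        using mal[of y "inv a \<otimes> g \<otimes> a"] yz(1,2) a(1) asm(4) by simp
      moreover have "conj_by G a (inv a \<otimes> g \<otimes> a) = g"
        using a(1) asm(4) by (simp add: conj_by_def group_word)
      ultimately show ?thesis unfolding a(2) by (rule_tac image_eqI[OF sym])
    qed
    show "carrier G = M \<union> \<Union>\<Q>"
    proof -
      have "\<one> \<in> M" unfolding kerU by simp
      moreover have "\<Union>\<Q> \<subseteq> carrier G" using carr\<Q> by (rule Sup_least)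
      ultimately show ?thesis unfolding kerU by auto
    qed
    show "Q \<inter> M = {\<one>}" if "Q \<in> \<Q>" for Q
    proof -
      have "\<one> \<in> Q" using sub\<Q>[OF that] by (rule subgroup.one_closed)
      moreover have "\<one> \<in> M" unfolding kerU by simp
      moreover have "x \<notin> M" if "x \<in> Q" "x \<noteq> \<one>" for x
        unfolding kerU using that \<open>Q \<in> \<Q>\<close> by blast
      ultimately show ?thesis by blast
    qed
    show "card Q * card M = card (carrier G)" if "Q \<in> \<Q>" for Q
      using cQ[OF that] c\<Q> cM by (simp add: mult.commute)
    show "\<exists>g\<in>carrier G. Q' = conj_by G g ` Q" if "Q \<in> \<Q>" "Q' \<in> \<Q>" for Q Q'
    proof -
      obtain a where a: "a \<in> carrier G" "Q = conj_by G a ` H"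
        using \<Q>E[OF \<open>Q \<in> \<Q>\<close>] by (elim bexE) (rule that)
      obtain b where b: "b \<in> carrier G" "Q' = conj_by G b ` H"
        using \<Q>E[OF \<open>Q' \<in> \<Q>\<close>] by (elim bexE) (rule that)
      have "Q' = conj_by G (b \<otimes> inv a) ` Q"
        unfolding a(2) b(2) using comp[of "b \<otimes> inv a" a] a(1) b(1) by (simp add: m_assoc)
      then show ?thesis by (rule bexI[where x = "b \<otimes> inv a"]) (simp_all add: a(1) b(1))
    qed
    show "finite (carrier G)" "M \<lhd> G" "card \<Q> = card M" by (fact fin M cM[symmetric])+
    show "subgroup Q G" if "Q \<in> \<Q>" for Q using that by (rule sub\<Q>)
    show "Q = Q'" if "Q \<in> \<Q>" "Q' \<in> \<Q>" "x \<in> Q" "x \<in> Q'" "x \<noteq> \<one>" for Q Q' x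
      using that by (rule meet\<Q>)
  qed
qed

section \<open>Fixed-point-free actions and partitions\<close>

lemma (in comm_group) endo_finprod:
  assumes "h \<in> hom G G" "finite S" "f \<in> S \<rightarrow> carrier G"
  shows "h (finprod G f S) = finprod G (\<lambda>x. h (f x)) S"
  using assms(2,3)
proof (induction S rule: finite_induct)
  case empty
  then show ?case using hom_one[OF assms(1) is_group is_group] by simp
next
  case (insert x S)
  have "h \<in> carrier G \<rightarrow> carrier G" using assms(1) by (auto simp: hom_def)
  then show ?case using insert hom_mult[OF assms(1)] by (simp add: Pi_iff)
qed

text \<open>The norm \<open>\<Prod>d\<in>S. d \<cdot> v\<close> over a subgroup \<open>S\<close> is fixed by \<open>S\<close>, so all norms below are trivial;
  comparing the norm over the whole group with the product of those over the parts of the partition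
  leaves only a power of \<open>v\<close>.\<close>

lemma (in comm_group) fixed_point_free_partition:
  assumes D: "group D" "finite (carrier D)" "finite \<Q>"
    and sub: "\<And>S. S \<in> \<Q> \<Longrightarrow> subgroup S D"
    and disj: "\<And>S T x. \<lbrakk>S \<in> \<Q>; T \<in> \<Q>; x \<in> S; x \<in> T; x \<noteq> \<one>\<^bsub>D\<^esub>\<rbrakk> \<Longrightarrow> S = T"
    and un: "\<Union>\<Q> = carrier D"
    and act: "\<And>d. d \<in> carrier D \<Longrightarrow> act d \<in> hom G G"
      "\<And>a. a \<in> carrier G \<Longrightarrow> act \<one>\<^bsub>D\<^esub> a = a"
      "\<And>d e a. \<lbrakk>d \<in> carrier D; e \<in> carrier D; a \<in> carrier G\<rbrakk> \<Longrightarrow> act (d \<otimes>\<^bsub>D\<^esub> e) a = act d (act e a)"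
    and v: "v \<in> carrier G"
    and free: "\<And>S u. \<lbrakk>S = carrier D \<or> S \<in> \<Q>; u \<in> carrier G; \<And>d. d \<in> S \<Longrightarrow> act d u = u\<rbrakk> \<Longrightarrow> u = \<one>"
  shows "v [^] card \<Q> = v"
proof -
  interpret D: group D by fact
  define N where "N = (\<lambda>S. finprod G (\<lambda>d. act d v) S)"
  have act_closed: "act d a \<in> carrier G" if "d \<in> carrier D" "a \<in> carrier G" for d a
    using act(1)[OF that(1)] that(2) by (auto simp: hom_def)
  have fv: "(\<lambda>d. act d v) \<in> S \<rightarrow> carrier G" if "S \<subseteq> carrier D" for S
    using that act_closed v by blast
  have Nc: "N S \<in> carrier G" if "S \<subseteq> carrier D" for S
    unfolding N_def using fv[OF that] by simp
  \<comment> \<open>Left translation by an element of \<open>S\<close> only permutes the factors of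
    the norm.\<close>
  have N1: "N S = \<one>" if S: "subgroup S D" "S = carrier D \<or> S \<in> \<Q>" for S
  proof (rule free[OF S(2)])
    have SD: "S \<subseteq> carrier D" using S(1) by (rule subgroup.subset)
    then show "N S \<in> carrier G" by (rule Nc)
    fix e assume e: "e \<in> S"
    have inj: "inj_on (\<lambda>d. e \<otimes>\<^bsub>D\<^esub> d) S"
      using e SD by (intro inj_onI) (auto simp: subset_iff)
    have img: "(\<lambda>d. e \<otimes>\<^bsub>D\<^esub> d) ` S = S"
    proof (rule card_subset_eq)
      show "finite S" using SD D(2) by (rule finite_subset)
      show "(\<lambda>d. e \<otimes>\<^bsub>D\<^esub> d) ` S \<subseteq> S" using e S(1) by (auto simp: subgroup.m_closed)
      show "card ((\<lambda>d. e \<otimes>\<^bsub>D\<^esub> d) ` S) = card S" using inj by (rule card_image)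
    qed
    have "act e (N S) = finprod G (\<lambda>d. act e (act d v)) S"
      unfolding N_def using e SD act(1) fv[OF SD] finite_subset[OF SD D(2)]
      by (intro endo_finprod) auto
    also have "\<dots> = finprod G (\<lambda>d. act (e \<otimes>\<^bsub>D\<^esub> d) v) S"
    proof (rule finprod_cong')
      show "(\<lambda>d. act (e \<otimes>\<^bsub>D\<^esub> d) v) \<in> S \<rightarrow> carrier G"
        using e SD v act_closed by (auto simp: subset_iff)
      show "act e (act d v) = act (e \<otimes>\<^bsub>D\<^esub> d) v" if "d \<in> S" for d
        using act(3)[of e d v] subsetD[OF SD] e v that by metis
    qed simp
    also have "\<dots> = finprod G (\<lambda>d. act d v) ((\<lambda>d. e \<otimes>\<^bsub>D\<^esub> d) ` S)"
      using inj fv[OF SD] img by (subst finprod_reindex) auto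
    finally show "act e (N S) = N S" unfolding img N_def .
  qed
  have Nsplit: "N S = v \<otimes> N (S - {\<one>\<^bsub>D\<^esub>})" if S: "subgroup S D" for S
  proof -
    have SD: "S \<subseteq> carrier D" using S by (rule subgroup.subset)
    have "S = insert \<one>\<^bsub>D\<^esub> (S - {\<one>\<^bsub>D\<^esub>})" using subgroup.one_closed[OF S] by blast
    then have "N S = N (insert \<one>\<^bsub>D\<^esub> (S - {\<one>\<^bsub>D\<^esub>}))" by simp
    also have "\<dots> = act \<one>\<^bsub>D\<^esub> v \<otimes> N (S - {\<one>\<^bsub>D\<^esub>})"
      unfolding N_def using v finite_subset[OF SD D(2)] fv[of "S - {\<one>\<^bsub>D\<^esub>}"] SD act_closed
      by (intro finprod_insert) auto
    finally show ?thesis using act(2) v by simp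
  qed
  have QD: "S \<subseteq> carrier D" if "S \<in> \<Q>" for S using sub[OF that] by (rule subgroup.subset)
  have "N (carrier D - {\<one>\<^bsub>D\<^esub>}) = N (\<Union>S\<in>\<Q>. S - {\<one>\<^bsub>D\<^esub>})"
    using un by (intro arg_cong[where f = N]) auto
  also have "\<dots> = finprod G (\<lambda>S. N (S - {\<one>\<^bsub>D\<^esub>})) \<Q>"
    unfolding N_def
  proof (rule finprod_UN_disjoint)
    show "finite (S - {\<one>\<^bsub>D\<^esub>})" if "S \<in> \<Q>" for S
      using QD[OF that] D(2) finite_subset by blast
    show "pairwise (\<lambda>S T. disjnt (S - {\<one>\<^bsub>D\<^esub>}) (T - {\<one>\<^bsub>D\<^esub>})) \<Q>"
      using disj by (auto simp: pairwise_def disjnt_def)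
    show "act d v \<in> carrier G" if "S \<in> \<Q>" "d \<in> S - {\<one>\<^bsub>D\<^esub>}" for S d
      using that QD act_closed v by blast
  qed (fact D(3))
  finally have N\<Q>: "N (carrier D - {\<one>\<^bsub>D\<^esub>}) = finprod G (\<lambda>S. N (S - {\<one>\<^bsub>D\<^esub>})) \<Q>" .
  \<comment> \<open>Multiplying the trivial norms of all parts collects one factor \<open>v\<close>
    per part, whereas the norm over the whole group contains \<open>v\<close> once; everything else
    cancels.\<close>
  have "\<one> = finprod G (\<lambda>S. v \<otimes> N (S - {\<one>\<^bsub>D\<^esub>})) \<Q>"
    using N1 sub Nsplit by (intro finprod_one_eqI[symmetric]) metis
  also have "\<dots> = finprod G (\<lambda>S. v) \<Q> \<otimes> N (carrier D - {\<one>\<^bsub>D\<^esub>})"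
    unfolding N\<Q> using v Nc QD by (intro finprod_multf) (auto intro!: Nc)
  also have "finprod G (\<lambda>S. v) \<Q> = v [^] card \<Q>" using v by (rule finprod_const)
  finally have "v [^] card \<Q> \<otimes> N (carrier D - {\<one>\<^bsub>D\<^esub>}) = v \<otimes> N (carrier D - {\<one>\<^bsub>D\<^esub>})"
    using N1[OF D.subgroup_self] Nsplit[OF D.subgroup_self] by simp
  then show ?thesis using v Nc by simp
qed

section \<open>Transfer\<close>

lemma (in group) mem_generate_singleton_iff:
  assumes "finite (carrier G)" "a \<in> carrier G"
  shows "z \<in> generate G {a} \<longleftrightarrow> (\<exists>k::nat. z = a [^] k)"
  using generate_pow_on_finite_carrier[OF assms] by auto

lemma (in group) rcosets_translate:
  assumes "subgroup R G" "C \<in> rcosets R" "g \<in> carrier G"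
  shows "C #> g \<in> rcosets R"
proof -
  obtain s where s: "s \<in> carrier G" "C = R #> s" using assms(2) by (auto simp: RCOSETS_def)
  then have "C #> g = R #> (s \<otimes> g)"
    using coset_mult_assoc[OF subgroup.subset[OF assms(1)] s(1) assms(3)] by simp
  then show ?thesis using s(1) assms(3) by (auto simp: RCOSETS_def)
qed

text \<open>On a coset not fixed by \<open>x\<close> the representatives are chosen along the \<open>x\<close>-orbit, so that
  such cosets contribute trivially to the transfer of \<open>x\<close>.\<close>

lemma (in group) equivariant_transversal:
  assumes x: "x \<in> carrier G" "prime (ord x)" and R: "subgroup R G"
  shows "\<exists>rep. \<forall>C\<in>rcosets R. rep C \<in> C \<and> (C #> x \<noteq> C \<longrightarrow> rep (C #> x) = rep C \<otimes> x)"
proof -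
  have RG: "R \<subseteq> carrier G" using R by (rule subgroup.subset)
  have cosub: "C \<subseteq> carrier G" if "C \<in> rcosets R" for C
    using that R subgroup.rcosets_carrier[OF R is_group] by blast
  have coset_mult: "(C #> g) #> h = C #> (g \<otimes> h)" if "C \<in> rcosets R" "g \<in> carrier G" "h \<in> carrier G" for C g h
    using coset_mult_assoc[OF cosub[OF that(1)] that(2,3)] .
  have coset_closed: "C #> g \<in> rcosets R" if "C \<in> rcosets R" "g \<in> carrier G" for C g
    using rcosets_translate[OF R that] .
  have coset_mem: "h \<otimes> g \<in> C #> g" if "h \<in> C" for C h g
    using that by (auto simp: r_coset_def)
  define orb where "orb = (\<lambda>C. {C #> x [^] k | k::nat. True})"
  \<comment> \<open>A base point chosen from the union of an orbit depends on the orbit only, not on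
    the coset used to name it. Representatives are then its translates by powers of
    \<open>x\<close>.\<close>
  define w :: "'a set set \<Rightarrow> 'a" where "w = (\<lambda>D. SOME h. h \<in> \<Union>D)"
  define P where "P = (\<lambda>C h. h \<in> C \<and> (\<exists>k::nat. h = w (orb C) \<otimes> x [^] k))"
  define rep where "rep = (\<lambda>C. if C #> x = C then SOME h. h \<in> C else SOME h. P C h)"
  have nonempty: "C \<noteq> {}" if "C \<in> rcosets R" for C
    using that subgroup.rcosets_non_empty[OF R] by blast
  have xk: "x [^] (k::nat) \<in> carrier G" for k using x by simp
  have ordx: "ord x \<noteq> 0" using x by auto
  have orb_shift: "orb (C #> x) = orb C" if C: "C \<in> rcosets R" for C
  proof -
    \<comment> \<open>Exponents are natural numbers, so a step back along the orbit is taken as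
      \<open>ord x - 1\<close> steps forward.\<close>
    have "\<exists>l::nat. C #> x [^] k = C #> x #> x [^] l" for k :: nat
    proof -
      have "x \<otimes> x [^] (k + (ord x - 1)) = x [^] (k + ord x)"
        using x ordx by (metis One_nat_def Suc_pred add.commute nat_pow_Suc2 neq0_conv plus_nat.simps(2) add.assoc)
      also have "\<dots> = x [^] k" using x by (simp flip: nat_pow_mult)
      finally show ?thesis using coset_mult[OF C x(1) xk] by metis
    qed
    moreover have "\<exists>l::nat. C #> x #> x [^] k = C #> x [^] l" for k :: nat
      using coset_mult[OF C x(1) xk, of k] x nat_pow_Suc2 by metis
    ultimately show ?thesis unfolding orb_def by blast
  qed
  have w_mem: "\<exists>k::nat. w (orb C) \<in> C #> x [^] k" if C: "C \<in> rcosets R" for C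
  proof -
    have "C #> x [^] (0::nat) \<noteq> {}" using nonempty[OF C] cosub[OF C] by simp
    then have "\<exists>h. h \<in> \<Union>(orb C)" unfolding orb_def by blast
    then have "w (orb C) \<in> \<Union>(orb C)" unfolding w_def by (rule someI_ex)
    then show ?thesis unfolding orb_def by blast
  qed
  have w_carr: "w (orb C) \<in> carrier G" if C: "C \<in> rcosets R" for C
    using w_mem[OF C] cosub[OF coset_closed[OF C xk]] by blast
  have P_ex: "\<exists>h. P C h" if C: "C \<in> rcosets R" for C
  proof -
    obtain k :: nat where k: "w (orb C) \<in> C #> x [^] k" using w_mem[OF C] by blast
    \<comment> \<open>A natural number congruent to \<open>-k\<close> modulo \<open>ord x\<close>;
      it moves the base point from the translate of \<open>C\<close> into \<open>C\<close>.\<close>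
    let ?l = "ord x * k - k"
    have "k \<le> ord x * k" using ordx by (cases "ord x") auto
    then have "x [^] k \<otimes> x [^] ?l = x [^] (ord x * k)"
      using x by (simp add: nat_pow_mult)
    also have "\<dots> = \<one>" using x by (simp flip: nat_pow_pow)
    finally have "C #> x [^] k #> x [^] ?l = C"
      using coset_mult[OF C xk xk] cosub[OF C] by simp
    then have "w (orb C) \<otimes> x [^] ?l \<in> C" using coset_mem[OF k] by metis
    then show ?thesis unfolding P_def by blast
  qed
  have P_unique: "h = h'" if C: "C \<in> rcosets R" "C #> x \<noteq> C" and P: "P C h" "P C h'" for C h h'
  proof -
    obtain k l :: nat where kl: "h = w (orb C) \<otimes> x [^] k" "h' = w (orb C) \<otimes> x [^] l"
      using P unfolding P_def by blast
    \<comment> \<open>Two different candidates in \<open>C\<close> would differ by a nontrivial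
      power \<open>x^m\<close> that fixes \<open>C\<close>. As \<open>ord x\<close> is prime,
      \<open>x\<close> is a power of \<open>x^m\<close> and would fix \<open>C\<close> too.\<close>
    have wlog: "u = u'" if u: "u = w (orb C) \<otimes> x [^] i" "u' = w (orb C) \<otimes> x [^] j" "u \<in> C" "u' \<in> C" "i \<le> j" for u u' and i j :: nat
    proof (rule ccontr)
      assume "u \<noteq> u'"
      have uc: "u \<in> carrier G" "u' \<in> carrier G" using u cosub[OF C(1)] by blast+
      define m where "m = j - i"
      have um: "u' = u \<otimes> x [^] m"
        using u w_carr[OF C(1)] x by (simp add: m_def m_assoc nat_pow_mult)
      then have "x [^] m \<noteq> \<one>" using \<open>u \<noteq> u'\<close> uc by auto
      then have "\<not> ord x dvd m" using x pow_eq_id by blast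
      then have "coprime m (ord x)" using x(2) by (metis coprime_commute prime_imp_coprime_nat)
      then obtain q :: nat where q: "(x [^] m) [^] q = x" by (rule pow_coprime_root[OF x(1)])
      obtain s where s: "s \<in> carrier G" "C = R #> s" using C(1) by (auto simp: RCOSETS_def)
      have "C = R #> u" "C = R #> u'"
        using repr_independence[OF _ s(1) R] u(3,4) s(2) by auto
      then have fix_m: "C #> x [^] m = C"
        using um coset_mult_assoc[OF RG uc(1) xk] by simp
      have "C #> x [^] (m * n) = C" for n
      proof (induction n)
        case (Suc n)
        have "C #> x [^] (m * Suc n) = C #> x [^] (m * n) #> x [^] m"
          using coset_mult[OF C(1) xk xk] x by (simp add: nat_pow_mult add.commute)
        then show ?case using Suc fix_m by simp
      qed (use cosub[OF C(1)] in simp)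
      then have "C #> x [^] (m * q) = C" .
      moreover have "x [^] (m * q) = x" using q x(1) by (simp add: nat_pow_pow)
      ultimately show False using C(2) by simp
    qed
    show ?thesis
      using wlog[OF kl] wlog[OF kl(2,1)] P unfolding P_def by (cases "k \<le> l") auto
  qed
  have "rep C \<in> C \<and> (C #> x \<noteq> C \<longrightarrow> rep (C #> x) = rep C \<otimes> x)" if C: "C \<in> rcosets R" for C
  proof (cases "C #> x = C")
    case True
    have "\<exists>h. h \<in> C" using nonempty[OF C] by blast
    then show ?thesis using True someI_ex[of "\<lambda>h. h \<in> C"] by (simp add: rep_def)
  next
    case False
    have Px: "P C (rep C)"
      using someI_ex[OF P_ex[OF C]] False by (simp add: rep_def)
    have Cx: "C #> x \<in> rcosets R" using coset_closed[OF C x(1)] .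
    have "C #> x #> x \<noteq> C #> x"
    proof
      assume "C #> x #> x = C #> x"
      then have "(C #> x #> x) #> inv x = (C #> x) #> inv x" by simp
      then show False
        using False x coset_mult[OF Cx x(1) inv_closed[OF x(1)]] coset_mult[OF C x(1) inv_closed[OF x(1)]]
          cosub[OF C] cosub[OF Cx] by simp
    qed
    then have "P (C #> x) (rep (C #> x))"
      using someI_ex[OF P_ex[OF Cx]] by (simp add: rep_def)
    moreover have "P (C #> x) (rep C \<otimes> x)"
    proof -
      obtain k :: nat where k: "rep C = w (orb C) \<otimes> x [^] k" using Px P_def by blast
      then have "rep C \<otimes> x = w (orb (C #> x)) \<otimes> x [^] Suc k"
        using orb_shift[OF C] w_carr[OF C] x by (simp add: m_assoc)
      then show ?thesis using coset_mem Px unfolding P_def by blast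
    qed
    ultimately show ?thesis
      using P_unique[OF Cx \<open>C #> x #> x \<noteq> C #> x\<close>] Px unfolding P_def by blast
  qed
  then show ?thesis by blast
qed

text \<open>The transfer \<open>V\<close> is a homomorphism to the abelian group \<open>R\<close>,
  so it kills commutators. But \<open>V x\<close> is \<open>x\<close> raised to the number of cosets
  fixed by \<open>x\<close>, and that number is congruent to the index of \<open>R\<close> modulo
  \<open>ord x\<close>, hence not divisible by it.\<close>

lemma (in group) transfer_not_in_derived:
  assumes fin: "finite (carrier G)" and R: "subgroup R G"
    and comm: "\<And>u v. u \<in> R \<Longrightarrow> v \<in> R \<Longrightarrow> u \<otimes> v = v \<otimes> u"
    and x: "x \<in> R" "prime (ord x)" and index: "\<not> ord x dvd card (rcosets R)"
    and fusion: "\<And>s. s \<in> carrier G \<Longrightarrow> conj_by G s x \<in> R \<Longrightarrow> conj_by G s x = x"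
  shows "x \<notin> derived G (carrier G)"
proof -
  have RG: "R \<subseteq> carrier G" using R by (rule subgroup.subset)
  have xG: "x \<in> carrier G" using x RG by blast
  define A where "A = G\<lparr>carrier := R\<rparr>"
  interpret A: comm_group A
    unfolding A_def using R comm
    by (intro group.group_comm_groupI subgroup_imp_group) auto
  have A_simps: "carrier A = R" "\<one>\<^bsub>A\<^esub> = \<one>" "u \<otimes>\<^bsub>A\<^esub> v = u \<otimes> v" for u v
    by (simp_all add: A_def)
  obtain rep where rep: "\<And>C. C \<in> rcosets R \<Longrightarrow> rep C \<in> C"
      "\<And>C. C \<in> rcosets R \<Longrightarrow> C #> x \<noteq> C \<Longrightarrow> rep (C #> x) = rep C \<otimes> x"
    using equivariant_transversal[OF xG x(2) R] by blast
  have cosub: "C \<subseteq> carrier G" if "C \<in> rcosets R" for C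
    using that subgroup.rcosets_carrier[OF R is_group] by blast
  have repG: "rep C \<in> carrier G" if "C \<in> rcosets R" for C
    using rep(1)[OF that] cosub[OF that] by blast
  have coset_mult: "(C #> g) #> h = C #> (g \<otimes> h)" if "C \<in> rcosets R" "g \<in> carrier G" "h \<in> carrier G" for C g h
    using coset_mult_assoc[OF cosub[OF that(1)] that(2,3)] .
  have coset_closed: "C #> g \<in> rcosets R" if "C \<in> rcosets R" "g \<in> carrier G" for C g
    using rcosets_translate[OF R that] .
  have Crep: "C = R #> h" if "C \<in> rcosets R" "h \<in> C" for C h
  proof -
    obtain s where "s \<in> carrier G" "C = R #> s" using \<open>C \<in> rcosets R\<close> by (auto simp: RCOSETS_def)
    then show ?thesis using repr_independence[OF _ _ R] that by blast
  qed
  define a where "a = (\<lambda>C t. rep C \<otimes> t \<otimes> inv (rep (C #> t)))"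
  have aR: "a C t \<in> R" if C: "C \<in> rcosets R" and t: "t \<in> carrier G" for C t
  proof -
    have "R #> (rep C \<otimes> t) = C #> t"
      using Crep[OF C rep(1)[OF C]] coset_mult_assoc[OF RG repG[OF C] t] by simp
    also have "\<dots> = R #> rep (C #> t)"
      using Crep[OF coset_closed[OF C t] rep(1)[OF coset_closed[OF C t]]] .
    finally show ?thesis
      unfolding a_def using r_coset_eq_iff[OF R] repG C t coset_closed by simp
  qed
  define V where "V = (\<lambda>t. finprod A (\<lambda>C. a C t) (rcosets R))"
  have finE: "finite (rcosets R)"
    using fin by (simp add: RCOSETS_def)
  have V_R: "V t \<in> R" if "t \<in> carrier G" for t
    using A.finprod_closed[of "\<lambda>C. a C t" "rcosets R"] aR that by (auto simp: V_def A_simps)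
  have V_mult: "V (t \<otimes> u) = V t \<otimes> V u" if t: "t \<in> carrier G" and u: "u \<in> carrier G" for t u
  proof -
    have inj: "inj_on (\<lambda>C. C #> t) (rcosets R)"
    proof (rule inj_onI)
      fix C D assume CD: "C \<in> rcosets R" "D \<in> rcosets R" "C #> t = D #> t"
      then have "C #> t #> inv t = D #> t #> inv t" by simp
      then show "C = D"
        using coset_mult[OF CD(1) t inv_closed[OF t]] coset_mult[OF CD(2) t inv_closed[OF t]]
          cosub[OF CD(1)] cosub[OF CD(2)] t by simp
    qed
    have img: "(\<lambda>C. C #> t) ` (rcosets R) = rcosets R"
      using coset_closed[OF _ t] by (intro endo_inj_surj[OF finE _ inj]) auto
    \<comment> \<open>Inserting the representative of \<open>C t\<close> splits each factor in two;
      translation by \<open>t\<close> permutes the cosets, so the second factors multiply to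
      \<open>V u\<close>.\<close>
    have "V (t \<otimes> u) = finprod A (\<lambda>C. a C t \<otimes>\<^bsub>A\<^esub> a (C #> t) u) (rcosets R)"
      unfolding V_def
    proof (rule A.finprod_cong')
      show "(\<lambda>C. a C t \<otimes>\<^bsub>A\<^esub> a (C #> t) u) \<in> rcosets R \<rightarrow> carrier A"
        using aR t u coset_closed subgroup.m_closed[OF R] by (auto simp: A_simps)
      show "a C (t \<otimes> u) = a C t \<otimes>\<^bsub>A\<^esub> a (C #> t) u" if "C \<in> rcosets R" for C
        using that t u repG coset_closed coset_mult by (simp add: a_def A_simps group_word)
    qed simp
    also have "\<dots> = V t \<otimes>\<^bsub>A\<^esub> finprod A (\<lambda>C. a (C #> t) u) (rcosets R)"
      unfolding V_def using aR t u coset_closed by (intro A.finprod_multf) (auto simp: A_simps)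
    also have "finprod A (\<lambda>C. a (C #> t) u) (rcosets R) = finprod A (\<lambda>C. a C u) ((\<lambda>C. C #> t) ` (rcosets R))"
      using inj aR t u coset_closed by (intro A.finprod_reindex[symmetric]) (auto simp: A_simps)
    finally show ?thesis unfolding img V_def by (simp add: A_simps)
  qed
  have V_one: "V \<one> = \<one>"
    using V_mult[of \<one> \<one>] V_R[of \<one>] RG by (metis l_one one_closed r_cancel_one' subsetD)
  have V_inv: "V (inv t) = inv (V t)" if "t \<in> carrier G" for t
    using V_mult[of "inv t" t] V_one V_R that RG by (metis inv_closed inv_equality l_inv subsetD)
  have ker: "subgroup {t \<in> carrier G. V t = \<one>} G"
    by (rule subgroupI) (auto simp: V_mult V_inv V_one intro!: exI[of _ \<one>])
  have "derived_set G (carrier G) \<subseteq> {t \<in> carrier G. V t = \<one>}"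
  proof clarsimp
    fix g h assume gh: "g \<in> carrier G" "h \<in> carrier G"
    have Vc: "V g \<in> carrier G" "V h \<in> carrier G" using V_R gh RG by blast+
    have "V (g \<otimes> h \<otimes> inv g \<otimes> inv h) = V g \<otimes> V h \<otimes> inv (V g) \<otimes> inv (V h)"
      using gh by (simp add: V_mult V_inv)
    also have "\<dots> = V h \<otimes> V g \<otimes> inv (V g) \<otimes> inv (V h)"
      using comm[OF V_R V_R] gh by simp
    also have "\<dots> = \<one>" using Vc by (simp add: group_word)
    finally show "V (g \<otimes> h \<otimes> inv g \<otimes> inv h) = \<one>" .
  qed
  then have der: "derived G (carrier G) \<subseteq> {t \<in> carrier G. V t = \<one>}"
    unfolding derived_def by (rule generate_subgroup_incl[OF _ ker])
  \<comment> \<open>On a fixed coset the factor is a conjugate of \<open>x\<close> lying in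
    \<open>R\<close>, which equals \<open>x\<close> by \<open>fusion\<close>; on a moved coset the
    equivariant representatives cancel.\<close>
  have a_x: "a C x = (if C #> x = C then x else \<one>)" if C: "C \<in> rcosets R" for C
  proof (cases "C #> x = C")
    case True
    then have "conj_by G (rep C) x \<in> R" using aR[OF C xG] by (simp add: a_def conj_by_def)
    then show ?thesis using True fusion[OF repG[OF C]] by (simp add: a_def conj_by_def)
  next
    case False
    then show ?thesis using rep(2)[OF C False] repG[OF C] xG by (simp add: a_def)
  qed
  define F where "F = {C \<in> rcosets R. C #> x = C}"
  have "V x = finprod A (\<lambda>C. x) F"
    unfolding V_def F_def
    using finE a_x x subgroup.one_closed[OF R]
    by (intro A.finprod_mono_neutral_cong_right) (auto simp: A_simps)
  also have "\<dots> = x [^]\<^bsub>A\<^esub> card F" using x by (intro A.finprod_const) (simp add: A_simps)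
  also have "\<dots> = x [^] card F"
    by (simp add: A_def nat_pow_consistent[symmetric])
  finally have Vx: "V x = x [^] card F" .
  have pow_inv: "C #> inv (x [^] k) = C" if "C \<in> F" for C and k :: nat
  proof -
    have C: "C \<in> rcosets R" "C #> x = C" using that by (auto simp: F_def)
    have "C #> x [^] k = C"
    proof (induction k)
      case (Suc k)
      then show ?case using coset_mult[OF C(1), of "x [^] k" x] xG C(2) by simp
    qed (use cosub[OF C(1)] in simp)
    then have "C #> inv (x [^] k) = C #> x [^] k #> inv (x [^] k)" by simp
    also have "\<dots> = C" using coset_mult[OF C(1)] xG cosub[OF C(1)] by simp
    finally show ?thesis .
  qed
  let ?X = "generate G {x}"
  have Xmem: "g \<in> ?X \<longleftrightarrow> (\<exists>k::nat. g = x [^] k)" for g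
    using generate_pow_on_finite_carrier[OF fin xG] by auto
  have XG: "?X \<subseteq> carrier G" using xG by (intro generate_incl) simp
  \<comment> \<open>The cyclic group generated by \<open>x\<close> has prime order and acts on the
    cosets by translation; its fixed points are the cosets fixed by \<open>x\<close>.\<close>
  have "[card (rcosets R) = card {C \<in> rcosets R. \<forall>g\<in>?X. C #> inv g = C}] (mod ord x)"
  proof (rule card_fixed_points_cong[where n = 1])
    show "subgroup ?X G" using xG by (intro generate_is_subgroup) simp
    show "card ?X = ord x ^ 1" using generate_pow_card[OF xG] by simp
    show "C #> inv g \<in> rcosets R" if "g \<in> ?X" "C \<in> rcosets R" for g C
      using that XG coset_closed by blast
    show "C #> inv \<one> = C" if "C \<in> rcosets R" for C using cosub[OF that] by simp
    show "C #> inv (g \<otimes> h) = C #> inv h #> inv g" if "g \<in> ?X" "h \<in> ?X" "C \<in> rcosets R" for g h C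
    proof -
      have "g \<in> carrier G" "h \<in> carrier G" using that XG by blast+
      then show ?thesis using coset_mult[OF that(3)] by (simp add: inv_mult_group)
    qed
  qed (fact x finE)+
  also have "{C \<in> rcosets R. \<forall>g\<in>?X. C #> inv g = C} = F"
  proof (intro equalityI subsetI)
    fix C assume C: "C \<in> {C \<in> rcosets R. \<forall>g\<in>?X. C #> inv g = C}"
    have "inv x \<in> ?X" using xG by (intro generate_m_inv_closed generate.incl) auto
    then have "C #> inv (inv x) = C" using C by blast
    then show "C \<in> F" using C xG by (simp add: F_def)
  next
    fix C assume C: "C \<in> F"
    then show "C \<in> {C \<in> rcosets R. \<forall>g\<in>?X. C #> inv g = C}"
      using pow_inv[OF C] Xmem by (auto simp: F_def)
  qed
  finally have "\<not> ord x dvd card F" using index cong_dvd_iff by blast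
  then have "V x \<noteq> \<one>" using Vx pow_eq_id[OF xG] by simp
  then show ?thesis using der by blast
qed

section \<open>Elements of prime order and normalisers of cyclic subgroups\<close>

context group
begin

lemma finite_ord_pos: "finite (carrier G) \<Longrightarrow> a \<in> carrier G \<Longrightarrow> ord a > 0"
  using ord_ge_1 by fastforce

lemma ord_pow_div:
  assumes "finite (carrier G)" "a \<in> carrier G" "prime r" "r dvd ord a"
  shows "ord (a [^] (ord a div r)) = r"
proof -
  obtain m where m: "ord a = r * m" using assms(4) by blast
  have "m \<noteq> 0" "r \<noteq> 0" using m finite_ord_pos[OF assms(1,2)] by auto
  then show ?thesis using ord_pow[OF assms(2), of m] m by simp
qed

lemma ord_prime_eqI:
  assumes "a \<in> carrier G" "prime r" "a \<noteq> \<one>" "a [^] r = \<one>"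
  shows "ord a = r"
  using assms pow_eq_id[OF assms(1)] ord_eq_1[OF assms(1)] prime_nat_iff by blast

lemma subgroup_generate_singleton: "a \<in> carrier G \<Longrightarrow> subgroup (generate G {a}) G"
  by (intro generate_is_subgroup) simp

lemma generate_singleton_subset: "subgroup S G \<Longrightarrow> a \<in> S \<Longrightarrow> generate G {a} \<subseteq> S"
  by (intro generate_subgroup_incl) simp_all

lemma generate_singleton_mem: "a \<in> generate G {a}"
  by (rule generate.incl) simp

lemma commute_pow_right:
  "\<lbrakk>x \<in> carrier G; y \<in> carrier G; x \<otimes> y = y \<otimes> x\<rbrakk> \<Longrightarrow> x \<otimes> y [^] (n::nat) = y [^] n \<otimes> x"
  by (metis conj_by_eq_self_iff conj_by_pow nat_pow_closed)

definition set_normalizer :: "'a set \<Rightarrow> 'a set" where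
  "set_normalizer A = {g \<in> carrier G. conj_by G g ` A = A}"

lemma subgroup_set_normalizer:
  assumes "A \<subseteq> carrier G"
  shows "subgroup (set_normalizer A) G"
proof -
  have comp: "conj_by G (g \<otimes> h) ` A = conj_by G g ` conj_by G h ` A"
    if "g \<in> carrier G" "h \<in> carrier G" for g h
    using that assms by (auto simp: image_image conj_by_conj_by subset_iff intro!: image_cong)
  have one: "conj_by G \<one> ` A = A"
    using assms by (force simp: subset_iff image_iff)
  show ?thesis
  proof (rule subgroupI)
    show "set_normalizer A \<noteq> {}" using one by (auto simp: set_normalizer_def)
    show "inv g \<in> set_normalizer A" if "g \<in> set_normalizer A" for g
      using that comp[of "inv g" g] one by (auto simp: set_normalizer_def)
    show "g \<otimes> h \<in> set_normalizer A" if "g \<in> set_normalizer A" "h \<in> set_normalizer A" for g h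
      using that comp[of g h] by (auto simp: set_normalizer_def)
  qed (auto simp: set_normalizer_def)
qed

lemma mem_set_normalizerI:
  assumes "finite A" "A \<subseteq> carrier G" "g \<in> carrier G" "conj_by G g ` A \<subseteq> A"
  shows "g \<in> set_normalizer A"
  using endo_inj_surj[OF assms(1,4) inj_on_conj_by[OF assms(3,2)]] assms(3)
  by (simp add: set_normalizer_def)

lemma mem_set_normalizer_generate_iff:
  assumes "finite (carrier G)" "a \<in> carrier G" "g \<in> carrier G"
  shows "g \<in> set_normalizer (generate G {a}) \<longleftrightarrow> conj_by G g a \<in> generate G {a}"
proof
  assume "g \<in> set_normalizer (generate G {a})"
  then have "conj_by G g ` generate G {a} = generate G {a}" by (simp add: set_normalizer_def)
  then show "conj_by G g a \<in> generate G {a}" using generate_singleton_mem by blast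
next
  assume c: "conj_by G g a \<in> generate G {a}"
  have sub: "generate G {a} \<subseteq> carrier G" using assms(2) by (intro generate_incl) simp
  show "g \<in> set_normalizer (generate G {a})"
  proof (rule mem_set_normalizerI[OF finite_subset[OF sub assms(1)] sub assms(3)], clarify)
    fix z assume "z \<in> generate G {a}"
    then obtain k :: nat where "z = a [^] k" using mem_generate_singleton_iff[OF assms(1,2)] by blast
    then have "conj_by G g z = conj_by G g a [^] k" using assms conj_by_pow by simp
    then show "conj_by G g z \<in> generate G {a}"
      using c subgroup_pow_closed[OF subgroup_generate_singleton[OF assms(2)]] by simp
  qed
qed

text \<open>Collection in nilpotency class two: each time a \<open>u\<close> passes a
  \<open>w\<close>, one commutator \<open>e\<close> appears, and \<open>n (n - 1) / 2\<close> such
  swaps sort the product. For an odd prime \<open>n\<close> this exponent is a multiple of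
  \<open>n\<close>.\<close>

lemma pow_mult_commutator:
  assumes c: "w \<in> carrier G" "u \<in> carrier G" "e \<in> carrier G"
    and uw: "u \<otimes> w = e \<otimes> w \<otimes> u" and ew: "e \<otimes> w = w \<otimes> e" and eu: "e \<otimes> u = u \<otimes> e"
  shows "(w \<otimes> u) [^] n = e [^] (n * (n - 1) div 2) \<otimes> w [^] n \<otimes> u [^] (n::nat)"
proof (induction n)
  case (Suc n)
  have un: "u [^] n \<otimes> w = e [^] n \<otimes> w \<otimes> u [^] n" for n :: nat
  proof (induction n)
    case (Suc n)
    have "u [^] Suc n \<otimes> w = u [^] n \<otimes> (u \<otimes> w)" using c by (simp add: m_assoc)
    also have "\<dots> = u [^] n \<otimes> e \<otimes> w \<otimes> u" using c uw by (simp add: m_assoc)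
    also have "\<dots> = e \<otimes> (u [^] n \<otimes> w) \<otimes> u"
      using c commute_pow_right[OF c(3,2) eu, of n] by (simp flip: m_assoc)
    also have "\<dots> = (e \<otimes> e [^] n) \<otimes> w \<otimes> (u [^] n \<otimes> u)"
      using c Suc by (simp add: m_assoc)
    finally show ?case using c by (simp flip: nat_pow_Suc2)
  qed (use c in simp)
  have tri: "Suc n * (Suc n - 1) div 2 = n * (n - 1) div 2 + n"
  proof -
    have "Suc n * (Suc n - 1) = n * (n - 1) + n * 2" by (cases n) (auto simp: algebra_simps)
    then show ?thesis by simp
  qed
  let ?T = "n * (n - 1) div 2"
  have "(w \<otimes> u) [^] Suc n = e [^] ?T \<otimes> w [^] n \<otimes> (u [^] n \<otimes> w) \<otimes> u"
    using c Suc by (simp add: m_assoc)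
  also have "\<dots> = e [^] ?T \<otimes> (w [^] n \<otimes> e [^] n) \<otimes> w \<otimes> u [^] n \<otimes> u"
    using c un[of n] by (simp add: m_assoc)
  also have "w [^] n \<otimes> e [^] n = e [^] n \<otimes> w [^] n"
  proof -
    have "e \<otimes> w [^] n = w [^] n \<otimes> e" using commute_pow_right[OF c(3,1) ew] .
    then show ?thesis using commute_pow_right[of "w [^] n" e n] c by simp
  qed
  also have "e [^] ?T \<otimes> (e [^] n \<otimes> w [^] n) \<otimes> w \<otimes> u [^] n \<otimes> u = (e [^] ?T \<otimes> e [^] n) \<otimes> w [^] Suc n \<otimes> u [^] Suc n"
    using c by (simp add: m_assoc)
  also have "e [^] ?T \<otimes> e [^] n = e [^] (Suc n * (Suc n - 1) div 2)"
    using c tri by (simp add: nat_pow_mult)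
  finally show ?case .
qed (use c in simp)

text \<open>Sylow's theorem with exponent 1 gives a subgroup of order \<open>r\<close>, in which
  every nonidentity element has order \<open>r\<close>.\<close>

lemma cauchy:
  assumes "finite (carrier G)" "subgroup S G" "prime r" "r dvd card S"
  shows "\<exists>a\<in>S. ord a = r"
proof -
  obtain m where m: "card S = r ^ 1 * m" using assms(4) by auto
  have SG: "S \<subseteq> carrier G" using assms(2) by (rule subgroup.subset)
  have "\<exists>H. subgroup H (G\<lparr>carrier := S\<rparr>) \<and> card H = r ^ 1"
    using assms m finite_subset[OF SG] by (intro sylow_thm[where m = m]) (auto simp: order_def subgroup_imp_group)
  then obtain H where H: "subgroup H (G\<lparr>carrier := S\<rparr>)" "card H = r" by auto
  then have HG: "subgroup H G" using incl_subgroup[OF assms(2)] by blast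
  have HS: "H \<subseteq> S" using subgroup.subset[OF H(1)] by simp
  have "H \<noteq> {\<one>}" using H(2) assms(3) by auto
  then obtain a where a: "a \<in> H" "a \<noteq> \<one>" using subgroup.one_closed[OF HG] by blast
  interpret H: group "G\<lparr>carrier := H\<rparr>" using HG by (rule subgroup_imp_group)
  have "a [^]\<^bsub>G\<lparr>carrier := H\<rparr>\<^esub> order (G\<lparr>carrier := H\<rparr>) = \<one>"
    using H.pow_order_eq_1[of a] a by simp
  then have "a [^] r = \<one>" using H(2) by (simp add: order_def nat_pow_consistent[symmetric])
  then show ?thesis using a HS SG ord_prime_eqI[of a r] assms(3) by blast
qed

lemma ord_dvd_card_subgroup:
  assumes "subgroup S G" "a \<in> S"
  shows "ord a dvd card S"
proof -
  interpret S: group "G\<lparr>carrier := S\<rparr>" using assms(1) by (rule subgroup_imp_group)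
  have "a [^]\<^bsub>G\<lparr>carrier := S\<rparr>\<^esub> order (G\<lparr>carrier := S\<rparr>) = \<one>"
    using S.pow_order_eq_1[of a] assms by simp
  then have "a [^] card S = \<one>" by (simp add: order_def nat_pow_consistent[symmetric])
  then show ?thesis using pow_eq_id subgroup.mem_carrier[OF assms] by blast
qed

end

section \<open>Fixed-point-free automorphisms of groups of rank one\<close>

text \<open>\<open>free\<close> expresses that \<open>M\<close> is a Frobenius kernel, and
  \<open>rank_one\<close> is the property that \<open>M\<close> inherits from acting without fixed
  points on the centre of \<open>K\<close>.\<close>

locale fpf_kernel = group G for G (structure) +
  fixes M
  assumes finite_carrier: "finite (carrier G)"
    and normal_kernel: "M \<lhd> G" and proper: "M \<noteq> carrier G"
    and free: "\<lbrakk>y \<in> carrier G; y \<notin> M; m \<in> M; y \<otimes> m = m \<otimes> y\<rbrakk> \<Longrightarrow> m = \<one>"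
    and rank_one: "\<lbrakk>a \<in> M; b \<in> M; prime (ord a); ord b = ord a; a \<otimes> b = b \<otimes> a\<rbrakk> \<Longrightarrow> b \<in> generate G {a}"
begin

lemma subgroup_M: "subgroup M G" using normal_kernel by (rule normal_imp_subgroup)
lemma M_carrier: "M \<subseteq> carrier G" using subgroup_M by (rule subgroup.subset)

text \<open>The map \<open>s \<mapsto> s\<^sup>-\<^sup>1 (y s y\<^sup>-\<^sup>1)\<close> is a bijection of \<open>T\<close>, and its values act trivially on a
  cyclic group because automorphisms of cyclic groups commute.\<close>

lemma normalizing_imp_centralizing:
  assumes a: "a \<in> carrier G" and T: "subgroup T G" "T \<subseteq> M" "T \<subseteq> set_normalizer (generate G {a})"
    and y: "y \<in> carrier G" "y \<notin> M" "y \<in> set_normalizer (generate G {a})" "conj_by G y ` T \<subseteq> T"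
    and t: "t \<in> T"
  shows "t \<otimes> a = a \<otimes> t"
proof -
  have TG: "T \<subseteq> carrier G" using T M_carrier by blast
  define \<phi> where "\<phi> = (\<lambda>s. inv s \<otimes> conj_by G y s)"
  have yT: "conj_by G y s \<in> T" if "s \<in> T" for s using that y by blast
  have \<phi>T: "\<phi> ` T \<subseteq> T" using yT subgroupE(3,4)[OF T(1)] by (auto simp: \<phi>_def)
  \<comment> \<open>If \<open>s\<close> and \<open>u\<close> have the same value, then
    \<open>u s^-1\<close> commutes with \<open>y\<close> and is trivial by
    \<open>free\<close>.\<close>
  have "inj_on \<phi> T"
  proof (rule inj_onI)
    fix s u assume su: "s \<in> T" "u \<in> T" and eq: "\<phi> s = \<phi> u"
    have sG: "s \<in> carrier G" "u \<in> carrier G" using su TG by blast+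
    have yc: "conj_by G y s \<in> carrier G" "conj_by G y u \<in> carrier G" using sG y by simp_all
    have "u \<otimes> \<phi> s \<otimes> inv (conj_by G y s) = u \<otimes> \<phi> u \<otimes> inv (conj_by G y s)" using eq by simp
    then have "u \<otimes> inv s = conj_by G y u \<otimes> inv (conj_by G y s)"
      using sG yc by (simp add: \<phi>_def group_word)
    also have "\<dots> = conj_by G y (u \<otimes> inv s)" using sG y by (simp add: conj_by_mult conj_by_inv)
    finally have "y \<otimes> (u \<otimes> inv s) = (u \<otimes> inv s) \<otimes> y"
      using conj_by_eq_self_iff[of y "u \<otimes> inv s"] sG y by simp
    moreover have "u \<otimes> inv s \<in> M" using su T(2) subgroupE(3,4)[OF T(1)] by blast
    ultimately have "u \<otimes> inv s = \<one>" using free y by blast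
    then show "s = u" using sG by (metis inv_closed inv_equality inv_inv)
  qed
  then have surj: "\<phi> ` T = T"
    using endo_inj_surj[OF _ \<phi>T] finite_subset[OF TG finite_carrier] by blast
  have power: "\<exists>k::nat. conj_by G g a = a [^] k" if "g \<in> set_normalizer (generate G {a})" for g
    using that mem_set_normalizer_generate_iff[OF finite_carrier a] mem_generate_singleton_iff[OF finite_carrier a]
    by (auto simp: set_normalizer_def)
  obtain i :: nat where i: "conj_by G y a = a [^] i" using power y by blast
  have "conj_by G v (conj_by G y a) = conj_by G y a" if v: "v \<in> T" for v
  proof -
    obtain s where s: "s \<in> T" "v = inv s \<otimes> conj_by G y s" using v surj by (auto simp: \<phi>_def)
    have sG: "s \<in> carrier G" using s TG by blast
    obtain k :: nat where k: "conj_by G s a = a [^] k" using power s T(3) by blast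
    \<comment> \<open>Conjugation by \<open>s\<close> and by \<open>y s y^-1\<close> have the same
      effect on \<open>y a y^-1\<close>: both raise it to the power \<open>k\<close>.\<close>
    have "conj_by G (conj_by G y s) (conj_by G y a) = conj_by G y (conj_by G s a)"
      using sG y a by (simp add: conj_by_def group_word)
    also have "\<dots> = conj_by G y a [^] k" using k y a by (simp add: conj_by_pow)
    also have "\<dots> = conj_by G s a [^] i" using i k a by (simp add: nat_pow_pow mult.commute)
    also have "\<dots> = conj_by G s (conj_by G y a)" using i sG a by (simp add: conj_by_pow)
    finally have "conj_by G (inv s) (conj_by G (conj_by G y s) (conj_by G y a)) = conj_by G y a"
      using sG y a by simp
    then show ?thesis using s sG y a by (simp add: conj_by_conj_by m_assoc)
  qed
  \<comment> \<open>For \<open>v = y t y^-1\<close> the outer conjugation by \<open>y\<close>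
    cancels and the statement for \<open>t\<close> remains.\<close>
  from this[OF yT[OF t]] have "conj_by G y (conj_by G t a) = conj_by G y a"
    using y a t TG by (auto simp: conj_by_def group_word)
  then have "conj_by G t a = a" using conj_by_inject y a t TG by auto
  then show ?thesis using conj_by_eq_self_iff a t TG by blast
qed

text \<open>A group of order 2 has no nontrivial automorphism, so for \<open>r = 2\<close> the
  normalising element \<open>y\<close> would centralise \<open>x\<close>, against
  \<open>free\<close>.\<close>

lemma prime_ord_odd:
  assumes "x \<in> M" "ord x = r" "prime r" "y \<in> carrier G" "y \<notin> M" "y \<in> set_normalizer (generate G {x})"
  shows "odd r"
proof
  assume "even r"
  then have r: "r = 2" using assms(3) primes_dvd_imp_eq two_is_prime_nat by blast
  have xG: "x \<in> carrier G" using assms M_carrier by blast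
  have "x \<noteq> \<one>" using assms by auto
  have "conj_by G y x \<in> generate G {x}"
    using mem_set_normalizer_generate_iff[OF finite_carrier xG assms(4)] assms(6) by blast
  then obtain k :: nat where k: "conj_by G y x = x [^] k"
    using mem_generate_singleton_iff[OF finite_carrier xG] by blast
  have "conj_by G y x \<noteq> \<one>" using conj_by_inject[of y x \<one>] assms xG \<open>x \<noteq> \<one>\<close> by simp
  then have "odd k" using k pow_eq_id[OF xG, of k] assms(2) r by auto
  then obtain l where "k = 2 * l + 1" by (auto elim: oddE)
  then have "x [^] k = x" using xG pow_eq_id[OF xG, of "2 * l"] assms(2) r by simp
  then have "y \<otimes> x = x \<otimes> y" using k conj_by_eq_self_iff assms xG by simp
  then show False using free assms \<open>x \<noteq> \<one>\<close> by blast
qed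

end

text \<open>An element central modulo \<open>A\<close> stays so when raised to powers, because
  \<open>A\<close> is central. Among its powers with exponent \<open>r^j\<close>, the last one
  outside \<open>A\<close> also has its \<open>r\<close>-th power in \<open>A\<close>.\<close>

lemma (in group) central_mod_prime_step:
  assumes R: "subgroup R G" "prime r" "card R = r ^ n"
    and A: "subgroup A G" "A \<subset> R" and central: "\<And>g a. g \<in> R \<Longrightarrow> a \<in> A \<Longrightarrow> g \<otimes> a = a \<otimes> g"
  shows "\<exists>b\<in>R - A. b [^] r \<in> A \<and> (\<forall>g\<in>R. conj_by G g b \<otimes> inv b \<in> A)"
proof -
  have RG: "R \<subseteq> carrier G" using R by (simp add: subgroup.subset)
  have "\<exists>b\<in>R - A. \<forall>g\<in>R. conj_by G g b \<otimes> inv b \<in> A"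
  proof (rule prime_power_group_central_mod[OF R A])
    fix g a assume ga: "g \<in> R" "a \<in> A"
    then have "conj_by G g a = a"
      using conj_by_eq_self_iff[of g a] central[OF ga] RG A by auto
    then show "conj_by G g a \<in> A" using ga by simp
  qed
  then obtain b where b: "b \<in> R" "b \<notin> A" "\<And>g. g \<in> R \<Longrightarrow> conj_by G g b \<otimes> inv b \<in> A" by blast
  have bG: "b \<in> carrier G" using b RG by blast
  have step: "conj_by G g (b [^] m) \<otimes> inv (b [^] m) \<in> A" if g: "g \<in> R" for g and m :: nat
  proof -
    define c where "c = conj_by G g b \<otimes> inv b"
    have c: "c \<in> A" "c \<in> carrier G" using b(3)[OF g] A RG by (auto simp: c_def)
    have "conj_by G g b = c \<otimes> b" using g RG bG by (auto simp: c_def m_assoc)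
    then have "conj_by G g (b [^] m) = (c \<otimes> b) [^] m" using g RG bG by (auto simp: conj_by_pow)
    also have "\<dots> = c [^] m \<otimes> b [^] m"
      using central[OF b(1) c(1)] c bG by (intro pow_mult_distrib) auto
    finally have "conj_by G g (b [^] m) \<otimes> inv (b [^] m) = c [^] m" using c bG by (simp add: m_assoc)
    then show ?thesis using subgroup_pow_closed[OF A(1) c(1)] by simp
  qed
  have "b [^] (r ^ n) = \<one>"
    using ord_dvd_card_subgroup[OF R(1) b(1)] R(3) pow_eq_id[OF bG] by simp
  then have "b [^] (r ^ n) \<in> A" using A subgroup.one_closed by metis
  then obtain i where i: "b [^] (r ^ i) \<in> A" "\<And>j. j < i \<Longrightarrow> b [^] (r ^ j) \<notin> A"
    using exists_least_iff[of "\<lambda>i. b [^] (r ^ i) \<in> A"] by blast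
  have "i \<noteq> 0" using i(1) b(2) bG by (cases i) auto
  then obtain j where j: "i = Suc j" by (cases i) auto
  let ?b = "b [^] (r ^ j)"
  have "?b [^] r = b [^] (r ^ i)" using bG j by (simp add: nat_pow_pow mult.commute)
  then have "?b [^] r \<in> A" using i by simp
  moreover have "?b \<in> R - A" using i(2)[of j] j subgroup_pow_closed[OF R(1) b(1)] by simp
  ultimately show ?thesis using step by blast
qed

context fpf_kernel
begin

text \<open>A maximal cyclic subgroup \<open>A\<close> among those normalised by \<open>R\<close> and \<open>y\<close> is central in \<open>R\<close>.
  If \<open>A \<noteq> R\<close>, an element \<open>b\<close> of order \<open>r\<close> and central modulo \<open>A\<close> generates a larger one:
  since \<open>M\<close> has rank one, \<open>b\<^sup>r\<close> generates \<open>A\<close>.\<close>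

lemma invariant_prime_power_subgroup_cyclic:
  assumes R: "subgroup R G" "R \<subseteq> M" "prime r" "card R = r ^ n"
    and y: "y \<in> carrier G" "y \<notin> M" "y \<in> set_normalizer R"
  shows "\<exists>a\<in>R. R = generate G {a}"
proof (cases "R = {\<one>}")
  case True
  then show ?thesis by (simp add: generate_one)
next
  case False
  have RG: "R \<subseteq> carrier G" using R by (simp add: subgroup.subset)
  have conjR: "conj_by G g b \<in> R" if "g \<in> R" "b \<in> R" for g b
    using that subgroupE(3,4)[OF R(1)] by (simp add: conj_by_def)
  have yR: "conj_by G y b \<in> R" if "b \<in> R" for b
    using that y(3) by (auto simp: set_normalizer_def)
  have ordR: "\<exists>k. ord b = r ^ k" if "b \<in> R" for b
    using ord_dvd_card_subgroup[OF R(1) that] R(4) divides_primepow_nat[OF R(3)] by auto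
  define C where "C = {a \<in> R. R \<subseteq> set_normalizer (generate G {a}) \<and> y \<in> set_normalizer (generate G {a})}"
  have central: "g \<otimes> a = a \<otimes> g" if a: "a \<in> C" and g: "g \<in> R" for a g
    using a g RG R(2) y yR
    by (intro normalizing_imp_centralizing[where T = R and y = y] R(1)) (auto simp: C_def)
  \<comment> \<open>With the trivial subgroup as \<open>A\<close> the step yields a central element
    of order \<open>r\<close>. It shows that \<open>C\<close> is nonempty and that the maximal order
    is at least \<open>r\<close>.\<close>
  have "\<exists>b\<in>R - {\<one>}. b [^] r \<in> {\<one>} \<and> (\<forall>g\<in>R. conj_by G g b \<otimes> inv b \<in> {\<one>})"
    using False subgroup.one_closed[OF R(1)] RG
    by (intro central_mod_prime_step[OF R(1,3,4)] triv_subgroup) auto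
  then obtain x0 where x0: "x0 \<in> R" "x0 \<noteq> \<one>" "x0 [^] r = \<one>" "\<And>g. g \<in> R \<Longrightarrow> conj_by G g x0 \<otimes> inv x0 = \<one>"
    by blast
  have x0G: "x0 \<in> carrier G" using x0 RG by blast
  have x0c: "conj_by G g x0 = x0" if "g \<in> R" for g
    using x0(4)[OF that] inv_equality[of "conj_by G g x0" "inv x0"] subsetD[OF RG that] x0G by simp
  have ordx0: "ord x0 = r" using ord_prime_eqI[OF x0G R(3) x0(2,3)] .
  have unique0: "z \<in> generate G {x0}" if "z \<in> R" "ord z = r" for z
  proof (rule rank_one)
    show "x0 \<otimes> z = z \<otimes> x0" using x0c[OF that(1)] conj_by_eq_self_iff[of z x0] x0G that RG by auto
  qed (use that x0 ordx0 R in auto)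
  have "x0 \<in> C"
  proof -
    have "g \<in> set_normalizer (generate G {x0})" if "g \<in> R \<or> g = y" for g
    proof -
      have "g \<in> carrier G" "conj_by G g x0 \<in> R" using that RG y x0 conjR yR by auto
      then show ?thesis
        using mem_set_normalizer_generate_iff[OF finite_carrier x0G] unique0 ord_conj_by[of g x0] ordx0 x0G by simp
    qed
    then show ?thesis using x0(1) by (auto simp: C_def)
  qed
  have finC: "finite C" using finite_subset[OF RG finite_carrier] by (simp add: C_def)
  have "Max (ord ` C) \<in> ord ` C" using finC \<open>x0 \<in> C\<close> by (intro Max_in) auto
  then obtain a where a: "a \<in> C" "ord a = Max (ord ` C)" by auto
  then have max: "ord b \<le> ord a" if "b \<in> C" for b using finC that by simp
  have aR: "a \<in> R" using a by (simp add: C_def)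
  then have aG: "a \<in> carrier G" using RG by blast
  let ?A = "generate G {a}"
  have Asub: "subgroup ?A G" using subgroup_generate_singleton[OF aG] .
  have AR: "?A \<subseteq> R" using generate_singleton_subset[OF R(1) aR] .
  have Acentral: "g \<otimes> z = z \<otimes> g" if "g \<in> R" "z \<in> ?A" for g z
  proof -
    obtain k :: nat where "z = a [^] k" using \<open>z \<in> ?A\<close> mem_generate_singleton_iff[OF finite_carrier aG] by blast
    then show ?thesis using commute_pow_right[of g a k] central[OF a(1) that(1)] that(1) RG aG by auto
  qed
  have orda: "r dvd ord a"
  proof -
    obtain k where k: "ord a = r ^ k" using ordR[OF aR] by blast
    have "r \<le> ord a" using max[OF \<open>x0 \<in> C\<close>] ordx0 by simp
    then have "k \<noteq> 0" using k prime_gt_1_nat[OF R(3)] by (cases k) auto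
    then show ?thesis using k by simp
  qed
  define x where "x = a [^] (ord a div r)"
  have x: "x \<in> ?A" "x \<in> R" "ord x = r"
    using ord_pow_div[OF finite_carrier aG R(3) orda] mem_generate_singleton_iff[OF finite_carrier aG]
      subgroup_pow_closed[OF R(1) aR] by (auto simp: x_def)
  \<comment> \<open>The central group \<open>A\<close> contains \<open>x\<close> of order
    \<open>r\<close>, so rank one puts every further element of order \<open>r\<close> of
    \<open>R\<close> into \<open>A\<close>.\<close>
  have inA: "z \<in> ?A" if "z \<in> R" "z [^] r = \<one>" for z
  proof (cases "z = \<one>")
    case True
    then show ?thesis using subgroup.one_closed[OF Asub] by simp
  next
    case False
    have "z \<in> carrier G" using that RG by blast
    then have "ord z = r" using ord_prime_eqI[OF _ R(3) False that(2)] by blast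
    then have "z \<in> generate G {x}"
      using rank_one[of x z] x that R Acentral[OF that(1) x(1)] by auto
    then show ?thesis using generate_singleton_subset[OF Asub x(1)] by blast
  qed
  have "R = ?A"
  proof (rule ccontr)
    assume "R \<noteq> ?A"
    then have "?A \<subset> R" using AR by blast
    then obtain b where b: "b \<in> R" "b \<notin> ?A" "b [^] r \<in> ?A" "\<And>g. g \<in> R \<Longrightarrow> conj_by G g b \<otimes> inv b \<in> ?A"
      using central_mod_prime_step[OF R(1,3,4) Asub _ Acentral] by blast
    have bG: "b \<in> carrier G" using b RG by blast
    let ?B = "generate G {b}"
    have Bsub: "subgroup ?B G" using subgroup_generate_singleton[OF bG] .
    have BR: "?B \<subseteq> R" using generate_singleton_subset[OF R(1) b(1)] .
    obtain j :: nat where j: "b [^] r = a [^] j" using b(3) mem_generate_singleton_iff[OF finite_carrier aG] by blast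
    \<comment> \<open>If \<open>b^r\<close> were the \<open>r\<close>-th power of an element of
      \<open>A\<close>, dividing \<open>b\<close> by that element would give an element with trivial
      \<open>r\<close>-th power. It would lie in \<open>A\<close>, and so would
      \<open>b\<close>.\<close>
    have "\<not> r dvd j"
    proof
      assume "r dvd j"
      then obtain m where m: "j = m * r" by (metis dvdE mult.commute)
      let ?z = "b \<otimes> inv (a [^] m)"
      have am: "a [^] m \<in> ?A" using mem_generate_singleton_iff[OF finite_carrier aG] by blast
      have iam: "inv (a [^] m) \<in> ?A" using subgroup.m_inv_closed[OF Asub am] .
      have "?z [^] r = b [^] r \<otimes> inv (a [^] m) [^] r"
        using Acentral[OF b(1) iam] bG aG by (intro pow_mult_distrib) auto
      also have "inv (a [^] m) [^] r = inv (a [^] j)" using aG m by (simp add: nat_pow_inv nat_pow_pow)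
      finally have "?z [^] r = \<one>" using j aG by simp
      moreover have "?z \<in> R" using b(1) iam AR subgroup.m_closed[OF R(1)] by blast
      ultimately have "?z \<in> ?A" using inA by blast
      then have "?z \<otimes> a [^] m \<in> ?A" using am subgroup.m_closed[OF Asub] by blast
      then show False using b(2) bG aG by (simp add: m_assoc)
    qed
    obtain e where e: "ord a = r ^ e" using ordR[OF aR] by blast
    have "coprime j (ord a)"
      using \<open>\<not> r dvd j\<close> R(3) e by (metis coprime_commute coprime_power_right_iff prime_imp_coprime_nat)
    then obtain q :: nat where "(a [^] j) [^] q = a" by (rule pow_coprime_root[OF aG])
    then have a_pow: "a = (b [^] r) [^] q" using j by simp
    then have "a = b [^] (r * q)" using bG by (simp add: nat_pow_pow)
    then have "a \<in> ?B" using mem_generate_singleton_iff[OF finite_carrier bG] by blast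
    then have AB: "?A \<subseteq> ?B" using generate_singleton_subset[OF Bsub] by blast
    moreover have "?A \<noteq> ?B" using b(2) generate_singleton_mem by blast
    ultimately have "card ?A < card ?B"
      using finite_subset[OF BR finite_subset[OF RG finite_carrier]] by (intro psubset_card_mono) auto
    then have lt: "ord a < ord b" using generate_pow_card aG bG by simp
    have normR: "g \<in> set_normalizer ?B" if g: "g \<in> R" for g
    proof -
      have gG: "g \<in> carrier G" using g RG by blast
      have "conj_by G g b \<otimes> inv b \<in> ?B" using b(4)[OF g] AB by blast
      then have "conj_by G g b \<otimes> inv b \<otimes> b \<in> ?B"
        using subgroup.m_closed[OF Bsub _ generate_singleton_mem] by blast
      then have "conj_by G g b \<in> ?B" using gG bG by (simp add: m_assoc)
      then show ?thesis using mem_set_normalizer_generate_iff[OF finite_carrier bG gG] by blast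
    qed
    \<comment> \<open>The conjugate \<open>u\<close> of \<open>b\<close> has its \<open>r\<close>-th
      power in \<open>A\<close>, which \<open>b^r\<close> generates; so some power \<open>w\<close>
      of \<open>b\<close> satisfies \<open>w^r = u^-r\<close>. If also \<open>(w u)^r = 1\<close>,
      then \<open>w u\<close> lies in \<open>A\<close>, and \<open>u\<close> in \<open>B\<close>.
      Only the commutator \<open>d\<close> of \<open>u\<close> and \<open>w\<close> stands in the
      way.\<close>
    have "y \<in> set_normalizer ?B"
    proof -
      define u where "u = conj_by G y b"
      have u: "u \<in> R" "u \<in> carrier G" using yR[OF b(1)] y(1) bG by (simp_all add: u_def)
      have "u [^] r = conj_by G y (b [^] r)" using y bG by (simp add: u_def conj_by_pow)
      also have "\<dots> \<in> conj_by G y ` ?A" using b(3) by blast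
      also have "conj_by G y ` ?A = ?A" using a by (simp add: C_def set_normalizer_def)
      finally have urA: "u [^] r \<in> ?A" .
      then obtain l :: nat where l: "u [^] r = a [^] l"
        using mem_generate_singleton_iff[OF finite_carrier aG] by blast
      have "(b [^] r) [^] (q * l) = u [^] r"
      proof -
        have "a [^] l = (b [^] r) [^] (q * l)"
          using a_pow bG by (metis nat_pow_pow nat_pow_closed)
        then show ?thesis using l by simp
      qed
      then have ur: "u [^] r = (b [^] (q * l)) [^] r"
        using bG by (simp add: nat_pow_pow mult.commute mult.left_commute)
      define w where "w = inv (b [^] (q * l))"
      have vB: "b [^] (q * l) \<in> ?B" using mem_generate_singleton_iff[OF finite_carrier bG] by blast
      have w: "w \<in> ?B" "w \<in> R" "w \<in> carrier G"
        using subgroup.m_inv_closed[OF Bsub vB] BR RG by (auto simp: w_def)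
      have wr: "w [^] r = inv (u [^] r)" using ur bG by (simp add: w_def nat_pow_inv)
      define d where "d = conj_by G u w \<otimes> inv w"
      have dA: "d \<in> ?A"
      proof -
        define c where "c = conj_by G u b \<otimes> inv b"
        have c: "c \<in> ?A" "c \<in> carrier G" using b(4)[OF u(1)] u bG by (auto simp: c_def)
        have "conj_by G u b = c \<otimes> b" using u bG by (simp add: c_def m_assoc)
        then have "conj_by G u (b [^] (q * l)) = (c \<otimes> b) [^] (q * l)" using u bG by (simp add: conj_by_pow)
        also have "\<dots> = c [^] (q * l) \<otimes> b [^] (q * l)"
          using Acentral[OF b(1) c(1)] c bG by (intro pow_mult_distrib) auto
        finally have "conj_by G u w = w \<otimes> inv (c [^] (q * l))"
          using u bG c by (simp add: w_def conj_by_inv inv_mult_group)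
        moreover have cA: "inv (c [^] (q * l)) \<in> ?A"
          using subgroup.m_inv_closed[OF Asub subgroup_pow_closed[OF Asub c(1)]] .
        moreover have "w \<otimes> inv (c [^] (q * l)) = inv (c [^] (q * l)) \<otimes> w"
          using Acentral[OF w(2) cA] .
        ultimately have "d = inv (c [^] (q * l))" using w c by (simp add: d_def m_assoc)
        then show ?thesis using cA by simp
      qed
      then have d: "d \<in> R" "d \<in> carrier G" using AR RG by blast+
      have uw: "u \<otimes> w = d \<otimes> w \<otimes> u" using u w by (simp add: d_def conj_by_def m_assoc)
      have dw: "d \<otimes> w = w \<otimes> d" and du: "d \<otimes> u = u \<otimes> d"
        using Acentral[OF w(2) dA] Acentral[OF u(1) dA] by simp_all
      \<comment> \<open>Conjugation by \<open>u\<close> multiplies \<open>w\<close> by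
        \<open>d\<close> and so \<open>w^r\<close> by \<open>d^r\<close>; but \<open>w^r\<close>
        lies in the central group \<open>A\<close>.\<close>
      have "d [^] r = \<one>"
      proof -
        have "conj_by G u w = d \<otimes> w" using u w by (simp add: d_def m_assoc)
        then have "conj_by G u (w [^] r) = d [^] r \<otimes> w [^] r"
          using pow_mult_distrib[OF dw d(2) w(3)] conj_by_pow[OF u(2) w(3)] by simp
        moreover have "conj_by G u (w [^] r) = w [^] r"
        proof -
          have "w [^] r \<in> ?A" using wr urA subgroup.m_inv_closed[OF Asub] by simp
          then show ?thesis using Acentral[OF u(1)] conj_by_eq_self_iff[of u "w [^] r"] u w by simp
        qed
        ultimately show ?thesis using d w by simp
      qed
      \<comment> \<open>For odd \<open>r\<close> the exponent \<open>r (r - 1) / 2\<close> is a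
        multiple of \<open>r\<close> and the commutator factor vanishes. For \<open>r = 2\<close> it
        would survive, as it does in the quaternion group.\<close>
      moreover have "odd r"
      proof (rule prime_ord_odd[OF _ ordx0 R(3) y(1,2)])
        show "x0 \<in> M" using x0 R by blast
        show "y \<in> set_normalizer (generate G {x0})" using \<open>x0 \<in> C\<close> by (simp add: C_def)
      qed
      then obtain k where k: "r = 2 * k + 1" by (rule oddE)
      have "r * (r - 1) div 2 = r * k" unfolding k by simp
      ultimately have d1: "d [^] (r * (r - 1) div 2) = \<one>"
        using nat_pow_pow[OF d(2), of r k] by simp
      have "(w \<otimes> u) [^] r = d [^] (r * (r - 1) div 2) \<otimes> w [^] r \<otimes> u [^] r"
        by (rule pow_mult_commutator[OF w(3) u(2) d(2) uw dw du])
      also have "\<dots> = inv (u [^] r) \<otimes> u [^] r" using u(2) by (simp only: d1 wr l_one inv_closed nat_pow_closed)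
      also have "\<dots> = \<one>" using u(2) by (intro l_inv nat_pow_closed)
      finally have "(w \<otimes> u) [^] r = \<one>" .
      then have "w \<otimes> u \<in> ?A" using inA subgroup.m_closed[OF R(1) w(2) u(1)] by blast
      then have "inv w \<otimes> (w \<otimes> u) \<in> ?B"
        using AB subgroup.m_closed[OF Bsub] subgroup.m_inv_closed[OF Bsub w(1)] by blast
      then have "u \<in> ?B" using w u by (simp add: inv_mult_cancel_left)
      then show ?thesis
        using mem_set_normalizer_generate_iff[OF finite_carrier bG y(1)] by (simp add: u_def)
    qed
    then have "b \<in> C" using normR b(1) by (auto simp: C_def)
    then show False using max[of b] lt by simp
  qed
  then show ?thesis using aR by blast
qed

end

section \<open>Restriction to subgroups and Sylow subgroups\<close>

context group
begin

lemma ord_restrict: "subgroup S G \<Longrightarrow> group.ord (G\<lparr>carrier := S\<rparr>) x = ord x"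
  by (simp add: group.ord_def[OF subgroup_imp_group] ord_def nat_pow_consistent[symmetric])

lemma conj_by_restrict: "subgroup S G \<Longrightarrow> g \<in> S \<Longrightarrow> conj_by (G\<lparr>carrier := S\<rparr>) g x = conj_by G g x"
  by (simp add: conj_by_def m_inv_consistent)

lemma rcosets_restrict: "rcosets\<^bsub>G\<lparr>carrier := S\<rparr>\<^esub> R = (\<lambda>s. R #> s) ` S"
  by (auto simp: RCOSETS_def)

lemma sylow_subgroup:
  assumes "finite (carrier G)" "subgroup S G" "prime r"
  shows "\<exists>R n. subgroup R G \<and> R \<subseteq> S \<and> card R = r ^ n \<and> \<not> r dvd card ((\<lambda>s. R #> s) ` S)"
proof -
  have SG: "S \<subseteq> carrier G" using assms(2) by (rule subgroup.subset)
  have "card S \<noteq> 0" using finite_subset[OF SG assms(1)] subgroup.one_closed[OF assms(2)] by auto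
  then obtain m where m: "card S = r ^ multiplicity r (card S) * m" "\<not> r dvd m"
    using multiplicity_decompose'[of "card S" r] assms(3) not_prime_unit by metis
  let ?n = "multiplicity r (card S)"
  have "\<exists>H. subgroup H (G\<lparr>carrier := S\<rparr>) \<and> card H = r ^ ?n"
    using assms m finite_subset[OF SG] by (intro sylow_thm[where m = m]) (auto simp: order_def subgroup_imp_group)
  then obtain R where R: "subgroup R (G\<lparr>carrier := S\<rparr>)" "card R = r ^ ?n" by auto
  have RG: "subgroup R G" using incl_subgroup[OF assms(2) R(1)] .
  have RS: "R \<subseteq> S" using subgroup.subset[OF R(1)] by simp
  have "card ((\<lambda>s. R #> s) ` S) * r ^ ?n = r ^ ?n * m"
    using card_subgroup_factor[OF RG assms(2) RS] R(2) m(1) by simp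
  moreover have "r > 0" using assms(3) by (rule prime_gt_0_nat)
  ultimately have "card ((\<lambda>s. R #> s) ` S) = m" by simp
  then show ?thesis using RG RS R(2) m(2) by blast
qed

end

context fpf_kernel
begin

text \<open>A Sylow subgroup \<open>R\<close> of \<open>S\<close> is normalised by some
  \<open>y\<close> outside \<open>M\<close> and therefore cyclic. No element of \<open>S\<close> can
  move the element \<open>x\<close> of order \<open>r\<close> to another element of
  \<open>R\<close>, so the transfer to \<open>R\<close> keeps \<open>x\<close> out of the derived
  subgroup.\<close>

lemma derived_normal_subgroup_proper:
  assumes S: "S \<lhd> G" "S \<subseteq> M" "S \<noteq> {\<one>}"
  shows "derived G S \<noteq> S"
proof -
  have Ssub: "subgroup S G" using S(1) by (rule normal_imp_subgroup)
  have SG: "S \<subseteq> carrier G" using Ssub by (rule subgroup.subset)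
  have finS: "finite S" using SG finite_carrier by (rule finite_subset)
  have "card S \<noteq> 1" using S(3) subgroup.one_closed[OF Ssub] by (metis card_1_singletonE singletonD)
  then obtain r where r: "prime r" "r dvd card S" using prime_factor_nat by blast
  obtain R n where R: "subgroup R G" "R \<subseteq> S" "card R = r ^ n" "\<not> r dvd card ((\<lambda>s. R #> s) ` S)"
    using sylow_subgroup[OF finite_carrier Ssub r(1)] by blast
  have RG: "R \<subseteq> carrier G" using R(2) SG by blast
  have RM: "R \<subseteq> M" using R(2) S(2) by blast
  obtain y0 where y0: "y0 \<in> carrier G" "y0 \<notin> M" using proper M_carrier by blast
  have cR: "card (conj_by G y0 ` R) = r ^ n"
    using card_image[OF inj_on_conj_by[OF y0(1) RG]] R(3) by simp
  have "conj_by G y0 ` R \<subseteq> S" using conj_by_in_normal[OF S(1) y0(1)] R(2) by blast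
  \<comment> \<open>Frattini argument: an element \<open>s\<close> of \<open>S\<close> carries the
    \<open>y0\<close>-conjugate of \<open>R\<close> back into \<open>R\<close>. Then
    \<open>s y0\<close> normalises \<open>R\<close> and still lies outside \<open>M\<close>.\<close>
  then obtain s where s: "s \<in> S" "\<And>x. x \<in> conj_by G y0 ` R \<Longrightarrow> conj_by G s x \<in> R"
    using prime_power_subgroup_le_conj[OF Ssub finS R(1,2) subgroup_conj_by[OF R(1) y0(1)] _ r(1) cR R(4)]
    by blast
  have sG: "s \<in> carrier G" using s SG by blast
  define y where "y = s \<otimes> y0"
  have yG: "y \<in> carrier G" using sG y0 by (simp add: y_def)
  have yM: "y \<notin> M"
  proof
    assume "y \<in> M"
    moreover have "inv s \<in> M" using s S(2) subgroup.m_inv_closed[OF subgroup_M] by blast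
    ultimately have "inv s \<otimes> y \<in> M" using subgroup.m_closed[OF subgroup_M] by blast
    then show False using y0 sG by (simp add: y_def inv_mult_cancel_left)
  qed
  have yR: "y \<in> set_normalizer R"
  proof (rule mem_set_normalizerI[OF finite_subset[OF R(2) finS] RG yG], clarify)
    fix x assume x: "x \<in> R"
    then have "conj_by G s (conj_by G y0 x) \<in> R" using s(2) by blast
    then show "conj_by G y x \<in> R"
      using conj_by_conj_by[OF sG y0(1), of x] x RG by (auto simp: y_def)
  qed
  obtain a where a: "a \<in> R" "R = generate G {a}"
    using invariant_prime_power_subgroup_cyclic[OF R(1) RM r(1) R(3) yG yM yR] by blast
  have aG: "a \<in> carrier G" using a(1) RG by blast
  have "r dvd card R"
  proof -
    have "card ((\<lambda>s. R #> s) ` S) * card R = card S" using card_subgroup_factor[OF R(1) Ssub R(2)] .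
    then have "r dvd card ((\<lambda>s. R #> s) ` S) * card R" using r(2) by simp
    then show ?thesis using prime_dvd_mult_iff[OF r(1)] R(4) by blast
  qed
  then have ra: "r dvd ord a" using generate_pow_card[OF aG] a(2) by simp
  define x where "x = a [^] (ord a div r)"
  have ordx: "ord x = r" unfolding x_def using ord_pow_div[OF finite_carrier aG r(1) ra] .
  have xR: "x \<in> R" unfolding x_def using subgroup_pow_closed[OF R(1) a(1)] .
  have xG: "x \<in> carrier G" and xM: "x \<in> M" using xR RG RM by blast+
  have commR: "u \<otimes> v = v \<otimes> u" if "u \<in> R" "v \<in> R" for u v
  proof -
    obtain i where i: "u = a [^] (i::nat)"
      using \<open>u \<in> R\<close> a(2) mem_generate_singleton_iff[OF finite_carrier aG] by blast
    obtain j where j: "v = a [^] (j::nat)"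
      using \<open>v \<in> R\<close> a(2) mem_generate_singleton_iff[OF finite_carrier aG] by blast
    show ?thesis using i j aG by (simp add: nat_pow_mult add.commute)
  qed
  \<comment> \<open>As \<open>R\<close> is abelian, a conjugate of \<open>x\<close> in
    \<open>R\<close> commutes with \<open>x\<close>, and rank one makes it a power of
    \<open>x\<close>.\<close>
  have conj_x: "g \<in> set_normalizer (generate G {x})" if g: "g \<in> carrier G" "conj_by G g x \<in> R" for g
  proof -
    have "conj_by G g x \<in> generate G {x}"
      using rank_one[OF xM, of "conj_by G g x"] g RM ordx r(1) ord_conj_by[OF g(1) xG] commR[OF xR g(2)] by auto
    then show ?thesis using mem_set_normalizer_generate_iff[OF finite_carrier xG g(1)] by blast
  qed
  let ?N = "set_normalizer (generate G {x})"
  have gxG: "generate G {x} \<subseteq> carrier G" using xG by (intro generate_incl) simp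
  have Nsub: "subgroup ?N G" using subgroup_set_normalizer[OF gxG] .
  have yN: "y \<in> ?N" using conj_x[OF yG] yR xR by (auto simp: set_normalizer_def)
  \<comment> \<open>The elements of \<open>S\<close> normalising the group generated by
    \<open>x\<close> form a subgroup invariant under \<open>y\<close>, and such a subgroup
    centralises \<open>x\<close>.\<close>
  have fusion: "conj_by G g x = x" if g: "g \<in> S" "conj_by G g x \<in> R" for g
  proof -
    have gG: "g \<in> carrier G" using g SG by blast
    have "g \<otimes> x = x \<otimes> g"
    proof (rule normalizing_imp_centralizing[OF xG _ _ _ yG yM yN])
      show "subgroup (S \<inter> ?N) G" using Ssub Nsub by (rule subgroups_Inter_pair)
      show "S \<inter> ?N \<subseteq> M" using S(2) by blast
      show "conj_by G y ` (S \<inter> ?N) \<subseteq> S \<inter> ?N"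
        using conj_by_in_normal[OF S(1) yG] yN subgroupE(3,4)[OF Nsub] by (auto simp: conj_by_def)
      show "g \<in> S \<inter> ?N" using g(1) conj_x[OF gG g(2)] by blast
    qed simp
    then show ?thesis using conj_by_eq_self_iff[OF gG xG] by blast
  qed
  interpret S: group "G\<lparr>carrier := S\<rparr>" using Ssub by (rule subgroup_imp_group)
  have "x \<notin> derived (G\<lparr>carrier := S\<rparr>) (carrier (G\<lparr>carrier := S\<rparr>))"
  proof (rule S.transfer_not_in_derived)
    show "finite (carrier (G\<lparr>carrier := S\<rparr>))" using finS by simp
    show "subgroup R (G\<lparr>carrier := S\<rparr>)" using R(1,2) Ssub by (simp add: subgroup_incl)
    show "u \<otimes>\<^bsub>G\<lparr>carrier := S\<rparr>\<^esub> v = v \<otimes>\<^bsub>G\<lparr>carrier := S\<rparr>\<^esub> u" if "u \<in> R" "v \<in> R" for u v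
      using commR that by simp
    show "x \<in> R" by (rule xR)
    show "prime (group.ord (G\<lparr>carrier := S\<rparr>) x)" using r(1) ordx ord_restrict[OF Ssub] by simp
    show "\<not> group.ord (G\<lparr>carrier := S\<rparr>) x dvd card (rcosets\<^bsub>G\<lparr>carrier := S\<rparr>\<^esub> R)"
      using R(4) ordx ord_restrict[OF Ssub] by (simp add: rcosets_restrict)
    show "conj_by (G\<lparr>carrier := S\<rparr>) g x = x"
      if "g \<in> carrier (G\<lparr>carrier := S\<rparr>)" "conj_by (G\<lparr>carrier := S\<rparr>) g x \<in> R" for g
      using that fusion conj_by_restrict[OF Ssub] by simp
  qed
  then have "x \<notin> derived G S" using derived_consistent[OF subset_refl Ssub] by simp
  then show ?thesis using xR R(2) by blast
qed

text \<open>Descending along derived subgroups reaches an abelian normal subgroup, whose elements of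
  prime order \<open>r\<close> form a single cyclic group.\<close>

lemma exists_normal_prime_cyclic:
  assumes "S \<lhd> G" "S \<subseteq> M" "S \<noteq> {\<one>}"
  shows "\<exists>x\<in>S. prime (ord x) \<and> set_normalizer (generate G {x}) = carrier G"
  using assms
proof (induction "card S" arbitrary: S rule: less_induct)
  case less
  have Ssub: "subgroup S G" using less.prems(1) by (rule normal_imp_subgroup)
  have SG: "S \<subseteq> carrier G" using Ssub by (rule subgroup.subset)
  have finS: "finite S" using SG finite_carrier by (rule finite_subset)
  show ?case
  proof (cases "\<forall>u\<in>S. \<forall>v\<in>S. u \<otimes> v = v \<otimes> u")
    case True
    have "card S \<noteq> 1" using less.prems(3) subgroup.one_closed[OF Ssub] by (metis card_1_singletonE singletonD)
    then obtain r where r: "prime r" "r dvd card S" using prime_factor_nat by blast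
    then obtain x where x: "x \<in> S" "ord x = r" using cauchy[OF finite_carrier Ssub] by blast
    have xG: "x \<in> carrier G" using x SG by blast
    have "g \<in> set_normalizer (generate G {x})" if g: "g \<in> carrier G" for g
    proof -
      have "conj_by G g x \<in> S" using conj_by_in_normal[OF less.prems(1) g x(1)] .
      then have "conj_by G g x \<in> generate G {x}"
        using rank_one[of x "conj_by G g x"] x less.prems(2) r(1) ord_conj_by[OF g xG] True by auto
      then show ?thesis using mem_set_normalizer_generate_iff[OF finite_carrier xG g] by blast
    qed
    then have "set_normalizer (generate G {x}) = carrier G" by (auto simp: set_normalizer_def)
    then show ?thesis using x r(1) by blast
  next
    case False
    then obtain u v where uv: "u \<in> S" "v \<in> S" "u \<otimes> v \<noteq> v \<otimes> u" by blast
    have uvG: "u \<in> carrier G" "v \<in> carrier G" using uv SG by blast+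
    have "derived G S \<subset> S"
      using derived_incl[OF subset_refl Ssub] derived_normal_subgroup_proper[OF less.prems] by blast
    moreover have "derived G S \<noteq> {\<one>}"
    proof
      assume "derived G S = {\<one>}"
      moreover have "u \<otimes> v \<otimes> inv u \<otimes> inv v \<in> derived G S"
        unfolding derived_def using uv(1,2) by (intro generate.incl) blast
      ultimately have "u \<otimes> v \<otimes> inv u \<otimes> inv v \<otimes> v \<otimes> u = v \<otimes> u" using uvG by simp
      then show False using uv(3) uvG by (simp add: group_word)
    qed
    ultimately show ?thesis
      using less.hyps[of "derived G S"] derived_is_normal[OF less.prems(1)] less.prems(2)
        psubset_card_mono[OF finS] by blast
  qed
qed

end

text \<open>\<open>G\<close> acts on a normal subgroup of prime order through an abelian group, and \<open>M\<close> is the kernel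
  of this action.\<close>

lemma (in fpf_kernel) central_element_and_abelian_quotient:
  assumes "M \<noteq> {\<one>}"
  obtains x where "x \<in> M" "prime (ord x)" "\<And>m. m \<in> M \<Longrightarrow> m \<otimes> x = x \<otimes> m"
    "\<And>g h. g \<in> carrier G \<Longrightarrow> h \<in> carrier G \<Longrightarrow> g \<otimes> h \<otimes> inv g \<otimes> inv h \<in> M"
proof -
  obtain x where x: "x \<in> M" "prime (ord x)" and norm: "set_normalizer (generate G {x}) = carrier G"
    using exists_normal_prime_cyclic[OF normal_kernel subset_refl assms] by blast
  have xG: "x \<in> carrier G" using x M_carrier by blast
  obtain y where y: "y \<in> carrier G" "y \<notin> M" using proper M_carrier by blast
  have "m \<otimes> x = x \<otimes> m" if "m \<in> M" for m
    using normalizing_imp_centralizing[OF xG subgroup_M subset_refl _ y _ _ that]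
      conj_by_in_normal[OF normal_kernel y(1)] norm M_carrier y(1) by blast
  moreover have "g \<otimes> h \<otimes> inv g \<otimes> inv h \<in> M" if gh: "g \<in> carrier G" "h \<in> carrier G" for g h
  proof (rule ccontr)
    assume nM: "g \<otimes> h \<otimes> inv g \<otimes> inv h \<notin> M"
    have power: "\<exists>k::nat. conj_by G g x = x [^] k" if "g \<in> carrier G" for g
      using mem_set_normalizer_generate_iff[OF finite_carrier xG that]
        mem_generate_singleton_iff[OF finite_carrier xG] norm that by blast
    obtain i j :: nat where ij: "conj_by G g x = x [^] i" "conj_by G h x = x [^] j"
      using power gh by metis
    have eq: "conj_by G (g \<otimes> h) x = conj_by G (h \<otimes> g) x"
      using ij gh xG by (simp add: conj_by_pow nat_pow_pow mult.commute flip: conj_by_conj_by)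
    have "conj_by G (inv (h \<otimes> g)) x \<in> generate G {x}"
      using mem_set_normalizer_generate_iff[OF finite_carrier xG, of "inv (h \<otimes> g)"] norm gh by simp
    then obtain k :: nat where k: "conj_by G (inv (h \<otimes> g)) x = x [^] k"
      using mem_generate_singleton_iff[OF finite_carrier xG] by blast
    have "conj_by G (g \<otimes> h \<otimes> inv g \<otimes> inv h) x = conj_by G (g \<otimes> h) (conj_by G (inv (h \<otimes> g)) x)"
      using gh xG by (simp add: conj_by_conj_by group_word)
    also have "\<dots> = conj_by G (g \<otimes> h) x [^] k" using k gh xG by (simp add: conj_by_pow)
    also have "\<dots> = conj_by G (h \<otimes> g) x [^] k" using eq by simp
    also have "\<dots> = conj_by G (h \<otimes> g) (x [^] k)" using gh xG by (simp add: conj_by_pow)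
    also have "\<dots> = x" unfolding k[symmetric] using gh xG by (intro conj_by_cancel) simp_all
    finally have "(g \<otimes> h \<otimes> inv g \<otimes> inv h) \<otimes> x = x \<otimes> (g \<otimes> h \<otimes> inv g \<otimes> inv h)"
      using conj_by_eq_self_iff[of "g \<otimes> h \<otimes> inv g \<otimes> inv h" x] gh xG by simp
    then have "x = \<one>" using free[OF _ nM x(1)] gh by simp
    then show False using x(2) by simp
  qed
  ultimately show thesis using that x by blast
qed

section \<open>Prime order elements of cyclic groups and commuting products\<close>

context group
begin

lemma mem_generate_pow_coprime:
  assumes x: "x \<in> carrier G" and "coprime k (ord x)"
  shows "x \<in> generate G {x [^] (k::nat)}"
proof -
  obtain q :: nat where q: "(x [^] k) [^] q = x" using assms by (rule pow_coprime_root)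
  have "(x [^] k) [^] q \<in> generate G {x [^] k}"
    using subgroup_pow_closed[OF subgroup_generate_singleton generate_singleton_mem] x by simp
  then show ?thesis unfolding q .
qed

text \<open>A cyclic group has a single subgroup of order \<open>q\<close>, the one generated by
  \<open>e = z^(ord z / q)\<close>: if the \<open>q\<close>-th power of \<open>z^k\<close> is
  trivial, then \<open>ord z / q\<close> divides \<open>k\<close>.\<close>

lemma generate_eq_prime_ord:
  assumes fin: "finite (carrier G)" and z: "z \<in> carrier G" and x: "x \<in> generate G {z}" "prime (ord x)"
    and y: "y \<in> generate G {z}" "ord y = ord x"
  shows "y \<in> generate G {x}"
proof -
  define q where "q = ord x"
  have zc: "generate G {z} \<subseteq> carrier G" using z by (intro generate_incl) simp
  have xG: "x \<in> carrier G" using x zc by blast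
  have q: "prime q" using x by (simp add: q_def)
  have "ord x dvd card (generate G {z})"
    using ord_dvd_card_subgroup[OF subgroup_generate_singleton[OF z] x(1)] .
  then have qz: "q dvd ord z" using generate_pow_card[OF z] by (simp add: q_def)
  define e where "e = z [^] (ord z div q)"
  have e: "e \<in> carrier G" "ord e = q"
    using ord_pow_div[OF fin z q qz] z by (simp_all add: e_def)
  have mem: "w \<in> generate G {e}" if w: "w \<in> generate G {z}" "ord w = q" for w
  proof -
    obtain k :: nat where k: "w = z [^] k" using w mem_generate_singleton_iff[OF fin z] by blast
    have "w [^] q = \<one>" using w zc pow_ord_eq_1[of w] by auto
    then have "z [^] (k * q) = \<one>" using k z by (simp add: nat_pow_pow)
    then have "ord z dvd k * q" using pow_eq_id[OF z] by simp
    moreover have "ord z = ord z div q * q" using qz by simp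
    ultimately have "ord z div q * q dvd k * q" by metis
    then have "ord z div q dvd k" using q by (simp add: prime_gt_0_nat)
    then obtain l where "k = (ord z div q) * l" by blast
    then have "w = e [^] l" using k z by (simp add: e_def nat_pow_pow)
    then show ?thesis using mem_generate_singleton_iff[OF fin e(1)] by blast
  qed
  have "generate G {x} \<subseteq> generate G {e}"
    using generate_singleton_subset[OF subgroup_generate_singleton[OF e(1)] mem[OF x(1) q_def[symmetric]]] .
  moreover have "card (generate G {x}) = card (generate G {e})"
    using generate_pow_card[OF xG] generate_pow_card[OF e(1)] e(2) by (simp add: q_def)
  moreover have "finite (generate G {e})"
    using finite_subset[OF generate_incl fin, of "{e}"] e(1) by simp
  ultimately have "generate G {x} = generate G {e}" by (intro card_subset_eq) auto
  then show ?thesis using mem y by (simp add: q_def)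
qed

text \<open>Raising \<open>x y\<close> to the power \<open>ord y\<close> removes \<open>y\<close>
  and leaves a power of \<open>x\<close> that still generates \<open>x\<close>.\<close>

lemma commute_mem_generate_mult:
  assumes x: "x \<in> carrier G" "y \<in> carrier G" "x \<otimes> y = y \<otimes> x" and cop: "coprime (ord x) (ord y)"
  shows "x \<in> generate G {x \<otimes> y}"
proof -
  have "(x \<otimes> y) [^] ord y = x [^] ord y"
    using pow_mult_distrib[OF x(3,1,2)] x by simp
  moreover have "(x \<otimes> y) [^] ord y \<in> generate G {x \<otimes> y}"
    using subgroup_pow_closed[OF subgroup_generate_singleton generate_singleton_mem] x by simp
  ultimately have "generate G {x [^] ord y} \<subseteq> generate G {x \<otimes> y}"
    using generate_singleton_subset[OF subgroup_generate_singleton] x by simp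
  moreover have "x \<in> generate G {x [^] ord y}"
    using mem_generate_pow_coprime[OF x(1)] cop by (simp add: coprime_commute)
  ultimately show ?thesis by blast
qed

end

section \<open>Components of the cyclic graph\<close>

context group
begin

text \<open>This is the usable form of adjacency: both ends of an edge are powers of one
  element.\<close>

lemma cyclic_subgroup_generated_pairE:
  assumes "x \<in> carrier G" "y \<in> carrier G" "cyclic_group (subgroup_generated G {x, y})"
  obtains z where "z \<in> carrier G" "x \<in> generate G {z}" "y \<in> generate G {z}"
proof -
  let ?H = "subgroup_generated G {x, y}"
  obtain z where z: "z \<in> carrier ?H" "carrier ?H = range (\<lambda>n::int. z [^]\<^bsub>?H\<^esub> n)"
    using group.cyclic_group[OF group_subgroup_generated] assms(3) by blast
  have zG: "z \<in> carrier G" using z(1) carrier_subgroup_generated_subset by blast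
  have "carrier ?H = generate G {z}"
    unfolding z(2) generate_pow[OF zG] int_pow_subgroup_generated[OF z(1)] by auto
  moreover have "{x, y} \<subseteq> carrier ?H"
    using subgroup_generated_subset_carrier_subset[of "{x, y}"] assms by simp
  ultimately show thesis using that[OF zG] by blast
qed

lemma cyclic_subgroup_generated_pairI:
  assumes "z \<in> carrier G" "y \<in> generate G {z}"
  shows "cyclic_group (subgroup_generated G {z, y})"
proof -
  have y: "y \<in> carrier G" using assms generate_incl[of "{z}"] by auto
  have "generate G {z, y} = generate G {z}"
  proof
    show "generate G {z, y} \<subseteq> generate G {z}"
      using assms generate_singleton_mem by (intro generate_subgroup_incl subgroup_generate_singleton) auto
  qed (rule mono_generate, simp)
  then have "subgroup_generated G {z, y} = subgroup_generated G {z}"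
    using assms(1) y by (simp add: subgroup_generated_def)
  then show ?thesis by (simp add: cyclic_group_generated)
qed

lemma cyclic_graph_reachable_power:
  assumes fin: "finite (carrier G)" and z: "z \<in> carrier G" "x \<in> generate G {z}" "x \<noteq> \<one>"
  shows "z \<rightarrow>\<^sup>*\<^bsub>with_proj (cyclic_graph G)\<^esub> x"
proof -
  interpret D: graph "with_proj (cyclic_graph G)" using fin by (rule graph_cyclic_graph)
  have x: "x \<in> carrier G" using z generate_incl[of "{z}"] by auto
  have z1: "z \<noteq> \<one>" using z by (auto simp: generate_one)
  show ?thesis
  proof (cases "x = z")
    case True
    have "x \<in> verts (with_proj (cyclic_graph G))" using x z by (simp add: cyclic_graph_def)
    then show ?thesis unfolding True by (rule D.reachable_refl)
  next
    case False
    then show ?thesis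
      using x z z1 cyclic_subgroup_generated_pairI[OF z(1,2)]
      by (intro D.reachable_adjI) (simp add: cyclic_graph_def)
  qed
qed

text \<open>Components are determined by elements of prime order, as every vertex is joined to a
  power of prime order.\<close>

lemma card_cyclic_graph_components:
  fixes f :: "'a \<Rightarrow> 'c"
  assumes fin: "finite (carrier G)"
    and comm: "\<And>x y. \<lbrakk>x \<in> carrier G; y \<in> carrier G; prime (ord x); prime (ord y); ord x \<noteq> ord y;
      x \<otimes> y = y \<otimes> x\<rbrakk> \<Longrightarrow> f x = f y"
    and gen: "\<And>x y. \<lbrakk>x \<in> carrier G; prime (ord x); y \<in> generate G {x}; ord y = ord x\<rbrakk> \<Longrightarrow> f x = f y"
    and reach: "\<And>x y. \<lbrakk>x \<in> carrier G; y \<in> carrier G; prime (ord x); prime (ord y); f x = f y\<rbrakk> \<Longrightarrow>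
      x \<rightarrow>\<^sup>*\<^bsub>with_proj (cyclic_graph G)\<^esub> y"
  shows "card (connected_components (with_proj (cyclic_graph G))) = card (f ` {x \<in> carrier G. prime (ord x)})"
proof -
  let ?D = "with_proj (cyclic_graph G)"
  interpret D: graph ?D using fin by (rule graph_cyclic_graph)
  let ?U = "{x \<in> carrier G. prime (ord x)}"
  have UV: "?U \<subseteq> verts ?D" by (auto simp: cyclic_graph_def)
  have f_gen: "f x = f y"
    if z: "z \<in> carrier G" and x: "x \<in> generate G {z}" "prime (ord x)" and y: "y \<in> generate G {z}" "prime (ord y)"
    for x y z
  proof -
    have xy: "x \<in> carrier G" "y \<in> carrier G" using x(1) y(1) z generate_incl[of "{z}"] by auto
    show ?thesis
    proof (cases "ord x = ord y")
      case True
      then have "y \<in> generate G {x}" using generate_eq_prime_ord[OF fin z x y(1)] by simp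
      then show ?thesis using gen[OF xy(1) x(2)] True by simp
    next
      case False
      obtain i :: nat where i: "x = z [^] i" using x(1) mem_generate_singleton_iff[OF fin z] by blast
      obtain j :: nat where j: "y = z [^] j" using y(1) mem_generate_singleton_iff[OF fin z] by blast
      have "x \<otimes> y = y \<otimes> x" using i j z by (simp add: nat_pow_mult add.commute)
      then show ?thesis using comm[OF xy x(2) y(2) False] by simp
    qed
  qed
  \<comment> \<open>Both ends of an edge lie in one cyclic group, where \<open>f\<close> is constant
    on elements of prime order. The induction carries an arbitrary prime order power of the current
    vertex, since the vertex itself need not have prime order.\<close>
  have f_reach: "f x = f y" if "u \<rightarrow>\<^sup>*\<^bsub>?D\<^esub> v"
    "x \<in> generate G {u}" "prime (ord x)" "y \<in> generate G {v}" "prime (ord y)" for u v x y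
    using that
  proof (induction arbitrary: x rule: D.converse_reachable_induct)
    case base
    have "v \<in> carrier G" using base.hyps by (simp add: cyclic_graph_def)
    then show ?case using f_gen base.prems by blast
  next
    case (step u w)
    have uw: "u \<in> carrier G" "w \<in> carrier G" "cyclic_group (subgroup_generated G {u, w})" "w \<noteq> \<one>"
      using step.hyps(1) by (auto simp: cyclic_graph_def)
    obtain z where z: "z \<in> carrier G" "u \<in> generate G {z}" "w \<in> generate G {z}"
      using cyclic_subgroup_generated_pairE[OF uw(1-3)] by blast
    have "ord w \<noteq> 1" using uw ord_eq_1 by blast
    then obtain q where q: "prime q" "q dvd ord w" using prime_factor_nat by blast
    define t where "t = w [^] (ord w div q)"
    have t: "ord t = q" "t \<in> generate G {w}"
      using ord_pow_div[OF fin uw(2) q] mem_generate_singleton_iff[OF fin uw(2)] by (auto simp: t_def)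
    have sub: "generate G {u} \<subseteq> generate G {z}" "generate G {w} \<subseteq> generate G {z}"
      using generate_singleton_subset[OF subgroup_generate_singleton[OF z(1)]] z by blast+
    have "f x = f t" using f_gen[OF z(1), of x t] sub step.prems t q by blast
    also have "f t = f y" using step.IH[of t] t q step.prems by simp
    finally show ?case .
  qed
  have scc: "D.scc_of x = D.scc_of y \<longleftrightarrow> x \<rightarrow>\<^sup>*\<^bsub>?D\<^esub> y" if "x \<in> verts ?D" "y \<in> verts ?D" for x y
  proof
    assume "D.scc_of x = D.scc_of y"
    then have "y \<in> D.scc_of x" using D.in_scc_of_self[OF that(2)] by simp
    then show "x \<rightarrow>\<^sup>*\<^bsub>?D\<^esub> y" by (simp add: D.scc_of_def)
  next
    assume xy: "x \<rightarrow>\<^sup>*\<^bsub>?D\<^esub> y"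
    then have yx: "y \<rightarrow>\<^sup>*\<^bsub>?D\<^esub> x" by (rule D.symmetric_reachable')
    show "D.scc_of x = D.scc_of y"
      using xy yx D.reachable_trans unfolding D.scc_of_def by blast
  qed
  have "card (connected_components ?D) = card D.sccs_verts"
    by (simp add: D.connected_components_eq_sccs D.card_sccs_verts)
  also have "D.sccs_verts = D.scc_of ` verts ?D" by (rule D.sccs_verts_conv_scc_of)
  also have "\<dots> = D.scc_of ` ?U"
  proof (intro equalityI subsetI)
    fix S assume "S \<in> D.scc_of ` verts ?D"
    then obtain z where z: "z \<in> verts ?D" "S = D.scc_of z" by blast
    then have zG: "z \<in> carrier G" "z \<noteq> \<one>" by (auto simp: cyclic_graph_def)
    then have "ord z \<noteq> 1" using ord_eq_1 by blast
    then obtain q where q: "prime q" "q dvd ord z" using prime_factor_nat by blast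
    define t where "t = z [^] (ord z div q)"
    have t: "ord t = q" "t \<in> generate G {z}" "t \<in> carrier G"
      using ord_pow_div[OF fin zG(1) q] mem_generate_singleton_iff[OF fin zG(1)] zG by (auto simp: t_def)
    have "t \<noteq> \<one>" using t q by auto
    then have "z \<rightarrow>\<^sup>*\<^bsub>?D\<^esub> t" using cyclic_graph_reachable_power[OF fin zG(1) t(2)] by blast
    then have "S = D.scc_of t" using scc z t q UV by blast
    then show "S \<in> D.scc_of ` ?U" using t q by blast
  qed (use UV in blast)
  also have "card (D.scc_of ` ?U) = card (f ` ?U)"
  proof (rule card_image_cong_iff)
    fix x y assume xy: "x \<in> ?U" "y \<in> ?U"
    have "D.scc_of x = D.scc_of y \<longleftrightarrow> x \<rightarrow>\<^sup>*\<^bsub>?D\<^esub> y" using scc xy UV by blast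
    also have "\<dots> \<longleftrightarrow> f x = f y"
      using f_reach[of x y x y] generate_singleton_mem reach xy by blast
    finally show "D.scc_of x = D.scc_of y \<longleftrightarrow> f x = f y" .
  qed
  finally show ?thesis .
qed

end

context group
begin

text \<open>A group of type \<open>(r, r)\<close> is the union of \<open>r + 1\<close> subgroups of order \<open>r\<close>, so it cannot act
  fixed-point-freely on an abelian group unless that group has exponent \<open>r\<close>.\<close>

lemma fixed_point_free_rank_one:
  assumes A: "comm_group A" and fin: "finite (carrier G)" and M: "subgroup M G"
    and act: "\<And>d. d \<in> M \<Longrightarrow> act d \<in> hom A A"
      "\<And>v. v \<in> carrier A \<Longrightarrow> act \<one> v = v"
      "\<And>d e v. \<lbrakk>d \<in> M; e \<in> M; v \<in> carrier A\<rbrakk> \<Longrightarrow> act (d \<otimes> e) v = act d (act e v)"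
    and free: "\<And>d v. \<lbrakk>d \<in> M; d \<noteq> \<one>; v \<in> carrier A; act d v = v\<rbrakk> \<Longrightarrow> v = \<one>\<^bsub>A\<^esub>"
    and ab: "a \<in> M" "b \<in> M" "prime (ord a)" "ord b = ord a" "a \<otimes> b = b \<otimes> a"
    and b_notin: "b \<notin> generate G {a}" and v: "v \<in> carrier A"
  shows "v [^]\<^bsub>A\<^esub> ord a = \<one>\<^bsub>A\<^esub>"
proof -
  interpret A: comm_group A by (fact A)
  define r where "r = ord a"
  have r: "prime r" using ab by (simp add: r_def)
  have abG: "a \<in> carrier G" "b \<in> carrier G" using subgroup.mem_carrier[OF M] ab(1,2) by simp_all
  let ?A = "generate G {a}" and ?B = "generate G {b}"
  have sA: "subgroup ?A G" and sB: "subgroup ?B G" using abG subgroup_generate_singleton by blast+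
  have AG: "?A \<subseteq> carrier G" and BG: "?B \<subseteq> carrier G" using sA sB by (simp_all add: subgroup.subset)
  have AM: "?A \<subseteq> M" and BM: "?B \<subseteq> M" using ab generate_singleton_subset[OF M] by blast+
  have comm: "u \<otimes> w = w \<otimes> u" if u: "u \<in> ?A" and w: "w \<in> ?B" for u w
  proof -
    obtain i :: nat where i: "u = a [^] i" using u mem_generate_singleton_iff[OF fin abG(1)] by blast
    obtain j :: nat where j: "w = b [^] j" using w mem_generate_singleton_iff[OF fin abG(2)] by blast
    have "b \<otimes> a [^] i = a [^] i \<otimes> b" using commute_pow_right[OF abG(2,1) ab(5)[symmetric]] .
    then show ?thesis using commute_pow_right[of "a [^] i" b j] i j abG by simp
  qed
  have pow_r: "u [^] r = \<one>" if "u \<in> ?A \<or> u \<in> ?B" for u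
  proof -
    have "u \<in> carrier G" using that AG BG by blast
    moreover have "ord u dvd r"
      using that ord_dvd_card_subgroup[OF sA, of u] ord_dvd_card_subgroup[OF sB, of u]
        generate_pow_card[OF abG(1)] generate_pow_card[OF abG(2)] ab(4) by (auto simp: r_def)
    ultimately show ?thesis using pow_eq_id by blast
  qed
  have ord_r: "ord x = r" if "x \<in> carrier G" "x \<noteq> \<one>" "x [^] r = \<one>" for x
    using ord_prime_eqI[OF that(1) r that(2,3)] .
  have AB: "?A \<inter> ?B = {\<one>}"
  proof -
    have False if x: "x \<in> ?A" "x \<in> ?B" "x \<noteq> \<one>" for x
    proof -
      have xG: "x \<in> carrier G" using x AG by blast
      have ox: "ord x = r" using ord_r[OF xG x(3)] pow_r x(1) by blast
      have "b \<in> generate G {x}"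
        using generate_eq_prime_ord[OF fin abG(2) x(2) _ generate_singleton_mem] ox r ab(4)
        by (simp add: r_def)
      then show False using b_notin generate_singleton_subset[OF sA x(1)] by blast
    qed
    then show ?thesis using subgroup.one_closed[OF sA] subgroup.one_closed[OF sB] by blast
  qed
  \<comment> \<open>The group of type \<open>(r, r)\<close> spanned by \<open>a\<close> and
    \<open>b\<close>, as the product of two commuting cyclic groups that meet trivially.\<close>
  define D where "D = (\<lambda>(u, w). u \<otimes> w) ` (?A \<times> ?B)"
  have DM: "D \<subseteq> M" using AM BM subgroup.m_closed[OF M] by (auto simp: D_def)
  have DG: "D \<subseteq> carrier G" using DM subgroup.subset[OF M] by blast
  have D_memI: "u \<otimes> w \<in> D" if "u \<in> ?A" "w \<in> ?B" for u w using that by (auto simp: D_def)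
  have D_memE: "\<exists>u\<in>?A. \<exists>w\<in>?B. x = u \<otimes> w" if "x \<in> D" for x using that by (auto simp: D_def)
  have sD: "subgroup D G"
  proof (rule subgroupI)
    show "D \<subseteq> carrier G" by (rule DG)
    show "D \<noteq> {}" using subgroup.one_closed[OF sA] subgroup.one_closed[OF sB] by (auto simp: D_def)
    fix x assume "x \<in> D"
    then obtain u w where x: "u \<in> ?A" "w \<in> ?B" "x = u \<otimes> w" using D_memE by blast
    have uw: "u \<in> carrier G" "w \<in> carrier G" using x AG BG by blast+
    have "inv x = inv u \<otimes> inv w" using x(3) comm[OF x(1,2)] uw by (simp add: inv_mult_group)
    then show "inv x \<in> D" using D_memI x subgroup.m_inv_closed[OF sA] subgroup.m_inv_closed[OF sB] by simp
    fix y assume "y \<in> D"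
    then obtain u' w' where y: "u' \<in> ?A" "w' \<in> ?B" "y = u' \<otimes> w'" using D_memE by blast
    have uw': "u' \<in> carrier G" "w' \<in> carrier G" using y AG BG by blast+
    have "x \<otimes> y = u \<otimes> (w \<otimes> u') \<otimes> w'" using x y uw uw' by (simp add: m_assoc)
    also have "\<dots> = (u \<otimes> u') \<otimes> (w \<otimes> w')"
      unfolding comm[OF y(1) x(2), symmetric] using uw uw' by (simp add: m_assoc)
    finally show "x \<otimes> y \<in> D"
      using D_memI subgroup.m_closed[OF sA x(1) y(1)] subgroup.m_closed[OF sB x(2) y(2)] by simp
  qed
  have D_pow: "x [^] r = \<one>" if x: "x \<in> D" for x
  proof -
    obtain u w where uw: "u \<in> ?A" "w \<in> ?B" "x = u \<otimes> w" using D_memE[OF x] by blast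
    have c: "u \<in> carrier G" "w \<in> carrier G" using uw AG BG by blast+
    show ?thesis using pow_mult_distrib[OF comm[OF uw(1,2)] c, of r] pow_r uw by simp
  qed
  have "inj_on (\<lambda>(u, w). u \<otimes> w) (?A \<times> ?B)"
  proof (rule inj_onI, clarify)
    fix u w u' w' assume m: "u \<in> ?A" "w \<in> ?B" "u' \<in> ?A" "w' \<in> ?B" and eq: "u \<otimes> w = u' \<otimes> w'"
    have c: "u \<in> carrier G" "w \<in> carrier G" "u' \<in> carrier G" "w' \<in> carrier G" using m AG BG by blast+
    have "inv u' \<otimes> (u \<otimes> w) \<otimes> inv w = inv u' \<otimes> (u' \<otimes> w') \<otimes> inv w" using eq by simp
    then have e: "inv u' \<otimes> u = w' \<otimes> inv w" using c by (simp add: group_word)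
    have "inv u' \<otimes> u \<in> ?A" using m subgroup.m_closed[OF sA] subgroup.m_inv_closed[OF sA] by blast
    moreover have "w' \<otimes> inv w \<in> ?B" using m subgroup.m_closed[OF sB] subgroup.m_inv_closed[OF sB] by blast
    ultimately have "inv u' \<otimes> u = \<one>" "w' \<otimes> inv w = \<one>" using AB e by auto
    then show "u = u' \<and> w = w'" using c by (metis inv_equality inv_inv inv_closed)
  qed
  then have "card D = card ?A * card ?B"
    unfolding D_def by (simp add: card_image card_cartesian_product)
  then have cD: "card D = r * r"
    using generate_pow_card[OF abG(1)] generate_pow_card[OF abG(2)] ab(4) by (simp add: r_def)
  have finD: "finite D" using DG fin by (rule finite_subset)
  define \<Q> where "\<Q> = (\<lambda>d. generate G {d}) ` (D - {\<one>})"
  have \<Q>D: "S \<subseteq> D" and \<Q>s: "subgroup S G" and \<Q>c: "card S = r" if "S \<in> \<Q>" for S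
  proof -
    obtain d where d: "d \<in> D" "d \<noteq> \<one>" "S = generate G {d}"
      using \<open>S \<in> \<Q>\<close> unfolding \<Q>_def by blast
    have dG: "d \<in> carrier G" using d DG by blast
    show "S \<subseteq> D" using d generate_singleton_subset[OF sD] by blast
    show "subgroup S G" using d dG subgroup_generate_singleton by blast
    show "card S = r" using d dG generate_pow_card ord_r D_pow by simp
  qed
  have \<Q>_meet: "S = T" if S: "S \<in> \<Q>" "T \<in> \<Q>" "x \<in> S" "x \<in> T" "x \<noteq> \<one>" for S T x
  proof -
    have xD: "x \<in> D" using S \<Q>D by blast
    then have xG: "x \<in> carrier G" using DG by blast
    have cx: "card (generate G {x}) = r" using generate_pow_card[OF xG] ord_r[OF xG S(5)] D_pow[OF xD] by simp
    have "generate G {x} = W" if "W \<in> \<Q>" "x \<in> W" for W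
      using generate_singleton_subset[OF \<Q>s[OF that(1)] that(2)] cx \<Q>c[OF that(1)]
        finite_subset[OF \<Q>D[OF that(1)] finD] by (intro card_subset_eq) auto
    then show ?thesis using S by blast
  qed
  have \<Q>_un: "(\<Union>S\<in>\<Q>. S - {\<one>}) = D - {\<one>}"
    using \<Q>D generate_singleton_mem by (auto simp: \<Q>_def)
  have fin\<Q>: "finite \<Q>" unfolding \<Q>_def using finD by simp
  \<comment> \<open>The \<open>r^2 - 1\<close> nonidentity elements fall into blocks of
    \<open>r - 1\<close>, one for each subgroup of order \<open>r\<close>.\<close>
  have "card (D - {\<one>}) = (\<Sum>S\<in>\<Q>. card (S - {\<one>}))"
    unfolding \<Q>_un[symmetric]
  proof (rule card_UN_disjoint[OF fin\<Q>])
    show "\<forall>S\<in>\<Q>. finite (S - {\<one>})" using \<Q>D finD finite_subset by blast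
    show "\<forall>S\<in>\<Q>. \<forall>T\<in>\<Q>. S \<noteq> T \<longrightarrow> (S - {\<one>}) \<inter> (T - {\<one>}) = {}" using \<Q>_meet by blast
  qed
  also have "\<dots> = (\<Sum>S\<in>\<Q>. r - 1)"
    using \<Q>c subgroup.one_closed[OF \<Q>s] by (intro sum.cong) (simp_all add: card_Diff_singleton)
  also have "card (D - {\<one>}) = r * r - 1"
    using cD subgroup.one_closed[OF sD] by (simp add: card_Diff_singleton)
  finally have "r * r - 1 = card \<Q> * (r - 1)" by simp
  moreover have "r * r - 1 = (r + 1) * (r - 1)" by (cases r) (auto simp: algebra_simps)
  ultimately have "card \<Q> * (r - 1) = (r + 1) * (r - 1)" by simp
  then have c\<Q>: "card \<Q> = r + 1"
    by (rule mult_right_cancel[THEN iffD1, rotated]) (use prime_gt_1_nat[OF r] in simp)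
  have D_nontriv: "\<exists>d\<in>D. d \<noteq> \<one>"
  proof -
    have "a \<otimes> \<one> \<in> D" using D_memI[OF generate_singleton_mem subgroup.one_closed[OF sB]] .
    moreover have "a \<noteq> \<one>" using ab(3) by auto
    ultimately show ?thesis using abG by auto
  qed
  let ?D = "G\<lparr>carrier := D\<rparr>"
  have "v [^]\<^bsub>A\<^esub> card \<Q> = v"
  proof (rule A.fixed_point_free_partition[where D = ?D and act = act])
    show "group ?D" using sD by (rule subgroup_imp_group)
    show "finite (carrier ?D)" using finD by simp
    show "\<Union>\<Q> = carrier ?D"
    proof (intro equalityI subsetI)
      fix x assume "x \<in> \<Union>\<Q>"
      then show "x \<in> carrier ?D" using \<Q>D by auto
    next
      fix x assume "x \<in> carrier ?D"
      then have x: "x \<in> D" by simp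
      \<comment> \<open>For \<open>x = \<one>\<close>, which every part contains, any nonidentity
        \<open>d\<close> names a part.\<close>
      obtain d where d: "d \<in> D - {\<one>}" "x \<noteq> \<one> \<Longrightarrow> x = d" using D_nontriv x by blast
      have S: "generate G {d} \<in> \<Q>" unfolding \<Q>_def using d(1) by (rule imageI)
      have "x \<in> generate G {d}"
        using d(2) generate_singleton_mem subgroup.one_closed[OF \<Q>s[OF S]] by (cases "x = \<one>") auto
      then show "x \<in> \<Union>\<Q>" using S by blast
    qed
    show "subgroup S ?D" if "S \<in> \<Q>" for S using subgroup_incl[OF \<Q>s[OF that] sD \<Q>D[OF that]] .
    show "u = \<one>\<^bsub>A\<^esub>" if S: "S = carrier ?D \<or> S \<in> \<Q>" and u: "u \<in> carrier A" "\<And>d. d \<in> S \<Longrightarrow> act d u = u" for S u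
    proof -
      have "\<exists>d\<in>S. d \<noteq> \<one>"
      proof (cases "S \<in> \<Q>")
        case True
        then show ?thesis using generate_singleton_mem by (auto simp: \<Q>_def)
      qed (use S D_nontriv in simp)
      then obtain d where d: "d \<in> S" "d \<noteq> \<one>" by blast
      have "d \<in> M" using S d \<Q>D DM by auto
      then show ?thesis using free d u by blast
    qed
    show "finite \<Q>" "v \<in> carrier A" by (fact fin\<Q> v)+
    show "S = T" if "S \<in> \<Q>" "T \<in> \<Q>" "x \<in> S" "x \<in> T" "x \<noteq> \<one>\<^bsub>?D\<^esub>" for S T x
      using \<Q>_meet that by simp
    show "act d \<in> hom A A" if "d \<in> carrier ?D" for d using act(1) DM that by auto
    show "act \<one>\<^bsub>?D\<^esub> u = u" if "u \<in> carrier A" for u using act(2) that by simp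
    show "act (d \<otimes>\<^bsub>?D\<^esub> e) u = act d (act e u)"
      if "d \<in> carrier ?D" "e \<in> carrier ?D" "u \<in> carrier A" for d e u
    proof -
      have "d \<in> M" "e \<in> M" using that DM by auto
      then show ?thesis using act(3)[OF _ _ that(3)] by simp
    qed
  qed
  then have "v [^]\<^bsub>A\<^esub> r \<otimes>\<^bsub>A\<^esub> v = \<one>\<^bsub>A\<^esub> \<otimes>\<^bsub>A\<^esub> v" using c\<Q> v by simp
  then show ?thesis using v by (simp add: r_def del: A.l_one)
qed

end

section \<open>2-Frobenius groups\<close>

text \<open>\<open>\<H>\<close> holds the complements of \<open>K\<close> in \<open>L\<close>, which
  are sets of elements of \<open>G\<close>; \<open>\<Q>\<close> holds the complements of the kernel
  of \<open>G / K\<close>, whose elements are cosets of \<open>K\<close>.\<close>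

locale two_frobenius_p = group G for G (structure) +
  fixes K L and p n :: nat and \<H> \<Q>
  assumes finite_carrier: "finite (carrier G)" and K_normal: "K \<lhd> G" and L_normal: "L \<lhd> G"
    and p_prime: "prime p" and card_K: "card K = p ^ n"
    and lower: "frobenius_partition (G\<lparr>carrier := L\<rparr>) K \<H>"
    and upper: "frobenius_partition (G Mod K) ((\<lambda>l. K #> l) ` L) \<Q>"
begin

definition F where "F = G Mod K"
definition M where "M = (\<lambda>l. K #> l) ` L"
abbreviation F_mult (infixl "\<cdot>" 70) where "F_mult \<equiv> monoid.mult F"
abbreviation F_one ("\<one>\<^sub>F") where "F_one \<equiv> monoid.one F"
definition pr where "pr g = K #> g"
text \<open>The centre of \<open>K\<close>: conjugation by \<open>G\<close> on it factors through
  \<open>F\<close>, and the norm computation requires an abelian group.\<close>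

definition Z where "Z = {z \<in> K. \<forall>k\<in>K. z \<otimes> k = k \<otimes> z}"
text \<open>The choice of representative is immaterial because \<open>K\<close> centralises \<open>Z\<close>.\<close>

definition act where "act c v = conj_by G (SOME g. g \<in> c) v"

sublocale K: normal K G by (rule K_normal)
sublocale L: normal L G by (rule L_normal)
sublocale lo: frobenius_partition "G\<lparr>carrier := L\<rparr>" K \<H> by (rule lower)
sublocale up: frobenius_partition F M \<Q> using upper by (simp add: F_def M_def)

lemma K_sub_L: "K \<subseteq> L" using lo.kernel_carrier by simp

section \<open>The quotient map to \<open>F\<close> and centralisers in \<open>G\<close>\<close>

lemma pr_closed [simp]: "g \<in> carrier G \<Longrightarrow> pr g \<in> carrier F"
  by (simp add: F_def pr_def carrier_FactGroup)

lemma pr_surj: "c \<in> carrier F \<Longrightarrow> \<exists>g\<in>carrier G. c = pr g"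
  by (auto simp: F_def pr_def carrier_FactGroup)

lemma pr_mult: "g \<in> carrier G \<Longrightarrow> h \<in> carrier G \<Longrightarrow> pr (g \<otimes> h) = pr g \<cdot> pr h"
  by (simp add: F_def pr_def K.rcos_sum)

lemma one_F: "\<one>\<^sub>F = K" by (simp add: F_def)

lemma pr_eq_iff: "g \<in> carrier G \<Longrightarrow> h \<in> carrier G \<Longrightarrow> pr g = pr h \<longleftrightarrow> g \<otimes> inv h \<in> K"
  unfolding pr_def by (rule r_coset_eq_iff[OF K.subgroup_axioms])

lemma pr_one: "pr \<one> = \<one>\<^sub>F"
  by (simp add: pr_def one_F K.subset)

lemma pr_eq_one_iff: "g \<in> carrier G \<Longrightarrow> pr g = \<one>\<^sub>F \<longleftrightarrow> g \<in> K"
  using pr_eq_iff[of g \<one>] pr_one by simp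

lemma pr_inv: "g \<in> carrier G \<Longrightarrow> pr (inv g) = inv\<^bsub>F\<^esub> pr g"
  using up.inv_equality[of "pr (inv g)" "pr g"] pr_mult[of "inv g" g] pr_one by simp

lemma pr_pow: "g \<in> carrier G \<Longrightarrow> pr (g [^] (k::nat)) = pr g [^]\<^bsub>F\<^esub> k"
  by (induction k) (simp_all add: pr_one pr_mult)

lemma pr_mem_M_iff: "g \<in> carrier G \<Longrightarrow> pr g \<in> M \<longleftrightarrow> g \<in> L"
proof
  assume g: "g \<in> carrier G" and "pr g \<in> M"
  then obtain l where l: "l \<in> L" "pr g = pr l" by (auto simp: M_def pr_def)
  have "g \<otimes> inv l \<in> L" using l pr_eq_iff[OF g, of l] K_sub_L L.mem_carrier by blast
  then have "g \<otimes> inv l \<otimes> l \<in> L" using l by blast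
  then show "g \<in> L" using g l L.mem_carrier by (simp add: m_assoc)
qed (auto simp: M_def pr_def)

lemma card_M: "card M * card K = card L"
  unfolding M_def using card_subgroup_factor[OF K.subgroup_axioms L.subgroup_axioms K_sub_L] .

lemma commute_pr: "\<lbrakk>g \<in> carrier G; h \<in> carrier G; g \<otimes> h = h \<otimes> g\<rbrakk> \<Longrightarrow> pr g \<cdot> pr h = pr h \<cdot> pr g"
  by (simp flip: pr_mult)

lemma subgroup_H: "H \<in> \<H> \<Longrightarrow> subgroup H G"
  using incl_subgroup[OF L.subgroup_axioms lo.subgroup_complement] .

lemma H_sub_L: "H \<in> \<H> \<Longrightarrow> H \<subseteq> L"
  using lo.complement_carrier by simp

lemma H_sub_G: "H \<in> \<H> \<Longrightarrow> H \<subseteq> carrier G"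
  using subgroup_H subgroup.subset by blast

lemma H_Int_K: "H \<in> \<H> \<Longrightarrow> x \<in> H \<Longrightarrow> x \<in> K \<Longrightarrow> x = \<one>"
  using lo.complement_Int_kernel by auto

lemma L_minus_K: "x \<in> L \<Longrightarrow> x \<notin> K \<Longrightarrow> \<exists>H\<in>\<H>. x \<in> H"
  using lo.complement_ex by simp

lemma H_nontrivial_notin_K: "H \<in> \<H> \<Longrightarrow> x \<in> H \<Longrightarrow> x \<noteq> \<one> \<Longrightarrow> x \<in> L - K"
  using H_Int_K H_sub_L by blast

lemma commute_K: "\<lbrakk>k \<in> K; k \<noteq> \<one>; l \<in> L; l \<otimes> k = k \<otimes> l\<rbrakk> \<Longrightarrow> l \<in> K"
  using lo.commute_kernel[of k l] by simp

text \<open>The image of \<open>h\<close> in \<open>F\<close> is a nontrivial element of the kernel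
  \<open>M\<close>, so its centraliser lies in \<open>M\<close>. This forces \<open>g\<close> into
  \<open>L\<close>, where \<open>H\<close> is malnormal.\<close>

lemma commute_H:
  assumes H: "H \<in> \<H>" "h \<in> H" "h \<noteq> \<one>" and g: "g \<in> carrier G" "g \<otimes> h = h \<otimes> g"
  shows "g \<in> H"
proof -
  have h: "h \<in> L" "h \<notin> K" "h \<in> carrier G" using H_nontrivial_notin_K[OF H] L.mem_carrier by auto
  have "pr g \<in> M"
    using up.commute_kernel[of "pr h" "pr g"] pr_mem_M_iff[OF h(3)] pr_eq_one_iff[OF h(3)] h commute_pr[OF g(1) h(3) g(2)] g(1)
    by simp
  then have "g \<in> L" using pr_mem_M_iff g by blast
  then show ?thesis using lo.commute_complement[OF H(1,2), of g] H(3) g by simp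
qed

lemma card_H: "H \<in> \<H> \<Longrightarrow> card H = card M"
proof -
  assume H: "H \<in> \<H>"
  have "card K > 0" using card_K p_prime prime_gt_0_nat by simp
  moreover have "card H * card K = card M * card K" using lo.card_complement[OF H] card_M by simp
  ultimately show ?thesis by simp
qed

lemma ord_dvd_card_K: "k \<in> K \<Longrightarrow> ord k dvd p ^ n"
  using ord_dvd_card_subgroup[OF K.subgroup_axioms, of k] card_K by simp

lemma prime_ord_K:
  assumes "k \<in> K" "prime (ord k)"
  shows "ord k = p"
  using prime_dvd_power[OF assms(2) ord_dvd_card_K[OF assms(1)]] primes_dvd_imp_eq[OF assms(2) p_prime] by simp

lemma coprime_power_K:
  assumes "k \<in> K" "\<not> p dvd m" "k [^] m = \<one>"
  shows "k = \<one>"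
proof -
  have kG: "k \<in> carrier G" using assms(1) by (rule K.mem_carrier)
  have "ord k dvd m" using assms(3) pow_eq_id[OF kG] by simp
  moreover have "coprime (p ^ n) m" using assms(2) p_prime by (simp add: prime_imp_coprime_nat)
  ultimately have "ord k dvd 1"
    using coprime_common_divisor ord_dvd_card_K[OF assms(1)] by blast
  then show ?thesis using ord_eq_1[OF kG] by simp
qed

text \<open>An element of order \<open>p\<close> in a complement \<open>H\<close> would act on the
  nontrivial \<open>p\<close>-group \<open>K\<close> with a nontrivial fixed point, whereas the
  centraliser of such a point in \<open>L\<close> lies in \<open>K\<close>.\<close>

lemma p_not_dvd_card_M: "\<not> p dvd card M"
proof
  assume "p dvd card M"
  obtain H where H: "H \<in> \<H>" using lo.complements_nonempty by blast
  have "p dvd card H" using \<open>p dvd card M\<close> card_H[OF H] by simp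
  then obtain x where x: "x \<in> H" "ord x = p"
    using cauchy[OF finite_carrier subgroup_H[OF H] p_prime] by blast
  have xG: "x \<in> carrier G" and x1: "x \<noteq> \<one>" using x H_sub_G[OF H] p_prime by auto
  let ?X = "generate G {x}"
  have sX: "subgroup ?X G" using subgroup_generate_singleton[OF xG] .
  have XG: "?X \<subseteq> carrier G" using sX by (rule subgroup.subset)
  have finK: "finite K" using K.subset finite_carrier by (rule finite_subset)
  have "[card K = card {k \<in> K. \<forall>g\<in>?X. conj_by G g k = k}] (mod p)"
  proof (rule card_fixed_points_cong[OF sX _ p_prime finK, where n = 1])
    show "card ?X = p ^ 1" using generate_pow_card[OF xG] x by simp
    show "conj_by G g k \<in> K" if "g \<in> ?X" "k \<in> K" for g k
      using conj_by_in_normal[OF K_normal] that XG by blast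
    show "conj_by G \<one> k = k" if "k \<in> K" for k using that K.mem_carrier by simp
    show "conj_by G (g \<otimes> h) k = conj_by G g (conj_by G h k)" if "g \<in> ?X" "h \<in> ?X" "k \<in> K" for g h k
      using conj_by_conj_by[OF subsetD[OF XG that(1)] subsetD[OF XG that(2)] K.mem_carrier[OF that(3)]] by simp
  qed
  moreover have "p dvd card K"
  proof -
    have "n \<noteq> 0"
    proof
      assume "n = 0"
      then have "card K = 1" using card_K by simp
      then obtain k where "K = {k}" by (rule card_1_singletonE)
      then show False using lo.kernel_nontrivial K.one_closed by simp
    qed
    then show ?thesis using card_K by simp
  qed
  ultimately have "p dvd card {k \<in> K. \<forall>g\<in>?X. conj_by G g k = k}" using cong_dvd_iff by blast
  moreover have "\<one> \<in> {k \<in> K. \<forall>g\<in>?X. conj_by G g k = k}" using XG by auto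
  moreover have "\<not> p dvd card {\<one>}" using p_prime by auto
  ultimately have "{k \<in> K. \<forall>g\<in>?X. conj_by G g k = k} \<noteq> {\<one>}" by metis
  then obtain k where k: "k \<in> K" "k \<noteq> \<one>" "\<forall>g\<in>?X. conj_by G g k = k"
    using \<open>\<one> \<in> {k \<in> K. \<forall>g\<in>?X. conj_by G g k = k}\<close> by blast
  have "conj_by G x k = k" using k generate_singleton_mem by blast
  then have "x \<otimes> k = k \<otimes> x" using conj_by_eq_self_iff[OF xG] k K.mem_carrier by blast
  then have "x \<in> K" using commute_K[OF k(1,2)] x H_sub_L[OF H] by blast
  then show False using H_Int_K[OF H] x x1 by blast
qed

section \<open>The centre of \<open>K\<close> as a module for \<open>F\<close>\<close>

lemma Z_sub_K: "Z \<subseteq> K" unfolding Z_def by blast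
lemma Z_I: "\<lbrakk>z \<in> K; \<And>k. k \<in> K \<Longrightarrow> z \<otimes> k = k \<otimes> z\<rbrakk> \<Longrightarrow> z \<in> Z" unfolding Z_def by blast
lemma Z_commute: "\<lbrakk>z \<in> Z; k \<in> K\<rbrakk> \<Longrightarrow> z \<otimes> k = k \<otimes> z" unfolding Z_def by blast
lemma Z_carrier: "Z \<subseteq> carrier G" using Z_sub_K K.subset by blast

lemma subgroup_Z: "subgroup Z G"
proof (rule subgroupI)
  have "\<one> \<in> Z" by (rule Z_I) simp_all
  then show "Z \<noteq> {}" by blast
  fix a assume a: "a \<in> Z"
  then have aG: "a \<in> carrier G" using Z_carrier by blast
  have "inv a \<otimes> k = k \<otimes> inv a" if "k \<in> K" for k
  proof -
    have kG: "k \<in> carrier G" using that by simp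
    have "conj_by G k a = a" using Z_commute[OF a that] conj_by_eq_self_iff[OF kG aG] by simp
    then have "conj_by G k (inv a) = inv a" using conj_by_inv[OF kG aG] by simp
    then show ?thesis using conj_by_eq_self_iff[OF kG] aG by simp
  qed
  then show "inv a \<in> Z" using a Z_sub_K by (intro Z_I K.m_inv_closed) auto
  fix b assume b: "b \<in> Z"
  have "a \<otimes> b \<otimes> k = k \<otimes> (a \<otimes> b)" if "k \<in> K" for k
  proof -
    have c: "k \<in> carrier G" "b \<in> carrier G" using that b Z_carrier by auto
    have "a \<otimes> (b \<otimes> k) = a \<otimes> k \<otimes> b" unfolding Z_commute[OF b that] using c aG by (simp add: m_assoc)
    also have "\<dots> = k \<otimes> a \<otimes> b" unfolding Z_commute[OF a that] by (rule refl)
    finally show ?thesis using c aG by (simp add: m_assoc)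
  qed
  then show "a \<otimes> b \<in> Z" using a b Z_sub_K by (intro Z_I K.m_closed) auto
qed (rule Z_carrier)

lemma conj_by_Z:
  assumes g: "g \<in> carrier G" and v: "v \<in> Z"
  shows "conj_by G g v \<in> Z"
proof -
  have vG: "v \<in> carrier G" using v Z_carrier by blast
  have "conj_by G g v \<otimes> k = k \<otimes> conj_by G g v" if k: "k \<in> K" for k
  proof -
    have kG: "k \<in> carrier G" using k by simp
    define k' where "k' = conj_by G (inv g) k"
    have k': "k' \<in> K" "k = conj_by G g k'" "k' \<in> carrier G"
      using conj_by_in_normal[OF K_normal, of "inv g" k] g k kG by (simp_all add: k'_def)
    have "v \<otimes> k' = k' \<otimes> v" using v k'(1) by (rule Z_commute)
    then show ?thesis unfolding k'(2) using conj_by_mult[OF g vG k'(3)] conj_by_mult[OF g k'(3) vG] by simp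
  qed
  then show ?thesis using conj_by_in_normal[OF K_normal g] v Z_sub_K by (intro Z_I) auto
qed

lemma act_pr:
  assumes g: "g \<in> carrier G" and v: "v \<in> Z"
  shows "act (pr g) v = conj_by G g v"
proof -
  have vG: "v \<in> carrier G" using v Z_carrier by blast
  have "g \<in> pr g" unfolding pr_def using rcos_self[OF g K.subgroup_axioms] .
  then have "(SOME h. h \<in> pr g) \<in> pr g" by (rule someI)
  then obtain k where k: "k \<in> K" "(SOME h. h \<in> pr g) = k \<otimes> g" by (auto simp: pr_def r_coset_def)
  have kG: "k \<in> carrier G" using k by simp
  have "act (pr g) v = conj_by G k (conj_by G g v)"
    unfolding act_def k(2) using conj_by_conj_by[OF kG g vG] by simp
  also have "\<dots> = conj_by G g v"
    using conj_by_eq_self_iff[OF kG, of "conj_by G g v"] Z_commute[OF conj_by_Z[OF g v] k(1)] g vG by simp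
  finally show ?thesis .
qed

abbreviation ZG where "ZG \<equiv> G\<lparr>carrier := Z\<rparr>"

lemma comm_group_Z: "comm_group ZG"
  using subgroup_Z Z_sub_K Z_commute
  by (intro group.group_comm_groupI subgroup_imp_group) auto

lemma act_hom: "c \<in> carrier F \<Longrightarrow> act c \<in> hom ZG ZG"
proof -
  assume "c \<in> carrier F"
  then obtain g where g: "g \<in> carrier G" "c = pr g" using pr_surj by blast
  show ?thesis
  proof (rule homI)
    show "act c v \<in> carrier ZG" if "v \<in> carrier ZG" for v
      using that act_pr[OF g(1)] conj_by_Z[OF g(1)] g(2) by simp
    show "act c (u \<otimes>\<^bsub>ZG\<^esub> v) = act c u \<otimes>\<^bsub>ZG\<^esub> act c v" if "u \<in> carrier ZG" "v \<in> carrier ZG" for u v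
      using that act_pr[OF g(1)] g subgroup.m_closed[OF subgroup_Z] Z_carrier conj_by_mult[OF g(1), of u v] by auto
  qed
qed

lemma act_one: "v \<in> Z \<Longrightarrow> act \<one>\<^sub>F v = v"
  using act_pr[of \<one> v] pr_one Z_carrier by auto

lemma act_mult:
  assumes "c \<in> carrier F" "d \<in> carrier F" "v \<in> Z"
  shows "act (c \<cdot> d) v = act c (act d v)"
proof -
  obtain g where g: "g \<in> carrier G" "c = pr g" using pr_surj[OF assms(1)] by blast
  obtain h where h: "h \<in> carrier G" "d = pr h" using pr_surj[OF assms(2)] by blast
  note gh = g h
  have "act (c \<cdot> d) v = conj_by G (g \<otimes> h) v"
    using act_pr[of "g \<otimes> h" v] gh assms(3) by (simp add: pr_mult)
  also have "\<dots> = conj_by G g (conj_by G h v)"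
    using conj_by_conj_by[of g h v] gh assms(3) Z_carrier by auto
  finally show ?thesis using gh assms(3) conj_by_Z by (simp add: act_pr)
qed

lemma act_free: "\<lbrakk>c \<in> M; c \<noteq> \<one>\<^sub>F; v \<in> Z; act c v = v\<rbrakk> \<Longrightarrow> v = \<one>"
proof (rule ccontr)
  assume c: "c \<in> M" "c \<noteq> \<one>\<^sub>F" and v: "v \<in> Z" "act c v = v" "v \<noteq> \<one>"
  obtain l where l: "l \<in> L" "c = pr l" using c by (auto simp: M_def pr_def)
  have lG: "l \<in> carrier G" using l by simp
  have "l \<otimes> v = v \<otimes> l" using v act_pr[OF lG v(1)] l(2) conj_by_eq_self_iff[OF lG] Z_carrier by auto
  then have "l \<in> K" using commute_K[of v l] v Z_sub_K l by blast
  then show False using c l pr_eq_one_iff[OF lG] by simp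
qed

lemma Z_nontrivial: "\<exists>v\<in>Z. v \<noteq> \<one>"
proof -
  have "\<exists>b\<in>K - {\<one>}. \<forall>g\<in>K. conj_by G g b \<otimes> inv b \<in> {\<one>}"
    using lo.kernel_nontrivial K.one_closed
    by (intro prime_power_group_central_mod[OF K.subgroup_axioms p_prime card_K triv_subgroup]) auto
  then obtain b where b: "b \<in> K" "b \<noteq> \<one>" "\<And>g. g \<in> K \<Longrightarrow> conj_by G g b \<otimes> inv b = \<one>" by blast
  have bG: "b \<in> carrier G" using b by simp
  have "b \<otimes> g = g \<otimes> b" if g: "g \<in> K" for g
  proof -
    have gG: "g \<in> carrier G" using g by simp
    have "conj_by G g b = b" using b(3)[OF g] inv_equality[of "conj_by G g b" "inv b"] gG bG by simp
    then show ?thesis using conj_by_eq_self_iff[OF gG bG] by simp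
  qed
  then have "b \<in> Z" using b(1) by (intro Z_I)
  then show ?thesis using b(2) by blast
qed

lemma not_p_dvd_ord_M:
  assumes "a \<in> M" "prime (up.ord a)"
  shows "\<not> p dvd up.ord a"
proof
  assume "p dvd up.ord a"
  also have "up.ord a dvd card M" using up.ord_dvd_card_subgroup[OF up.subgroup_kernel assms(1)] .
  finally show False using p_not_dvd_card_M by blast
qed

text \<open>Otherwise a group of type \<open>(r, r)\<close> would act without fixed points on
  \<open>Z\<close>, and \<open>Z\<close> would have exponent dividing \<open>r\<close>. But
  \<open>Z\<close> is a nontrivial \<open>p\<close>-group and \<open>r\<close> is not
  \<open>p\<close>.\<close>

lemma rank_one_M:
  assumes ab: "a \<in> M" "b \<in> M" "prime (up.ord a)" "up.ord b = up.ord a" "a \<cdot> b = b \<cdot> a"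
  shows "b \<in> generate F {a}"
proof (rule ccontr)
  assume notin: "b \<notin> generate F {a}"
  have MF: "M \<subseteq> carrier F" by (rule up.kernel_carrier)
  obtain v where v: "v \<in> Z" "v \<noteq> \<one>" using Z_nontrivial by blast
  have "v [^]\<^bsub>ZG\<^esub> up.ord a = \<one>\<^bsub>ZG\<^esub>"
  proof (rule up.fixed_point_free_rank_one[OF comm_group_Z up.finite_carrier up.subgroup_kernel _ _ _ _ ab notin])
    show "act d \<in> hom ZG ZG" if "d \<in> M" for d using act_hom that MF by blast
    show "act \<one>\<^sub>F w = w" if "w \<in> carrier ZG" for w using act_one that by simp
    show "act (d \<cdot> e) w = act d (act e w)" if "d \<in> M" "e \<in> M" "w \<in> carrier ZG" for d e w
      using act_mult that MF by auto
    show "w = \<one>\<^bsub>ZG\<^esub>" if "d \<in> M" "d \<noteq> \<one>\<^sub>F" "w \<in> carrier ZG" "act d w = w" for d w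
      using act_free[of d w] that by simp
    show "v \<in> carrier ZG" using v by simp
  qed
  then have "v [^] up.ord a = \<one>" by (simp add: nat_pow_consistent[symmetric])
  then show False using coprime_power_K[OF _ not_p_dvd_ord_M[OF ab(1,3)]] v Z_sub_K by blast
qed

sublocale fp: fpf_kernel F M
proof (rule fpf_kernel.intro[OF up.is_group fpf_kernel_axioms.intro])
  show "finite (carrier F)" by (rule up.finite_carrier)
  show "M \<lhd> F" by (rule up.normal_kernel)
  show "M \<noteq> carrier F" by (rule up.kernel_ne_carrier)
  show "m = \<one>\<^sub>F" if "y \<in> carrier F" "y \<notin> M" "m \<in> M" "y \<cdot> m = m \<cdot> y" for y m
    using up.commute_kernel[OF that(3) _ that(1,4)] that(2) by blast
  show "b \<in> generate F {a}"
    if "a \<in> M" "b \<in> M" "prime (up.ord a)" "up.ord b = up.ord a" "a \<cdot> b = b \<cdot> a" for a b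
    using that by (rule rank_one_M)
qed

lemma commutator_in_L:
  assumes "g \<in> carrier G" "h \<in> carrier G"
  shows "g \<otimes> h \<otimes> inv g \<otimes> inv h \<in> L"
proof -
  obtain x where x: "x \<in> M" "prime (up.ord x)" "\<And>m. m \<in> M \<Longrightarrow> m \<cdot> x = x \<cdot> m"
      "\<And>c d. c \<in> carrier F \<Longrightarrow> d \<in> carrier F \<Longrightarrow>
        c \<cdot> d \<cdot> inv\<^bsub>F\<^esub> c \<cdot> inv\<^bsub>F\<^esub> d \<in> M"
    by (rule fp.central_element_and_abelian_quotient[OF up.kernel_nontrivial]) (rule that)
  have "pr g \<cdot> pr h \<cdot> inv\<^bsub>F\<^esub> pr g \<cdot> inv\<^bsub>F\<^esub> pr h \<in> M"
    using x(4) assms by simp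
  then have "pr (g \<otimes> h \<otimes> inv g \<otimes> inv h) \<in> M" using assms by (simp add: pr_mult pr_inv)
  then show ?thesis using pr_mem_M_iff assms by simp
qed

section \<open>Complements of \<open>K\<close> in \<open>L\<close> as copies of
  \<open>M\<close>\<close>

lemma inj_on_pr_H:
  assumes H: "H \<in> \<H>"
  shows "inj_on pr H"
proof (rule inj_onI)
  fix x y assume xy: "x \<in> H" "y \<in> H" "pr x = pr y"
  have c: "x \<in> carrier G" "y \<in> carrier G" using xy H_sub_G[OF H] by blast+
  have "x \<otimes> inv y \<in> K" using pr_eq_iff[OF c] xy(3) by blast
  moreover have "x \<otimes> inv y \<in> H" using xy subgroupE(3,4)[OF subgroup_H[OF H]] by blast
  ultimately have "x \<otimes> inv y = \<one>" using H_Int_K[OF H] by blast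
  then show "x = y" using c by (metis inv_closed inv_equality inv_inv)
qed

lemma pr_image_H:
  assumes H: "H \<in> \<H>"
  shows "pr ` H = M"
proof (rule card_subset_eq)
  show "finite M" using up.kernel_carrier up.finite_carrier by (rule finite_subset)
  show "pr ` H \<subseteq> M" using H_sub_L[OF H] by (auto simp: M_def pr_def)
  show "card (pr ` H) = card M" using card_image[OF inj_on_pr_H[OF H]] card_H[OF H] by simp
qed

lemma ord_pr_H:
  assumes H: "H \<in> \<H>" and h: "h \<in> H"
  shows "up.ord (pr h) = ord h"
proof -
  have hG: "h \<in> carrier G" using h H_sub_G[OF H] by blast
  have dvd_iff: "up.ord (pr h) dvd m \<longleftrightarrow> ord h dvd m" for m
  proof -
    have hm: "h [^] m \<in> H" using subgroup_pow_closed[OF subgroup_H[OF H] h] .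
    have "up.ord (pr h) dvd m \<longleftrightarrow> pr (h [^] m) = \<one>\<^sub>F"
      using up.pow_eq_id[OF pr_closed[OF hG]] pr_pow[OF hG] by simp
    also have "\<dots> \<longleftrightarrow> h [^] m = \<one>" using pr_eq_one_iff[of "h [^] m"] hG H_Int_K[OF H hm] by auto
    finally show ?thesis using pow_eq_id[OF hG] by simp
  qed
  show ?thesis
    using dvd_iff[of "ord h"] dvd_iff[of "up.ord (pr h)"] by (intro dvd_antisym) simp_all
qed

text \<open>The central element of prime order of \<open>M\<close> is pulled back along the
  bijection from \<open>H\<close> to \<open>M\<close>. It serves as the hub of the component:
  elements of another prime order commute with it, and those of the same order are powers of
  it.\<close>

lemma H_central_element:
  assumes H: "H \<in> \<H>"
  obtains h0 where "h0 \<in> H" "prime (ord h0)" "\<And>h. h \<in> H \<Longrightarrow> h \<otimes> h0 = h0 \<otimes> h"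
    "\<And>h. h \<in> H \<Longrightarrow> ord h = ord h0 \<Longrightarrow> h \<in> generate G {h0}"
proof -
  obtain x where x: "x \<in> M" "prime (up.ord x)" "\<And>m. m \<in> M \<Longrightarrow> m \<cdot> x = x \<cdot> m"
      "\<And>c d. c \<in> carrier F \<Longrightarrow> d \<in> carrier F \<Longrightarrow>
        c \<cdot> d \<cdot> inv\<^bsub>F\<^esub> c \<cdot> inv\<^bsub>F\<^esub> d \<in> M"
    by (rule fp.central_element_and_abelian_quotient[OF up.kernel_nontrivial]) (rule that)
  have "x \<in> pr ` H" using x(1) pr_image_H[OF H] by simp
  then obtain h0 where h0: "h0 \<in> H" "pr h0 = x" by auto
  have h0G: "h0 \<in> carrier G" using h0 H_sub_G[OF H] by blast
  have prH: "pr h \<in> M" if "h \<in> H" for h using imageI[OF that, of pr] pr_image_H[OF H] by simp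
  have comm: "h \<otimes> h0 = h0 \<otimes> h" if h: "h \<in> H" for h
  proof (rule inj_onD[OF inj_on_pr_H[OF H]])
    have hG: "h \<in> carrier G" using h H_sub_G[OF H] by blast
    show "pr (h \<otimes> h0) = pr (h0 \<otimes> h)" using x(3)[OF prH[OF h]] h0 hG h0G by (simp add: pr_mult)
    show "h \<otimes> h0 \<in> H" using subgroup.m_closed[OF subgroup_H[OF H] h h0(1)] .
    show "h0 \<otimes> h \<in> H" using subgroup.m_closed[OF subgroup_H[OF H] h0(1) h] .
  qed
  have gen: "h \<in> generate G {h0}" if h: "h \<in> H" "ord h = ord h0" for h
  proof -
    have hG: "h \<in> carrier G" using h H_sub_G[OF H] by blast
    have "up.ord (pr h) = up.ord x" using ord_pr_H[OF H h(1)] ord_pr_H[OF H h0(1)] h(2) h0(2) by simp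
    then have gen: "pr h \<in> generate F {x}"
      by (rule rank_one_M[OF x(1) prH[OF h(1)] x(2) _ x(3)[OF prH[OF h(1)], symmetric]])
    have xF: "x \<in> carrier F" using subsetD[OF up.kernel_carrier x(1)] .
    obtain k :: nat where "pr h = x [^]\<^bsub>F\<^esub> k"
      using iffD1[OF up.mem_generate_singleton_iff[OF up.finite_carrier xF] gen] by blast
    then have "pr h = pr (h0 [^] k)" using h0 pr_pow[OF h0G] by simp
    then have "h = h0 [^] k"
      by (rule inj_onD[OF inj_on_pr_H[OF H] _ h(1) subgroup_pow_closed[OF subgroup_H[OF H] h0(1)]])
    then show ?thesis using mem_generate_singleton_iff[OF finite_carrier h0G] by blast
  qed
  have "prime (ord h0)" using ord_pr_H[OF H h0(1)] h0(2) x(2) by simp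
  then show thesis by (rule that[OF h0(1) _ comm gen])
qed

text \<open>The kernel \<open>M\<close> and the complements partition \<open>F\<close>, and \<open>M\<close> fixes no nontrivial element of
  \<open>Z\<close>; if no complement did, every element of \<open>Z\<close> would satisfy \<open>v ^ card M = \<one>\<close>.\<close>

lemma complement_fixes_some:
  "\<exists>Q\<in>\<Q>. \<exists>u\<in>Z. u \<noteq> \<one> \<and> (\<forall>c\<in>Q. act c u = u)"
proof (rule ccontr)
  assume none: "\<not> ?thesis"
  interpret Zc: comm_group ZG by (rule comm_group_Z)
  obtain v where v: "v \<in> Z" "v \<noteq> \<one>" using Z_nontrivial by blast
  obtain c where c: "c \<in> M" "c \<noteq> \<one>\<^sub>F"
    using up.kernel_nontrivial subgroup.one_closed[OF up.subgroup_kernel] by blast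
  have M\<Q>: "M \<notin> \<Q>" using c up.complement_Int_kernel by blast
  have "v [^]\<^bsub>ZG\<^esub> card (insert M \<Q>) = v"
  proof (rule Zc.fixed_point_free_partition[where D = F and act = act])
    show "group F" "finite (carrier F)" by (fact up.is_group up.finite_carrier)+
    show "finite (insert M \<Q>)" using up.finite_complements by simp
    show "subgroup S F" if "S \<in> insert M \<Q>" for S
      using that up.subgroup_kernel up.subgroup_complement by blast
    show "S = T" if st: "S \<in> insert M \<Q>" "T \<in> insert M \<Q>" "x \<in> S" "x \<in> T" "x \<noteq> \<one>\<^sub>F" for S T x
    proof -
      have "x \<notin> M" if "x \<in> Q" "Q \<in> \<Q>" for Q
        using up.complement_Int_kernel[OF that(2)] that(1) \<open>x \<noteq> \<one>\<^sub>F\<close> by blast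
      then show ?thesis using st up.complements_meet[of S T x] by blast
    qed
    show "\<Union>(insert M \<Q>) = carrier F" using up.covers by simp
    show "act d \<in> hom ZG ZG" if "d \<in> carrier F" for d using that by (rule act_hom)
    show "act \<one>\<^sub>F a = a" if "a \<in> carrier ZG" for a using that act_one by simp
    show "act (d \<cdot> e) a = act d (act e a)"
      if "d \<in> carrier F" "e \<in> carrier F" "a \<in> carrier ZG" for d e a
      using that act_mult by simp
    show "v \<in> carrier ZG" using v by simp
    show "u = \<one>\<^bsub>ZG\<^esub>"
      if S: "S = carrier F \<or> S \<in> insert M \<Q>" and u: "u \<in> carrier ZG" "\<And>d. d \<in> S \<Longrightarrow> act d u = u" for S u
    proof (cases "S \<in> \<Q>")
      case True
      then show ?thesis using none u by auto
    next
      case False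
      \<comment> \<open>The sets left over are \<open>F\<close> and \<open>M\<close>, and both
        contain the fixed-point-free element \<open>c\<close>.\<close>
      then have "c \<in> S" using S c up.kernel_carrier by blast
      then show ?thesis using act_free[OF c] u by simp
    qed
  qed
  \<comment> \<open>\<open>M\<close> and its \<open>card M\<close> complements are
    \<open>card M + 1\<close> parts.\<close>
  then have "v [^] Suc (card M) = v"
    using M\<Q> up.finite_complements up.card_complements by (simp add: nat_pow_consistent[symmetric])
  then have "v [^] card M = \<one>" using v Z_carrier by (auto simp: subset_iff)
  then show False using coprime_power_K[OF _ p_not_dvd_card_M] v Z_sub_K by blast
qed

text \<open>The complements are conjugate, so a nontrivial fixed element for one of them can be
  moved to each of the others; a suitable power then has order \<open>p\<close>.\<close>

lemma complement_fixed_element: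
  assumes Q: "Q \<in> \<Q>"
  shows "\<exists>u\<in>K. ord u = p \<and> (\<forall>g\<in>carrier G. pr g \<in> Q \<longrightarrow> g \<otimes> u = u \<otimes> g)"
proof -
  obtain Q0 u0 where 0: "Q0 \<in> \<Q>" "u0 \<in> Z" "u0 \<noteq> \<one>" "\<And>c. c \<in> Q0 \<Longrightarrow> act c u0 = u0"
    using complement_fixes_some by blast
  obtain c where c: "c \<in> carrier F" "Q = conj_by F c ` Q0" using up.complements_conj[OF 0(1) Q] by blast
  obtain g0 where g0: "g0 \<in> carrier G" "c = pr g0" using pr_surj[OF c(1)] by blast
  define v where "v = conj_by G g0 u0"
  have u0G: "u0 \<in> carrier G" using 0 Z_carrier by blast
  have vZ: "v \<in> Z" and vG: "v \<in> carrier G" using conj_by_Z[OF g0(1) 0(2)] Z_carrier by (auto simp: v_def)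
  have v1: "v \<noteq> \<one>" using conj_by_inject[OF g0(1) u0G one_closed] g0(1) 0(3) by (simp add: v_def)
  have fixed: "g \<otimes> v = v \<otimes> g" if g: "g \<in> carrier G" "pr g \<in> Q" for g
  proof -
    obtain d where d: "d \<in> Q0" "pr g = conj_by F c d" using g c by blast
    have dF: "d \<in> carrier F" using d up.complement_carrier[OF 0(1)] by blast
    obtain h where h: "h \<in> carrier G" "d = pr h" using pr_surj[OF dF] by blast
    have hu: "conj_by G h u0 = u0" using act_pr[OF h(1) 0(2)] 0(4)[OF d(1)] h(2) by simp
    have "pr g = pr (conj_by G g0 h)"
      using d(2) g0 h by (simp add: conj_by_def pr_mult pr_inv)
    then have "conj_by G g v = conj_by G (conj_by G g0 h) v"
      using act_pr[OF g(1) vZ] act_pr[of "conj_by G g0 h" v] g0 h vZ by simp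
    also have "\<dots> = conj_by G g0 (conj_by G h u0)"
      using g0 h u0G by (simp add: v_def conj_by_def group_word)
    finally have "conj_by G g v = v" unfolding hu v_def[symmetric] .
    then show ?thesis using conj_by_eq_self_iff[OF g(1) vG] by blast
  qed
  have vK: "v \<in> K" using vZ Z_sub_K by blast
  obtain k where k: "ord v = p ^ k"
    using ord_dvd_card_K[OF vK] divides_primepow_nat[OF p_prime] by blast
  have "ord v \<noteq> 1" using ord_eq_1[OF vG] v1 by blast
  then have "p dvd ord v" using k by (cases k) auto
  then have "ord (v [^] (ord v div p)) = p" using ord_pow_div[OF finite_carrier vG p_prime] by blast
  moreover have "v [^] (ord v div p) \<in> K" using subgroup_pow_closed[OF K.subgroup_axioms vK] .
  moreover have "g \<otimes> v [^] (ord v div p) = v [^] (ord v div p) \<otimes> g"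
    if "g \<in> carrier G" "pr g \<in> Q" for g
    using commute_pow_right[OF that(1) vG fixed[OF that]] .
  ultimately show ?thesis by blast
qed

section \<open>Labels of elements of prime order\<close>

text \<open>The description is meaningful where exactly one complement contains the image, that is,
  for \<open>g\<close> outside \<open>L\<close>; likewise \<open>hconj\<close> is used on
  \<open>L - K\<close> only.\<close>

definition compl where "compl g = (THE Q. Q \<in> \<Q> \<and> pr g \<in> Q)"
definition hconj where "hconj x = (THE H. H \<in> \<H> \<and> x \<in> H)"
definition linked where "linked x y \<longleftrightarrow> y \<in> carrier G \<and> prime (ord y) \<and> ord y \<noteq> p \<and> x \<otimes> y = y \<otimes> x"

text \<open>The label of an element of prime order records its component: a conjugate of the complement of
  \<open>K\<close> in \<open>L\<close>, a complement of \<open>M\<close> in \<open>F\<close>, or an isolated subgroup of order \<open>p\<close>.\<close>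

definition label :: "'a \<Rightarrow> nat \<times> 'a set set" where
  "label x = (if x \<in> L - K then (0, {hconj x})
    else if ord x \<noteq> p then (1, compl x)
    else if \<exists>y. linked x y then (1, compl (SOME y. linked x y))
    else (2, {generate G {x}}))"

lemma hconj_eq:
  assumes "H \<in> \<H>" "x \<in> H" "x \<noteq> \<one>"
  shows "hconj x = H"
  unfolding hconj_def
proof (rule the_equality)
  show "H \<in> \<H> \<and> x \<in> H" using assms by simp
  show "H' = H" if "H' \<in> \<H> \<and> x \<in> H'" for H'
    using lo.complements_meet[of H' H x] that assms by simp
qed

lemma pr_notin_M: "g \<in> carrier G \<Longrightarrow> g \<notin> L \<Longrightarrow> pr g \<in> carrier F - M"
  using pr_mem_M_iff by simp

lemma pr_ne_one: "g \<in> carrier G \<Longrightarrow> g \<notin> L \<Longrightarrow> pr g \<noteq> \<one>\<^sub>F"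
  using pr_eq_one_iff K_sub_L by blast

lemma compl_eq:
  assumes "Q \<in> \<Q>" "pr g \<in> Q" "g \<in> carrier G" "g \<notin> L"
  shows "compl g = Q"
  unfolding compl_def
proof (rule the_equality)
  show "Q \<in> \<Q> \<and> pr g \<in> Q" using assms by simp
  show "Q' = Q" if "Q' \<in> \<Q> \<and> pr g \<in> Q'" for Q'
    using up.complements_meet[of Q' Q "pr g"] that assms(1,2) pr_ne_one[OF assms(3,4)] by simp
qed

lemma compl:
  assumes "g \<in> carrier G" "g \<notin> L"
  shows "compl g \<in> \<Q>" "pr g \<in> compl g"
proof -
  obtain Q where "Q \<in> \<Q>" "pr g \<in> Q" using up.complement_ex[OF pr_notin_M[OF assms]] by blast
  then show "compl g \<in> \<Q>" "pr g \<in> compl g" using compl_eq assms by simp_all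
qed

lemma compl_commute:
  assumes "g \<in> carrier G" "g \<notin> L" "h \<in> carrier G" "h \<notin> L" "pr g \<cdot> pr h = pr h \<cdot> pr g"
  shows "compl h = compl g"
proof (rule compl_eq[OF compl(1)[OF assms(1,2)] _ assms(3,4)])
  show "pr h \<in> compl g"
    using up.commute_complement[OF compl[OF assms(1,2)] pr_ne_one[OF assms(1,2)] pr_closed[OF assms(3)] assms(5)[symmetric]] .
qed

text \<open>Commuting elements of \<open>F\<close> outside \<open>M\<close> lie in the same
  complement, so it is enough to compare \<open>y\<close> and \<open>z\<close> with \<open>x\<close>
  when \<open>x\<close> is outside \<open>L\<close>, and with each other modulo \<open>K\<close>
  when \<open>x\<close> is in \<open>K\<close>. As a result the choice made by \<open>SOME\<close>
  in \<open>label\<close> is immaterial.\<close>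

lemma compl_common_centralizer:
  assumes x: "x \<in> carrier G" "x \<noteq> \<one>" "x \<in> K \<or> x \<notin> L"
    and y: "y \<in> carrier G" "y \<notin> L" "x \<otimes> y = y \<otimes> x"
    and z: "z \<in> carrier G" "z \<notin> L" "x \<otimes> z = z \<otimes> x"
  shows "compl y = compl z"
proof (cases "x \<in> L")
  case False
  have "compl y = compl x" using compl_commute[OF x(1) False y(1,2) commute_pr[OF x(1) y(1,3)]] .
  moreover have "compl z = compl x" using compl_commute[OF x(1) False z(1,2) commute_pr[OF x(1) z(1,3)]] .
  ultimately show ?thesis by simp
next
  case True
  then have xK: "x \<in> K" using x(3) by blast
  let ?c = "z \<otimes> y \<otimes> inv z \<otimes> inv y"
  have cx: "conj_by G y x = x" "conj_by G z x = x"
    using conj_by_eq_self_iff[OF y(1) x(1)] conj_by_eq_self_iff[OF z(1) x(1)] y(3) z(3) by simp_all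
  have icx: "conj_by G (inv y) x = x" "conj_by G (inv z) x = x"
    using conj_by_cancel(1)[OF y(1) x(1)] conj_by_cancel(1)[OF z(1) x(1)] cx by simp_all
  have "conj_by G ?c x = conj_by G z (conj_by G y (conj_by G (inv z) (conj_by G (inv y) x)))"
    using x(1) y(1) z(1) by (simp add: conj_by_conj_by m_assoc)
  also have "\<dots> = x" by (simp only: cx icx)
  finally have "?c \<otimes> x = x \<otimes> ?c" using conj_by_eq_self_iff[of ?c x] x(1) y(1) z(1) by simp
  then have "?c \<in> K" using commute_K[OF xK x(2) commutator_in_L[OF z(1) y(1)]] by simp
  then have "pr (z \<otimes> y) = pr (y \<otimes> z)"
    using pr_eq_iff[of "z \<otimes> y" "y \<otimes> z"] y(1) z(1) by (simp add: inv_mult_group m_assoc)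
  then show ?thesis using compl_commute[OF z(1,2) y(1,2)] y(1) z(1) by (simp add: pr_mult)
qed

lemma prime_ord_ne_p: "\<lbrakk>prime (ord y); ord y \<noteq> p; y \<notin> L - K\<rbrakk> \<Longrightarrow> y \<notin> L"
  using prime_ord_K by blast

lemma L_minus_K_E:
  assumes "x \<in> L - K"
  obtains H where "H \<in> \<H>" "x \<in> H" "x \<noteq> \<one>"
  using assms L_minus_K by (metis DiffD1 DiffD2 K.one_closed)

lemma commute_L_minus_K:
  assumes "x \<in> L - K" "y \<in> carrier G" "y \<noteq> \<one>" "x \<otimes> y = y \<otimes> x"
  shows "y \<in> L - K" "hconj y = hconj x"
proof -
  obtain H where H: "H \<in> \<H>" "x \<in> H" "x \<noteq> \<one>" using assms(1) by (rule L_minus_K_E)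
  have "y \<in> H" using commute_H[OF H assms(2) assms(4)[symmetric]] .
  then show "y \<in> L - K" "hconj y = hconj x"
    using H_nontrivial_notin_K[OF H(1)] hconj_eq[OF H] hconj_eq[OF H(1)] assms(3) by simp_all
qed

lemma L_minus_K_ord: "x \<in> L - K \<Longrightarrow> ord x \<noteq> p"
proof
  assume x: "x \<in> L - K" "ord x = p"
  obtain H where H: "H \<in> \<H>" "x \<in> H" "x \<noteq> \<one>" using x(1) by (rule L_minus_K_E)
  have "p dvd card M" using ord_dvd_card_subgroup[OF subgroup_H[OF H(1)] H(2)] card_H[OF H(1)] x(2) by simp
  then show False using p_not_dvd_card_M by blast
qed

lemma label_L_minus_K: "x \<in> L - K \<Longrightarrow> label x = (0, {hconj x})"
  by (simp add: label_def)

lemma label_ne_p: "\<lbrakk>prime (ord x); ord x \<noteq> p; x \<notin> L - K\<rbrakk> \<Longrightarrow> label x = (1, compl x)"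
  by (auto simp: label_def)

lemma prime_ord_ne_one: "prime (ord x) \<Longrightarrow> x \<noteq> \<one>"
  by auto

text \<open>In \<open>K\<close> only the prime order \<open>p\<close> occurs. An element of
  \<open>L - K\<close> commutes with nonidentity elements of \<open>L - K\<close> only, and none of
  these has order \<open>p\<close>.\<close>

lemma linked_notin_L:
  assumes x: "x \<in> carrier G" "ord x = p" and y: "linked x y"
  shows "y \<notin> L"
proof (rule prime_ord_ne_p)
  show "prime (ord y)" "ord y \<noteq> p" using y by (simp_all add: linked_def)
  show "y \<notin> L - K"
  proof
    assume "y \<in> L - K"
    moreover have "x \<noteq> \<one>" using prime_ord_ne_one[of x] x p_prime by simp
    moreover have "y \<otimes> x = x \<otimes> y" using y by (simp add: linked_def)
    ultimately have "x \<in> L - K" using commute_L_minus_K(1) x(1) by blast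
    then show False using L_minus_K_ord x(2) by blast
  qed
qed

lemma label_linked:
  assumes x: "x \<in> carrier G" "ord x = p" and y: "linked x y"
  shows "label x = (1, compl y)"
proof -
  have xLK: "x \<notin> L - K" using L_minus_K_ord x(2) by blast
  have x1: "x \<noteq> \<one>" using prime_ord_ne_one[of x] x(2) p_prime by simp
  define z where "z = (SOME y. linked x y)"
  have z: "linked x z" unfolding z_def using y by (rule someI)
  have "compl z = compl y"
  proof (rule compl_common_centralizer[OF x(1) x1])
    show "x \<in> K \<or> x \<notin> L" using xLK by blast
    show "z \<notin> L" "y \<notin> L" using linked_notin_L[OF x] y z by blast+
    show "z \<in> carrier G" "y \<in> carrier G" "x \<otimes> z = z \<otimes> x" "x \<otimes> y = y \<otimes> x"
      using y z by (simp_all add: linked_def)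
  qed
  then show ?thesis using xLK x(2) y by (auto simp: label_def z_def)
qed

lemma label_commute_p:
  assumes x: "x \<in> carrier G" "ord x = p" and y: "y \<in> carrier G" "prime (ord y)" "ord y \<noteq> p" "x \<otimes> y = y \<otimes> x"
  shows "label x = label y"
proof -
  have g: "linked x y" using y by (simp add: linked_def)
  have "y \<notin> L" using linked_notin_L[OF x g] .
  then have "label y = (1, compl y)" using label_ne_p[OF y(2,3)] by blast
  then show ?thesis using label_linked[OF x g] by simp
qed

lemma label_commute:
  assumes x: "x \<in> carrier G" "prime (ord x)" and y: "y \<in> carrier G" "prime (ord y)"
    and ne: "ord x \<noteq> ord y" and comm: "x \<otimes> y = y \<otimes> x"
  shows "label x = label y"
proof (cases "x \<in> L - K \<or> y \<in> L - K")
  case True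
  then have "y \<in> L - K \<and> x \<in> L - K \<and> hconj x = hconj y"
  proof
    assume xLK: "x \<in> L - K"
    show ?thesis using xLK commute_L_minus_K[OF xLK y(1) prime_ord_ne_one[OF y(2)] comm] by simp
  next
    assume yLK: "y \<in> L - K"
    show ?thesis using yLK commute_L_minus_K[OF yLK x(1) prime_ord_ne_one[OF x(2)] comm[symmetric]] by simp
  qed
  then show ?thesis by (simp add: label_L_minus_K)
next
  case False
  show ?thesis
  proof (cases "ord x = p \<or> ord y = p")
    case True
    then show ?thesis
      using label_commute_p[OF x(1) _ y(1,2) _ comm] label_commute_p[OF y(1) _ x(1,2) _ comm[symmetric]] ne
      by auto
  next
    case np: False
    have nL: "x \<notin> L" "y \<notin> L" using False np prime_ord_ne_p x y by blast+
    have "compl x = compl y"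
      using compl_commute[OF y(1) nL(2) x(1) nL(1) commute_pr[OF y(1) x(1) comm[symmetric]]] .
    then show ?thesis using label_ne_p False np x y by simp
  qed
qed

lemma label_generate:
  assumes x: "x \<in> carrier G" "prime (ord x)" and y: "y \<in> generate G {x}" "ord y = ord x"
  shows "label x = label y"
proof -
  have yG: "y \<in> carrier G" using y(1) generate_incl[of "{x}"] x(1) by auto
  obtain k :: nat where k: "y = x [^] k" using y(1) mem_generate_singleton_iff[OF finite_carrier x(1)] by blast
  have xy: "x \<in> generate G {y}"
    using x(2) y(2)
    by (intro generate_eq_prime_ord[OF finite_carrier x(1) y(1) _ generate_singleton_mem]) simp_all
  then obtain j :: nat where j: "x = y [^] j" using mem_generate_singleton_iff[OF finite_carrier yG] by blast
  have comm: "x \<otimes> y = y \<otimes> x" unfolding k using commute_pow_right[OF x(1) x(1) refl] .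
  have x1: "x \<noteq> \<one>" "y \<noteq> \<one>" using prime_ord_ne_one x(2) y(2) by metis+
  show ?thesis
  proof (cases "x \<in> L - K")
    case True
    then show ?thesis using commute_L_minus_K[OF True yG x1(2) comm] by (simp add: label_L_minus_K)
  next
    case xn: False
    then have yn: "y \<notin> L - K" using commute_L_minus_K(1)[OF _ x(1) x1(1) comm[symmetric]] by blast
    show ?thesis
    proof (cases "ord x = p")
      case False
      have nL: "x \<notin> L" "y \<notin> L" using False xn yn prime_ord_ne_p x y by metis+
      have "compl x = compl y"
        using compl_commute[OF yG nL(2) x(1) nL(1) commute_pr[OF yG x(1) comm[symmetric]]] .
      then show ?thesis using label_ne_p False xn yn x y by simp
    next
      case True
      \<comment> \<open>\<open>x\<close> and \<open>y\<close> are powers of each other and have the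
        same centraliser. Equality of the predicates makes \<open>SOME\<close> pick the same element
        for both.\<close>
      have "linked x = linked y"
      proof
        fix z
        have "x \<otimes> z = z \<otimes> x \<longleftrightarrow> y \<otimes> z = z \<otimes> y" if z: "z \<in> carrier G"
        proof
          assume "x \<otimes> z = z \<otimes> x"
          then show "y \<otimes> z = z \<otimes> y" unfolding k using commute_pow_right[OF z x(1), of k] by simp
        next
          assume "y \<otimes> z = z \<otimes> y"
          then show "x \<otimes> z = z \<otimes> x" unfolding j using commute_pow_right[OF z yG, of j] by simp
        qed
        then show "linked x z = linked y z" by (auto simp: linked_def)
      qed
      moreover have "generate G {x} = generate G {y}"
        using generate_singleton_subset[OF subgroup_generate_singleton] xy y(1) x(1) yG by blast
      ultimately show ?thesis using xn yn True y(2) by (auto simp: label_def)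
    qed
  qed
qed

section \<open>Paths in the cyclic graph\<close>

abbreviation reach (infix "\<leadsto>" 50) where "x \<leadsto> y \<equiv> x \<rightarrow>\<^sup>*\<^bsub>with_proj (cyclic_graph G)\<^esub> y"

sublocale D: graph "with_proj (cyclic_graph G)"
  using finite_carrier by (rule graph_cyclic_graph)

text \<open>The product \<open>x y\<close> generates a cyclic group containing both elements and so
  connects them.\<close>

lemma reach_commute:
  assumes x: "x \<in> carrier G" "prime (ord x)" and y: "y \<in> carrier G" "prime (ord y)"
    and ne: "ord x \<noteq> ord y" and comm: "x \<otimes> y = y \<otimes> x"
  shows "x \<leadsto> y"
proof -
  have cop: "coprime (ord x) (ord y)" using primes_coprime[OF x(2) y(2) ne] .
  have xyG: "x \<otimes> y \<in> carrier G" using x y by simp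
  have "x \<otimes> y \<leadsto> x"
    using cyclic_graph_reachable_power[OF finite_carrier xyG commute_mem_generate_mult[OF x(1) y(1) comm cop]
        prime_ord_ne_one[OF x(2)]] .
  then have "x \<leadsto> x \<otimes> y" by (rule D.symmetric_reachable')
  also have "y \<in> generate G {x \<otimes> y}"
    using commute_mem_generate_mult[OF y(1) x(1) comm[symmetric]] cop comm by (simp add: coprime_commute)
  then have "x \<otimes> y \<leadsto> y"
    using cyclic_graph_reachable_power[OF finite_carrier xyG _ prime_ord_ne_one[OF y(2)]] by blast
  finally show ?thesis .
qed

lemma reach_generate:
  "\<lbrakk>x \<in> carrier G; y \<in> generate G {x}; prime (ord y)\<rbrakk> \<Longrightarrow> x \<leadsto> y"
  using cyclic_graph_reachable_power[OF finite_carrier] prime_ord_ne_one by blast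

end

lemma exists_other_prime_divisor:
  fixes c p :: nat
  assumes "c > 0" "prime p" "\<And>k. c \<noteq> p ^ k"
  obtains s where "prime s" "s \<noteq> p" "s dvd c"
proof -
  obtain m where m: "c = p ^ multiplicity p c * m" "\<not> p dvd m"
    using multiplicity_decompose'[of c p] assms(1,2) not_prime_unit by (metis neq0_conv)
  have "m \<noteq> 1" using m(1) assms(3) by (metis mult.right_neutral)
  then obtain s where s: "prime s" "s dvd m" using prime_factor_nat by blast
  have "s \<noteq> p" using s m(2) by blast
  moreover have "s dvd c" using s(2) m(1) by (metis dvd_mult)
  ultimately show thesis using that s(1) by blast
qed

section \<open>Components and their labels\<close>

context two_frobenius_p
begin

lemma card_complement_eq:
  assumes Q: "Q \<in> \<Q>"
  shows "card Q = order (G Mod L)"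
proof -
  have cF: "card (carrier F) * card K = card (carrier G)"
    unfolding F_def using lagrange[OF K.subgroup_axioms] by (simp add: FactGroup_def order_def)
  have cL: "order (G Mod L) * card L = card (carrier G)"
    using lagrange[OF L.subgroup_axioms] by (simp add: FactGroup_def order_def)
  have "card Q * card L = card Q * card M * card K" using card_M by (simp add: mult.assoc)
  also have "\<dots> = order (G Mod L) * card L" using up.card_complement[OF Q] cF cL by simp
  finally have "card Q * card L = order (G Mod L) * card L" .
  moreover have "L \<noteq> {}" using L.one_closed by blast
  then have "card L \<noteq> 0" using finite_subset[OF L.subset finite_carrier] by simp
  ultimately show ?thesis by simp
qed

text \<open>\<open>Q\<close> has the order of \<open>G / L\<close>, so some prime \<open>s\<close>
  other than \<open>p\<close> divides it. An element of order \<open>s\<close> in \<open>Q\<close>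
  has to be lifted to one of order exactly \<open>s\<close> in \<open>G\<close>.\<close>

lemma complement_prime_element:
  assumes np: "\<not> p_group p (G Mod L)" and Q: "Q \<in> \<Q>"
  obtains y where "y \<in> carrier G" "prime (ord y)" "ord y \<noteq> p" "pr y \<in> Q" "y \<notin> L"
proof -
  have "finite Q" using up.complement_carrier[OF Q] up.finite_carrier by (rule finite_subset)
  then have "card Q > 0" using subgroup.one_closed[OF up.subgroup_complement[OF Q]] by (auto simp: card_gt_0_iff)
  moreover have "card Q \<noteq> p ^ k" for k using np card_complement_eq[OF Q] by (auto simp: p_group_def)
  ultimately obtain s where s: "prime s" "s \<noteq> p" "s dvd card Q"
    using exists_other_prime_divisor[OF _ p_prime] by blast
  obtain c where c: "c \<in> Q" "up.ord c = s"
    using up.cauchy[OF up.finite_carrier up.subgroup_complement[OF Q] s(1,3)] by blast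
  have cF: "c \<in> carrier F" using c up.complement_carrier[OF Q] by blast
  obtain g where g: "g \<in> carrier G" "c = pr g" using pr_surj[OF cF] by blast
  \<comment> \<open>For a lift \<open>g\<close> the power \<open>g^s\<close> lies in
    \<open>K\<close>, whose order is \<open>p^n\<close>; hence \<open>y^s = 1\<close>. The image of
    \<open>y\<close> remains nontrivial because \<open>s\<close> does not divide
    \<open>p^n\<close>.\<close>
  define y where "y = g [^] (p ^ n)"
  have yG: "y \<in> carrier G" using g by (simp add: y_def)
  have pry: "pr y = c [^]\<^bsub>F\<^esub> (p ^ n)" using g by (simp add: y_def pr_pow)
  then have yQ: "pr y \<in> Q" using up.subgroup_pow_closed[OF up.subgroup_complement[OF Q] c(1)] by simp
  have "c [^]\<^bsub>F\<^esub> s = \<one>\<^sub>F" using up.pow_ord_eq_1[OF cF] unfolding c(2) .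
  then have "pr (g [^] s) = \<one>\<^sub>F" unfolding g(2) pr_pow[OF g(1)] .
  then have "g [^] s \<in> K" using pr_eq_one_iff g by simp
  then have "(g [^] s) [^] (p ^ n) = \<one>" using ord_dvd_card_K pow_eq_id[of "g [^] s"] g by simp
  then have ys: "y [^] s = \<one>" using g by (simp add: y_def nat_pow_pow mult.commute)
  have "\<not> s dvd p ^ n" using s(1,2) p_prime prime_dvd_power primes_dvd_imp_eq by blast
  then have pry1: "pr y \<noteq> \<one>\<^sub>F" using pry up.pow_eq_id[OF cF] c(2) by simp
  then have "y \<noteq> \<one>" using pr_one by blast
  then have "ord y = s" using ord_prime_eqI[OF yG s(1) _ ys] by blast
  moreover have "y \<notin> L"
    using pry1 yQ up.complement_Int_kernel[OF Q] pr_mem_M_iff[OF yG] by blast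
  ultimately show thesis using that[OF yG] s(1,2) yQ by simp
qed

lemma not_linked_label:
  assumes "ord x = p" "\<nexists>y. linked x y"
  shows "label x = (2, {generate G {x}})"
  using assms L_minus_K_ord by (auto simp: label_def)

text \<open>\<open>u\<close> is the hub of the component: elements of prime order other than
  \<open>p\<close> over \<open>Q\<close> commute with it, and elements of order \<open>p\<close> get
  there through an element they are linked to.\<close>

lemma compl_fixed_reach:
  assumes u: "u \<in> K" "ord u = p" "\<And>g. g \<in> carrier G \<Longrightarrow> pr g \<in> Q \<Longrightarrow> g \<otimes> u = u \<otimes> g"
    and x: "x \<in> carrier G" "prime (ord x)" "label x = (1, Q)"
  shows "x \<leadsto> u"
proof -
  have uG: "u \<in> carrier G" "prime (ord u)" using u(1,2) p_prime by simp_all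
  have main: "y \<leadsto> u" if y: "y \<in> carrier G" "prime (ord y)" "ord y \<noteq> p" "y \<notin> L" "compl y = Q" for y
  proof (rule reach_commute[OF y(1,2) uG])
    show "y \<otimes> u = u \<otimes> y" using u(3)[OF y(1)] compl(2)[OF y(1,4)] y(5) by simp
    show "ord y \<noteq> ord u" using y u by simp
  qed
  have xLK: "x \<notin> L - K" using x(3) label_L_minus_K by (metis prod.inject zero_neq_one)
  show ?thesis
  proof (cases "ord x = p")
    case False
    have "x \<notin> L" using prime_ord_ne_p[OF x(2) False xLK] .
    moreover have "compl x = Q" using label_ne_p[OF x(2) False xLK] x(3) by simp
    ultimately show ?thesis using main[OF x(1,2) False] by blast
  next
    case True
    obtain y where y: "linked x y"
      using not_linked_label[OF True] x(3) by auto
    have "compl y = Q" using label_linked[OF x(1) True y] x(3) by simp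
    then have "y \<leadsto> u" using main[of y] linked_notin_L[OF x(1) True y] y by (simp add: linked_def)
    moreover have "x \<leadsto> y" using reach_commute[OF x(1,2), of y] y True by (simp add: linked_def)
    ultimately show ?thesis using D.reachable_trans by blast
  qed
qed

lemma label_cases:
  assumes "x \<in> carrier G" "prime (ord x)"
  obtains H where "H \<in> \<H>" "x \<in> H" "label x = (0, {H})"
    | Q where "Q \<in> \<Q>" "label x = (1, Q)"
    | "ord x = p" "\<nexists>y. linked x y" "label x = (2, {generate G {x}})"
proof (cases "x \<in> L - K")
  case True
  then obtain H where H: "H \<in> \<H>" "x \<in> H" "x \<noteq> \<one>" by (rule L_minus_K_E)
  then show thesis using that(1)[OF H(1,2)] label_L_minus_K[OF True] hconj_eq[OF H] by simp
next
  case xn: False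
  show thesis
  proof (cases "ord x = p")
    case False
    have "x \<notin> L" using prime_ord_ne_p[OF assms(2) False xn] .
    then show thesis using that(2)[OF compl(1)[OF assms(1)]] label_ne_p[OF assms(2) False xn] by simp
  next
    case True
    show thesis
    proof (cases "\<exists>y. linked x y")
      case ex: True
      then obtain y where y: "linked x y" by blast
      have "y \<in> carrier G" using y by (simp add: linked_def)
      then show thesis
        using that(2)[OF compl(1)[OF _ linked_notin_L[OF assms(1) True y]]] label_linked[OF assms(1) True y] by simp
    next
      case False
      then show thesis using that(3)[OF True] not_linked_label[OF True] by blast
    qed
  qed
qed

text \<open>Elements with equal labels meet at a hub: the central element of \<open>H\<close> for
  tag 0, and the element of \<open>K\<close> centralised by everything over \<open>Q\<close> for tag
  1. With tag 2 they generate the same group of order \<open>p\<close>.\<close>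

lemma label_reach:
  assumes x: "x \<in> carrier G" "prime (ord x)" and y: "y \<in> carrier G" "prime (ord y)"
    and eq: "label x = label y"
  shows "x \<leadsto> y"
  using x
proof (cases rule: label_cases)
  case (1 H)
  obtain h0 where h0: "h0 \<in> H" "prime (ord h0)" "\<And>h. h \<in> H \<Longrightarrow> h \<otimes> h0 = h0 \<otimes> h"
    "\<And>h. h \<in> H \<Longrightarrow> ord h = ord h0 \<Longrightarrow> h \<in> generate G {h0}"
    using H_central_element[OF 1(1)] by metis
  have h0G: "h0 \<in> carrier G" using h0(1) H_sub_G[OF 1(1)] by blast
  have to: "h0 \<leadsto> h" if h: "h \<in> H" "h \<in> carrier G" "prime (ord h)" for h
  proof (cases "ord h = ord h0")
    case True
    then show ?thesis using reach_generate[OF h0G h0(4)[OF h(1)] h(3)] by blast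
  next
    case False
    show ?thesis
      by (rule reach_commute[OF h0G h0(2) h(2,3) False[symmetric] h0(3)[OF h(1), symmetric]])
  qed
  have "y \<in> H"
    using y
  proof (cases rule: label_cases)
    case (1 H')
    then show ?thesis using eq \<open>label x = (0, {H})\<close> by simp
  qed (use eq \<open>label x = (0, {H})\<close> in simp_all)
  then have "h0 \<leadsto> y" using to y by blast
  moreover have "x \<leadsto> h0" using D.symmetric_reachable'[OF to[OF 1(2) x]] .
  ultimately show ?thesis using D.reachable_trans by blast
next
  case (2 Q)
  obtain u where u: "u \<in> K" "ord u = p" "\<forall>g\<in>carrier G. pr g \<in> Q \<longrightarrow> g \<otimes> u = u \<otimes> g"
    using complement_fixed_element[OF 2(1)] by blast
  have "x \<leadsto> u" by (rule compl_fixed_reach[OF u(1,2) _ x 2(2)]) (use u(3) in blast)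
  moreover have "y \<leadsto> u" by (rule compl_fixed_reach[OF u(1,2) _ y]) (use u(3) 2(2) eq in auto)
  ultimately show ?thesis using D.reachable_trans[OF _ D.symmetric_reachable'] by blast
next
  case 3
  have "generate G {y} = generate G {x}"
    using y
  proof (cases rule: label_cases)
    case 3
    then show ?thesis using eq \<open>label x = (2, {generate G {x}})\<close> by simp
  qed (use eq \<open>label x = (2, {generate G {x}})\<close> in simp_all)
  then have "y \<in> generate G {x}" using generate_singleton_mem by metis
  then show ?thesis using reach_generate[OF x(1) _ y(2)] by blast
qed

text \<open>Each summand of the final count is one tag. The tags keep the three kinds apart, and the
  singletons bring subgroups of \<open>G\<close> to the type of the complements in \<open>F\<close>,
  which are sets of cosets.\<close>

lemma label_image:
  assumes np: "\<not> p_group p (G Mod L)"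
  shows "label ` {x \<in> carrier G. prime (ord x)} =
    (\<lambda>H. (0, {H})) ` \<H> \<union> Pair 1 ` \<Q> \<union>
    (\<lambda>P. (2, {P})) ` {P. subgroup P G \<and> card P = p \<and>
      \<not> (\<exists>x \<in> carrier G. prime (ord x) \<and> ord x \<noteq> p \<and> (\<forall>y \<in> P. x \<otimes> y = y \<otimes> x))}"
    (is "?L = ?A \<union> ?B \<union> (\<lambda>P. (2, {P})) ` ?P")
proof (intro equalityI subsetI)
  fix l assume "l \<in> ?L"
  then obtain x where x: "x \<in> carrier G" "prime (ord x)" and l: "l = label x" by blast
  from x show "l \<in> ?A \<union> ?B \<union> (\<lambda>P. (2, {P})) ` ?P"
  proof (cases rule: label_cases)
    case 3
    have "generate G {x} \<in> ?P"
    proof (intro CollectI conjI notI)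
      show "subgroup (generate G {x}) G" using subgroup_generate_singleton[OF x(1)] .
      show "card (generate G {x}) = p" using generate_pow_card[OF x(1)] 3(1) by simp
      assume "\<exists>z\<in>carrier G. prime (ord z) \<and> ord z \<noteq> p \<and> (\<forall>y\<in>generate G {x}. z \<otimes> y = y \<otimes> z)"
      then obtain z where "z \<in> carrier G" "prime (ord z)" "ord z \<noteq> p" "z \<otimes> x = x \<otimes> z"
        using generate_singleton_mem by blast
      then have "linked x z" by (simp add: linked_def)
      then show False using 3(2) by blast
    qed
    then show ?thesis using l 3(3) by blast
  qed (use l in auto)
next
  fix l assume "l \<in> ?A \<union> ?B \<union> (\<lambda>P. (2, {P})) ` ?P"
  then consider H where "H \<in> \<H>" "l = (0, {H})" | Q where "Q \<in> \<Q>" "l = (1, Q)" | P where "P \<in> ?P" "l = (2, {P})"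
    by blast
  then show "l \<in> ?L"
  proof cases
    case (1 H)
    obtain h where h: "h \<in> H" "prime (ord h)" using H_central_element[OF 1(1)] by metis
    have "h \<in> L - K" using H_nontrivial_notin_K[OF 1(1) h(1) prime_ord_ne_one[OF h(2)]] .
    then have "label h = l" using label_L_minus_K hconj_eq[OF 1(1) h(1) prime_ord_ne_one[OF h(2)]] 1(2) by simp
    moreover have "h \<in> carrier G" using h H_sub_G[OF 1(1)] by blast
    ultimately show ?thesis using h(2) by blast
  next
    case (2 Q)
    obtain y where y: "y \<in> carrier G" "prime (ord y)" "ord y \<noteq> p" "pr y \<in> Q" "y \<notin> L"
      using complement_prime_element[OF np 2(1)] by metis
    have "label y = l" using label_ne_p[OF y(2,3)] compl_eq[OF 2(1) y(4,1,5)] y(5) 2(2) by simp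
    then show ?thesis using y by blast
  next
    case (3 P)
    then have P: "subgroup P G" "card P = p"
      and nc: "\<not> (\<exists>x \<in> carrier G. prime (ord x) \<and> ord x \<noteq> p \<and> (\<forall>y \<in> P. x \<otimes> y = y \<otimes> x))"
      by blast+
    obtain a where a: "a \<in> P" "ord a = p" using cauchy[OF finite_carrier P(1) p_prime] P(2) by auto
    have aG: "a \<in> carrier G" using subgroup.mem_carrier[OF P(1) a(1)] .
    have gen: "generate G {a} = P"
    proof (rule card_subset_eq)
      show "finite P" using finite_subset[OF subgroup.subset[OF P(1)] finite_carrier] .
      show "generate G {a} \<subseteq> P" using generate_singleton_subset[OF P(1) a(1)] .
      show "card (generate G {a}) = card P" using generate_pow_card[OF aG] a(2) P(2) by simp
    qed
    \<comment> \<open>Commuting with the generator \<open>a\<close> is the same as centralising all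
      of \<open>P\<close>.\<close>
    have "\<not> linked a z" for z
    proof
      assume "linked a z"
      then have z: "z \<in> carrier G" "prime (ord z)" "ord z \<noteq> p" "z \<otimes> a = a \<otimes> z" by (simp_all add: linked_def)
      have "z \<otimes> y = y \<otimes> z" if "y \<in> P" for y
      proof -
        have "y \<in> generate G {a}" using that gen by simp
        then obtain k :: nat where k: "y = a [^] k" using mem_generate_singleton_iff[OF finite_carrier aG] by blast
        show ?thesis unfolding k using commute_pow_right[OF z(1) aG z(4)] .
      qed
      then show False using nc z by blast
    qed
    then have "label a = l" using not_linked_label[OF a(2)] gen 3(2) by blast
    then show ?thesis using aG a(2) p_prime by blast
  qed
qed

lemma card_components:
  assumes np: "\<not> p_group p (G Mod L)"
  shows "card (connected_components (with_proj (cyclic_graph G))) = card K + card M + m_star G p"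
proof -
  let ?P = "{P. subgroup P G \<and> card P = p \<and>
      \<not> (\<exists>x \<in> carrier G. prime (ord x) \<and> ord x \<noteq> p \<and> (\<forall>y \<in> P. x \<otimes> y = y \<otimes> x))}"
  let ?A = "(\<lambda>H. (0::nat, {H})) ` \<H>" and ?B = "Pair (1::nat) ` \<Q>" and ?C = "(\<lambda>P. (2::nat, {P})) ` ?P"
  have "?P \<subseteq> Pow (carrier G)" using subgroup.subset by blast
  then have finP: "finite ?P" using finite_carrier by (simp add: finite_subset)
  have cA: "card ?A = card K" using lo.card_complements by (subst card_image) (auto simp: inj_on_def)
  have cB: "card ?B = card M" using up.card_complements by (subst card_image) (auto simp: inj_on_def)
  have cC: "card ?C = m_star G p" unfolding m_star_def by (subst card_image) (auto simp: inj_on_def)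
  have "card (connected_components (with_proj (cyclic_graph G))) = card (label ` {x \<in> carrier G. prime (ord x)})"
  proof (rule card_cyclic_graph_components[OF finite_carrier])
    show "label x = label y"
      if "x \<in> carrier G" "y \<in> carrier G" "prime (ord x)" "prime (ord y)" "ord x \<noteq> ord y" "x \<otimes> y = y \<otimes> x" for x y
      using label_commute[OF that(1,3,2,4-6)] .
    show "label x = label y"
      if "x \<in> carrier G" "prime (ord x)" "y \<in> generate G {x}" "ord y = ord x" for x y
      using label_generate[OF that] .
    show "x \<leadsto> y"
      if "x \<in> carrier G" "y \<in> carrier G" "prime (ord x)" "prime (ord y)" "label x = label y" for x y
      using label_reach[OF that(1,3,2,4,5)] .
  qed
  also have "\<dots> = card (?A \<union> ?B \<union> ?C)" unfolding label_image[OF np] ..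
  also have "\<dots> = card (?A \<union> ?B) + card ?C"
    using lo.finite_complements up.finite_complements finP by (intro card_Un_disjoint) auto
  also have "card (?A \<union> ?B) = card ?A + card ?B"
    using lo.finite_complements up.finite_complements by (intro card_Un_disjoint) auto
  finally show ?thesis unfolding cA cB cC .
qed

end

theorem theorem3:
  fixes G :: "('a, 'b) monoid_scheme" (structure) and K L :: "'a set" and p :: nat
  assumes "group G" and "finite (carrier G)"
    and "two_frobenius_group G K L"
    and "prime p"
    and "p_group p (G\<lparr>carrier := K\<rparr>)"
    and "\<not> p_group p (G Mod L)"
  shows "card (connected_components (with_proj (cyclic_graph G))) =
    card K + card (rcosets\<^bsub>G\<lparr>carrier := L\<rparr>\<^esub> K) + m_star G p"
proof -
  interpret group G by fact
  have KL: "K \<lhd> G" "L \<lhd> G" and lower: "frobenius_group_with_kernel (G\<lparr>carrier := L\<rparr>) K"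
    and upper: "frobenius_group_with_kernel (G Mod K) (carrier (G\<lparr>carrier := L\<rparr> Mod K))"
    using assms(3) by (simp_all add: two_frobenius_group_def)
  have subL: "subgroup L G" using KL(2) by (rule normal_imp_subgroup)
  have finL: "finite L" using subgroup.subset[OF subL] assms(2) by (rule finite_subset)
  have K_L: "K \<subseteq> L" using lower by (auto simp: frobenius_group_with_kernel_def frobenius_kernel_def)
  have M_eq: "rcosets\<^bsub>G\<lparr>carrier := L\<rparr>\<^esub> K = (\<lambda>l. K #> l) ` L" by (rule rcosets_restrict)
  interpret L: group "G\<lparr>carrier := L\<rparr>" using subL by (rule subgroup_imp_group)
  have "K \<lhd> G\<lparr>carrier := L\<rparr>" using normal_restrict_supergroup[OF subL KL(1) K_L] .
  then obtain \<H> where \<H>: "frobenius_partition (G\<lparr>carrier := L\<rparr>) K \<H>"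
    using L.frobenius_partition_exists[OF _ _ lower] finL by auto
  interpret FG: group "G Mod K" using KL(1) by (rule normal.factorgroup_is_group)
  have "(\<lambda>l. K #> l) ` L \<lhd> G Mod K"
    using normality_factorization[OF KL(1) K_L KL(2)] by (simp add: M_eq)
  moreover have "finite (carrier (G Mod K))" using assms(2) by (simp add: carrier_FactGroup)
  moreover have "frobenius_group_with_kernel (G Mod K) ((\<lambda>l. K #> l) ` L)"
    using upper M_eq by (simp add: FactGroup_def)
  ultimately obtain \<Q> where \<Q>: "frobenius_partition (G Mod K) ((\<lambda>l. K #> l) ` L) \<Q>"
    using FG.frobenius_partition_exists by blast
  obtain n where n: "card K = p ^ n" using assms(5) by (auto simp: p_group_def order_def)
  interpret T: two_frobenius_p G K L p n \<H> \<Q>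
    by (intro two_frobenius_p.intro two_frobenius_p_axioms.intro is_group assms(2) KL assms(4) n \<H> \<Q>)
  show ?thesis using T.card_components[OF assms(6)] by (simp add: M_eq T.M_def)
qed

end
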